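(* There is an absolute constant $C>0$ such that the following holds. Let $g\in M^*(\mathbb{R}^d)$ with $\|g\|_2=1$, let $\Omega\subset\mathbb{R}^{2d}$ be a compact set with finite perimeter, and assume that $\|g\|_{M^*}^2|\partial\Omega|\ge1$. Then for every $\delta>0$, $$\big|\{z\in\mathbb{R}^{2d}:|\rho_\Omega(z)-1_\Omega(z)|>\delta\}\big|\le\frac{C}{\delta^2}\|g\|_{M^*}^2|\partial\Omega|,$$ where $|\partial\Omega|$ is the perimeter of $\Omega$ and $\rho_\Omega$ is the accumulated spectrogram of $\Omega$ with respect to $g$.
   Context: For $f\in L^2(\mathbb{R}^d)$ and $z=(x,\xi)\in\mathbb{R}^d\times\mathbb{R}^d$, the short-time Fourier transform is $V_gf(x,\xi)=\int_{\mathbb{R}^d}f(t)\overline{g(t-x)}e^{-2\pi i\xi\cdot t}\,dt$. For compact $\Omega\subset\mathbb{R}^{2d}$, the time-frequency localization operator $H_\Omega$ on $L^2(\mathbb{R}^d)$ is $H_\Omega f(t)=\int_\Omega V_gf(x,\xi)g(t-x)e^{2\pi i\xi\cdot t}\,dx\,d\xi$, i.e. $H_\Omega f=V_g^*(1_\Omega\cdot V_gf)$; it is a compact positive operator. Let $\lambda_1^\Omega\ge\lambda_2^\Omega\ge\dots$ be its non-zero eigenvalues, counted with multiplicity and ordered non-increasingly, and $\{h_k^\Omega\}_{k\ge1}$ a corresponding orthonormal set of eigenfunctions. $|E|$ denotes the Lebesgue measure of a set $E$, and $A_\Omega=\lceil|\Omega|\rceil$ is the smallest integer $\ge|\Omega|$.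 The accumulated spectrogram of $\Omega$ (with respect to $g$) is $\rho_\Omega(z)=\sum_{k=1}^{A_\Omega}|V_gh_k^\Omega(z)|^2$, $z\in\mathbb{R}^{2d}$. $M^*(\mathbb{R}^d)$ is the class of $g\in L^2(\mathbb{R}^d)$ with $\|g\|_{M^*}^2:=\int_{\mathbb{R}^{2d}}|z|\,|V_gg(z)|^2\,dz<+\infty$ ($|z|$ the Euclidean norm). For real-valued $f\in L^1(\mathbb{R}^n)$, $\mathrm{Var}(f)=\sup\{\int_{\mathbb{R}^n}f\,\mathrm{div}\,\phi\,dx:\phi\in C_c^1(\mathbb{R}^n,\mathbb{R}^n),\ |\phi(x)|\le1\ \forall x\}$ (Euclidean norm). A set $\Omega\subset\mathbb{R}^{2d}$ has finite perimeter if $1_\Omega$ has bounded variation, and then its perimeter is $|\partial\Omega|:=\mathrm{Var}(1_\Omega)$. *)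

theory Defs
  imports "HOL-Analysis.Analysis" "HOL-Library.Extended_Nat"
begin

text \<open>
  The constant of the theorem does not depend on the dimension, so the dimension must be a
  natural number that can be quantified inside a formula. A point of \<open>\<real>\<^sup>n\<close> is therefore a
  function in \<open>{..<n} \<rightarrow>\<^sub>E UNIV\<close>, the Euclidean norm is \<^const>\<open>L2_set\<close> over \<open>{..<n}\<close>, and the
  measure and the topology are the library's finite products.

  The measure lives on the Borel sets. Elements of \<open>L\<^sup>2\<close> are represented by Borel functions
  (every class has such a representative) and are compared almost everywhere.
\<close>

definition leb :: "nat \<Rightarrow> (nat \<Rightarrow> real) measure" where
  "leb n = PiM {..<n} (\<lambda>_. lborel)"

definition euc_top :: "nat \<Rightarrow> (nat \<Rightarrow> real) topology" where
  "euc_top n = product_topology (\<lambda>_. euclideanreal) {..<n}"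

definition vdiff :: "nat \<Rightarrow> (nat \<Rightarrow> real) \<Rightarrow> (nat \<Rightarrow> real) \<Rightarrow> nat \<Rightarrow> real" where
  "vdiff n x y = (\<lambda>i\<in>{..<n}. x i - y i)"

definition dotp :: "nat \<Rightarrow> (nat \<Rightarrow> real) \<Rightarrow> (nat \<Rightarrow> real) \<Rightarrow> real" where
  "dotp n x y = (\<Sum>i<n. x i * y i)"


subsection \<open>Square-integrable functions\<close>

definition L2 :: "nat \<Rightarrow> ((nat \<Rightarrow> real) \<Rightarrow> complex) set" where
  "L2 d = {f \<in> borel_measurable (leb d). integrable (leb d) (\<lambda>t. (cmod (f t))\<^sup>2)}"

definition l2norm :: "nat \<Rightarrow> ((nat \<Rightarrow> real) \<Rightarrow> complex) \<Rightarrow> real" where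
  "l2norm d f = sqrt (LINT t|leb d. (cmod (f t))\<^sup>2)"

definition l2inner ::
  "nat \<Rightarrow> ((nat \<Rightarrow> real) \<Rightarrow> complex) \<Rightarrow> ((nat \<Rightarrow> real) \<Rightarrow> complex) \<Rightarrow> complex" where
  "l2inner d f h = (LINT t|leb d. f t * cnj (h t))"


subsection \<open>Time-frequency analysis\<close>

text \<open>
  A point \<open>z = (x, \<xi>)\<close> of phase space is a single point of \<open>\<real>\<^sup>2\<^sup>d\<close>: its first \<open>d\<close> coordinates
  are \<open>x\<close>, the last \<open>d\<close> are \<open>\<xi>\<close>.
\<close>

definition tpart :: "nat \<Rightarrow> (nat \<Rightarrow> real) \<Rightarrow> nat \<Rightarrow> real" where
  "tpart d z = (\<lambda>i\<in>{..<d}. z i)"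

definition fpart :: "nat \<Rightarrow> (nat \<Rightarrow> real) \<Rightarrow> nat \<Rightarrow> real" where
  "fpart d z = (\<lambda>i\<in>{..<d}. z (d + i))"

definition stft ::
  "nat \<Rightarrow> ((nat \<Rightarrow> real) \<Rightarrow> complex) \<Rightarrow> ((nat \<Rightarrow> real) \<Rightarrow> complex) \<Rightarrow> (nat \<Rightarrow> real) \<Rightarrow> complex" where
  "stft d g f z =
    (LINT t|leb d. f t * cnj (g (vdiff d t (tpart d z))) * cis (- (2 * pi * dotp d (fpart d z) t)))"

definition loc_op ::
  "nat \<Rightarrow> ((nat \<Rightarrow> real) \<Rightarrow> complex) \<Rightarrow> (nat \<Rightarrow> real) set
    \<Rightarrow> ((nat \<Rightarrow> real) \<Rightarrow> complex) \<Rightarrow> (nat \<Rightarrow> real) \<Rightarrow> complex" where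
  "loc_op d g \<Omega> f t =
    (LINT z:\<Omega>|leb (2 * d). stft d g f z * g (vdiff d t (tpart d z)) * cis (2 * pi * dotp d (fpart d z) t))"

definition Mstar :: "nat \<Rightarrow> ((nat \<Rightarrow> real) \<Rightarrow> complex) set" where
  "Mstar d = {g \<in> L2 d. integrable (leb (2 * d)) (\<lambda>z. L2_set z {..<2 * d} * (cmod (stft d g g z))\<^sup>2)}"

definition Mstar_norm :: "nat \<Rightarrow> ((nat \<Rightarrow> real) \<Rightarrow> complex) \<Rightarrow> real" where
  "Mstar_norm d g = sqrt (LINT z|leb (2 * d). L2_set z {..<2 * d} * (cmod (stft d g g z))\<^sup>2)"


subsection \<open>Eigensystem and accumulated spectrogram\<close>

text \<open>
  The non-zero eigenvalues are indexed by \<open>1 \<le> k \<le> N\<close>, where \<open>N = \<infinity>\<close> is allowed; a finite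
  \<open>N\<close> covers an operator of finite rank.
\<close>

definition eig_index :: "enat \<Rightarrow> nat set" where
  "eig_index N = {k. 1 \<le> k \<and> enat k \<le> N}"

text \<open>
  The last conjunct says that all non-zero eigenvalues occur, with their multiplicity: the
  \<open>h k\<close> with \<open>ev k = \<mu>\<close> span the eigenspace of \<open>\<mu>\<close>, hence form an orthonormal basis of it.
\<close>

definition eigensystem ::
  "nat \<Rightarrow> ((nat \<Rightarrow> real) \<Rightarrow> complex) \<Rightarrow> (nat \<Rightarrow> real) set
    \<Rightarrow> enat \<Rightarrow> (nat \<Rightarrow> real) \<Rightarrow> (nat \<Rightarrow> (nat \<Rightarrow> real) \<Rightarrow> complex) \<Rightarrow> bool" where
  "eigensystem d g \<Omega> N ev h \<longleftrightarrow>
    (\<forall>k\<in>eig_index N. ev k \<noteq> 0 \<and> h k \<in> L2 d \<and>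
        (AE t in leb d. loc_op d g \<Omega> (h k) t = complex_of_real (ev k) * h k t)) \<and>
    (\<forall>j\<in>eig_index N. \<forall>k\<in>eig_index N. j \<le> k \<longrightarrow> ev k \<le> ev j) \<and>
    (\<forall>j\<in>eig_index N. \<forall>k\<in>eig_index N. l2inner d (h j) (h k) = (if j = k then 1 else 0)) \<and>
    (\<forall>\<mu>::complex. \<mu> \<noteq> 0 \<longrightarrow>
        finite {k \<in> eig_index N. complex_of_real (ev k) = \<mu>} \<and>
        (\<forall>f\<in>L2 d. (AE t in leb d. loc_op d g \<Omega> f t = \<mu> * f t) \<longrightarrow>
          (\<exists>c. AE t in leb d. f t = (\<Sum>k\<in>{k \<in> eig_index N. complex_of_real (ev k) = \<mu>}. c k * h k t))))"

definition acc_spectrogram ::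
  "nat \<Rightarrow> ((nat \<Rightarrow> real) \<Rightarrow> complex) \<Rightarrow> (nat \<Rightarrow> real) set
    \<Rightarrow> enat \<Rightarrow> (nat \<Rightarrow> (nat \<Rightarrow> real) \<Rightarrow> complex) \<Rightarrow> (nat \<Rightarrow> real) \<Rightarrow> real" where
  "acc_spectrogram d g \<Omega> N h z =
    (\<Sum>k\<in>eig_index N \<inter> {1..nat \<lceil>measure (leb (2 * d)) \<Omega>\<rceil>}. (cmod (stft d g (h k) z))\<^sup>2)"


subsection \<open>Bounded variation\<close>

definition partial_deriv :: "nat \<Rightarrow> ((nat \<Rightarrow> real) \<Rightarrow> real) \<Rightarrow> (nat \<Rightarrow> real) \<Rightarrow> real" where
  "partial_deriv i f x = deriv (\<lambda>s. f (x(i := s))) (x i)"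

definition C1_c :: "nat \<Rightarrow> ((nat \<Rightarrow> real) \<Rightarrow> real) set" where
  "C1_c n = {f. continuous_map (euc_top n) euclideanreal f \<and>
    (\<forall>i<n. (\<forall>x\<in>topspace (euc_top n). (\<lambda>s. f (x(i := s))) differentiable (at (x i))) \<and>
           continuous_map (euc_top n) euclideanreal (partial_deriv i f)) \<and>
    (\<exists>K. compactin (euc_top n) K \<and> (\<forall>x\<in>topspace (euc_top n) - K. f x = 0))}"

text \<open>The \<open>i\<close>-th component of a vector field \<open>\<phi>\<close> is \<open>\<lambda>x. \<phi> x i\<close>.\<close>

definition test_fields :: "nat \<Rightarrow> ((nat \<Rightarrow> real) \<Rightarrow> nat \<Rightarrow> real) set" where
  "test_fields n = {\<phi>. (\<forall>i<n. (\<lambda>x. \<phi> x i) \<in> C1_c n) \<and>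
    (\<forall>x\<in>topspace (euc_top n). L2_set (\<phi> x) {..<n} \<le> 1)}"

definition divergence :: "nat \<Rightarrow> ((nat \<Rightarrow> real) \<Rightarrow> nat \<Rightarrow> real) \<Rightarrow> (nat \<Rightarrow> real) \<Rightarrow> real" where
  "divergence n \<phi> x = (\<Sum>i<n. partial_deriv i (\<lambda>y. \<phi> y i) x)"

definition variation :: "nat \<Rightarrow> ((nat \<Rightarrow> real) \<Rightarrow> real) \<Rightarrow> ereal" where
  "variation n f = (SUP \<phi>\<in>test_fields n. ereal (LINT x|leb n. f x * divergence n \<phi> x))"

definition finite_perimeter :: "nat \<Rightarrow> (nat \<Rightarrow> real) set \<Rightarrow> bool" where
  "finite_perimeter n \<Omega> \<longleftrightarrow>
    integrable (leb n) (indicator \<Omega> :: _ \<Rightarrow> real) \<and> variation n (indicator \<Omega>) < \<infinity>"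

definition perimeter :: "nat \<Rightarrow> (nat \<Rightarrow> real) set \<Rightarrow> real" where
  "perimeter n \<Omega> = real_of_ereal (variation n (indicator \<Omega>))"

end

(*
  Let H be the localization operator, lambda_k its eigenvalues and h_k its eigenfunctions. The
  operator H has the same non-zero spectrum as the integral operator on L^2(Omega) whose kernel is
  the Gram kernel of the time-frequency atoms g_z; the functions V_g h_k are its eigenfunctions.
  A bounded Hermitian kernel that is not almost everywhere zero has a non-zero eigenvalue (the
  normalized iterated kernels converge uniformly), so the hypothesis that all non-zero eigenvalues
  are listed forces sum_k lambda_k^2 to be the squared L^2 norm of the Gram kernel. Because
  |<g_w, g_z>| = |V_g g (z - w)| and V_g g has norm 1, the number |Omega| - sum_k lambda_k^2 is the
  integral of |V_g g (u)|^2 |Omega minus (Omega + u)| over u, which is at most the product P of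
  ||g||_{M*}^2 and the perimeter, since translating Omega by u removes at most |u| times its perimeter.

  If T = |Omega| - sum_{k <= A} lambda_k, then T <= |Omega| - sum_k lambda_k^2 <= P, and
  ||rho - 1_Omega||_1 <= 2 T + 1 <= 3 P. As 0 <= rho <= 1, only delta < 1 matters, and there
  Markov's inequality gives 3 P / delta <= 3 P / delta^2.
*)

theory Submission
  imports Defs "HOL-Probability.Probability"
begin

section \<open>Square-integrable functions\<close>

text \<open>The eigensystem is given, not constructed, so the obstacle is completeness: no part of
  the Gram kernel may escape the listed eigenvalues. With phi_k = V_g h_k on Omega, the remainder of
  the Gram kernel after subtracting all phi_k(z) conj(phi_k(w)) is bounded, Hermitian and
  annihilates every phi_k. A non-zero remainder has an eigenvector v; v is orthogonal to all phi_k,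
  hence an eigenvector of the Gram kernel too, and synthesis from v gives an eigenfunction of H
  orthogonal to every h_k, which the hypothesis excludes. The eigenvector comes from traces:
  Hilbert-Schmidt products of powers of T depend only on the sum of the exponents, so one convergent
  sequence of numbers controls the distances between normalized powers. Even powers are used because
  both square roots of the top eigenvalue q of T^2 may be eigenvalues of T. The unit mass of V_g g
  is needed from below: less mass would leave part of |Omega| unaccounted for. Gaussian
  regularization reduces this to the value at 0 of the autocorrelation of g, which weak continuity
  of translations provides. The 1 in 2 T + 1 is the cost of rounding |Omega| up to A.\<close>

definition sq_int :: "'a measure \<Rightarrow> ('a \<Rightarrow> complex) \<Rightarrow> bool" where
  "sq_int M f \<longleftrightarrow> f \<in> borel_measurable M \<and> integrable M (\<lambda>x. (cmod (f x))\<^sup>2)"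

text \<open>The measure is a parameter because these notions are used on R^d, on Omega with the
  restricted phase-space measure, and on the square of that space. Linear in the first argument,
  conjugate-linear in the second.\<close>

definition ip :: "'a measure \<Rightarrow> ('a \<Rightarrow> complex) \<Rightarrow> ('a \<Rightarrow> complex) \<Rightarrow> complex" where
  "ip M f g = (LINT x|M. f x * cnj (g x))"

definition nsq :: "'a measure \<Rightarrow> ('a \<Rightarrow> complex) \<Rightarrow> real" where
  "nsq M f = (LINT x|M. (cmod (f x))\<^sup>2)"

lemma borel_measurable_cnj[measurable (raw)]:
  "f \<in> borel_measurable M \<Longrightarrow> (\<lambda>x. cnj (f x)) \<in> borel_measurable M"
  by (rule borel_measurable_continuous_on[of cnj]) (intro continuous_intros)

lemma sq_int_measurable[measurable_dest]: "sq_int M f \<Longrightarrow> f \<in> borel_measurable M"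
  by (simp add: sq_int_def)

lemma sq_int_integrable: "sq_int M f \<Longrightarrow> integrable M (\<lambda>x. (cmod (f x))\<^sup>2)"
  by (simp add: sq_int_def)

lemma nsq_nonneg[simp]: "0 \<le> nsq M f"
  by (simp add: nsq_def)

lemma sq_int_bound:
  assumes "f \<in> borel_measurable M" "integrable M b" "\<And>x. x \<in> space M \<Longrightarrow> (cmod (f x))\<^sup>2 \<le> b x"
  shows "sq_int M f"
proof -
  have "integrable M (\<lambda>x. (cmod (f x))\<^sup>2)"
    by (rule Bochner_Integration.integrable_bound[OF assms(2)])
       (use assms(1,3) in \<open>auto intro!: AE_I2 order_trans[OF _ abs_ge_self]\<close>)
  with assms(1) show ?thesis by (simp add: sq_int_def)
qed

lemma two_mult_le_squares: "2 * (a * b) \<le> a\<^sup>2 + (b::real)\<^sup>2"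
  using sum_squares_bound[of a b] by (simp add: mult.assoc)

lemma mult_le_half_squares: "a * b \<le> (a\<^sup>2 + (b::real)\<^sup>2) / 2"
  using two_mult_le_squares[of a b] by simp

lemma integrable_mult_cnj:
  assumes f: "sq_int M f" and g: "sq_int M g"
  shows "integrable M (\<lambda>x. f x * cnj (g x))"
proof (rule Bochner_Integration.integrable_bound[of _ "\<lambda>x. (cmod (f x))\<^sup>2 + (cmod (g x))\<^sup>2"])
  note [measurable] = f[THEN sq_int_measurable] g[THEN sq_int_measurable]
  show "integrable M (\<lambda>x. (cmod (f x))\<^sup>2 + (cmod (g x))\<^sup>2)"
    using f g by (auto simp: sq_int_def)
  show "(\<lambda>x. f x * cnj (g x)) \<in> borel_measurable M" by measurable
  show "AE x in M. norm (f x * cnj (g x)) \<le> norm ((cmod (f x))\<^sup>2 + (cmod (g x))\<^sup>2)"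
  proof (rule AE_I2)
    fix x
    have "cmod (f x) * cmod (g x) \<ge> 0" by simp
    with two_mult_le_squares[of "cmod (f x)" "cmod (g x)"]
    show "norm (f x * cnj (g x)) \<le> norm ((cmod (f x))\<^sup>2 + (cmod (g x))\<^sup>2)"
      unfolding norm_mult complex_mod_cnj real_norm_def by linarith
  qed
qed

lemma integrable_cmod_mult:
  assumes f: "sq_int M f" and g: "sq_int M g"
  shows "integrable M (\<lambda>x. cmod (f x) * cmod (g x))"
  using integrable_norm[OF integrable_mult_cnj[OF f g]] by (simp add: norm_mult)

lemma sq_int_cmult: "sq_int M f \<Longrightarrow> sq_int M (\<lambda>x. c * f x)"
  by (auto simp: sq_int_def norm_mult power_mult_distrib)

lemma sq_int_add:
  assumes f: "sq_int M f" and g: "sq_int M g"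
  shows "sq_int M (\<lambda>x. f x + g x)"
proof (rule sq_int_bound[of _ _ "\<lambda>x. 2 * (cmod (f x))\<^sup>2 + 2 * (cmod (g x))\<^sup>2"])
  note [measurable] = f[THEN sq_int_measurable] g[THEN sq_int_measurable]
  show "integrable M (\<lambda>x. 2 * (cmod (f x))\<^sup>2 + 2 * (cmod (g x))\<^sup>2)"
    using f g by (auto simp: sq_int_def)
  show "(\<lambda>x. f x + g x) \<in> borel_measurable M" by measurable
  fix x
  have "(cmod (f x + g x))\<^sup>2 \<le> (cmod (f x) + cmod (g x))\<^sup>2"
    by (intro power_mono norm_triangle_ineq) auto
  also have "\<dots> \<le> 2 * (cmod (f x))\<^sup>2 + 2 * (cmod (g x))\<^sup>2"
    using two_mult_le_squares[of "cmod (f x)" "cmod (g x)"] by (simp add: power2_sum)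
  finally show "(cmod (f x + g x))\<^sup>2 \<le> 2 * (cmod (f x))\<^sup>2 + 2 * (cmod (g x))\<^sup>2" .
qed

lemma sq_int_zero[simp]: "sq_int M (\<lambda>x. 0)"
  by (simp add: sq_int_def)

lemma sq_int_diff: "sq_int M f \<Longrightarrow> sq_int M g \<Longrightarrow> sq_int M (\<lambda>x. f x - g x)"
  using sq_int_add[of M f "\<lambda>x. (-1) * g x"] sq_int_cmult[of M g "-1"] by simp

lemma sq_int_sum: "(\<And>i. i \<in> I \<Longrightarrow> sq_int M (f i)) \<Longrightarrow> sq_int M (\<lambda>x. \<Sum>i\<in>I. f i x)"
  by (induction I rule: infinite_finite_induct) (auto intro: sq_int_add)

section \<open>Inner products, Cauchy-Schwarz and orthogonal expansions\<close>

lemma cnj_ip: "cnj (ip M f g) = ip M g f"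
  unfolding ip_def by (simp add: mult.commute flip: Bochner_Integration.integral_cnj)

lemma ip_self: "ip M f f = of_real (nsq M f)"
  unfolding ip_def nsq_def by (simp add: complex_norm_square[symmetric] flip: of_real_power integral_complex_of_real)

lemma ip_add_left:
  "sq_int M f \<Longrightarrow> sq_int M g \<Longrightarrow> sq_int M h \<Longrightarrow> ip M (\<lambda>x. f x + g x) h = ip M f h + ip M g h"
  unfolding ip_def by (simp add: distrib_right integrable_mult_cnj)

lemma ip_diff_left:
  "sq_int M f \<Longrightarrow> sq_int M g \<Longrightarrow> sq_int M h \<Longrightarrow> ip M (\<lambda>x. f x - g x) h = ip M f h - ip M g h"
  unfolding ip_def by (simp add: left_diff_distrib integrable_mult_cnj)

lemma ip_diff_right:
  "sq_int M f \<Longrightarrow> sq_int M g \<Longrightarrow> sq_int M h \<Longrightarrow> ip M h (\<lambda>x. f x - g x) = ip M h f - ip M h g"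
  unfolding ip_def by (simp add: right_diff_distrib integrable_mult_cnj)

lemma ip_cmult_left: "ip M (\<lambda>x. c * f x) g = c * ip M f g"
  unfolding ip_def by (simp add: mult.assoc)

lemma ip_sum_left:
  assumes "\<And>i. i \<in> I \<Longrightarrow> sq_int M (f i)" "sq_int M g"
  shows "ip M (\<lambda>x. \<Sum>i\<in>I. f i x) g = (\<Sum>i\<in>I. ip M (f i) g)"
  unfolding ip_def sum_distrib_right
  by (rule Bochner_Integration.integral_sum) (use assms in \<open>auto intro: integrable_mult_cnj\<close>)

lemma ip_sum_right:
  assumes "\<And>i. i \<in> I \<Longrightarrow> sq_int M (f i)" "sq_int M g"
  shows "ip M g (\<lambda>x. \<Sum>i\<in>I. f i x) = (\<Sum>i\<in>I. ip M g (f i))"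
  unfolding ip_def cnj_sum sum_distrib_left
  by (rule Bochner_Integration.integral_sum) (use assms in \<open>auto intro: integrable_mult_cnj\<close>)

lemma ip_cong_AE:
  assumes "AE x in M. f x = f' x" "AE x in M. g x = g' x"
    "sq_int M f" "sq_int M f'" "sq_int M g" "sq_int M g'"
  shows "ip M f g = ip M f' g'"
  unfolding ip_def
  by (rule integral_cong_AE) (use assms in \<open>auto intro: borel_measurable_integrable integrable_mult_cnj\<close>)

lemma Cauchy_Schwarz_integral:
  assumes f: "sq_int M f" and g: "sq_int M g"
  shows "(LINT x|M. cmod (f x) * cmod (g x))\<^sup>2 \<le> nsq M f * nsq M g"
proof -
  note [measurable] = f[THEN sq_int_measurable] g[THEN sq_int_measurable]
  have "(\<integral>\<^sup>+x. ennreal (cmod (f x)) * ennreal (cmod (g x)) \<partial>M)\<^sup>2 \<le>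
      (\<integral>\<^sup>+x. (ennreal (cmod (f x)))\<^sup>2 \<partial>M) * (\<integral>\<^sup>+x. (ennreal (cmod (g x)))\<^sup>2 \<partial>M)"
    by (rule Cauchy_Schwarz_nn_integral) measurable
  moreover have "(\<integral>\<^sup>+x. ennreal (cmod (f x)) * ennreal (cmod (g x)) \<partial>M)
      = ennreal (LINT x|M. cmod (f x) * cmod (g x))"
    by (subst nn_integral_eq_integral[symmetric, OF integrable_cmod_mult[OF f g]])
       (auto simp: ennreal_mult)
  moreover have "(\<integral>\<^sup>+x. (ennreal (cmod (f x)))\<^sup>2 \<partial>M) = ennreal (nsq M f)" if "sq_int M f" for f
    unfolding nsq_def
    by (subst nn_integral_eq_integral[symmetric, OF sq_int_integrable[OF that]]) (auto simp: ennreal_power)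
  ultimately show ?thesis
    using f g by (simp add: ennreal_power integral_nonneg_AE flip: ennreal_mult)
qed

lemma Cauchy_Schwarz_ip:
  assumes f: "sq_int M f" and g: "sq_int M g"
  shows "(cmod (ip M f g))\<^sup>2 \<le> nsq M f * nsq M g"
proof -
  have "cmod (ip M f g) \<le> (LINT x|M. cmod (f x) * cmod (g x))"
    unfolding ip_def by (rule order_trans[OF integral_norm_bound]) (simp add: norm_mult)
  then have "(cmod (ip M f g))\<^sup>2 \<le> (LINT x|M. cmod (f x) * cmod (g x))\<^sup>2"
    by (intro power_mono) auto
  with Cauchy_Schwarz_integral[OF assms] show ?thesis by linarith
qed

lemma nsq_diff:
  assumes f: "sq_int M f" and g: "sq_int M g"
  shows "nsq M (\<lambda>x. f x - g x) = nsq M f - 2 * Re (ip M f g) + nsq M g"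
proof -
  have "complex_of_real (nsq M (\<lambda>x. f x - g x)) = ip M f f - ip M f g - (ip M g f - ip M g g)"
    unfolding ip_self[symmetric] using f g by (simp add: ip_diff_left ip_diff_right sq_int_diff)
  also have "ip M g f = cnj (ip M f g)" by (simp add: cnj_ip)
  finally have "Re (complex_of_real (nsq M (\<lambda>x. f x - g x)))
      = Re (ip M f f - ip M f g - (cnj (ip M f g) - ip M g g))"
    by (rule arg_cong)
  then show ?thesis by (simp add: ip_self)
qed

text \<open>For the finite sum S both \<open>ip M f S\<close> and \<open>ip M S S\<close> equal the
  sum of c |a|^2, so the cross terms remove it exactly once. The squared norms \<open>c k\<close>
  are kept general: Bessel's inequality takes them equal to 1, while the orthogonal pieces of the
  Gram kernel have the squared eigenvalues as squared norms.\<close>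

lemma nsq_diff_orthogonal_expansion:
  fixes a :: "'i \<Rightarrow> complex" and c :: "'i \<Rightarrow> real"
  assumes fin: "finite J" and f: "sq_int M f" and e: "\<And>k. k \<in> J \<Longrightarrow> sq_int M (e k)"
    and ortho: "\<And>j k. j \<in> J \<Longrightarrow> k \<in> J \<Longrightarrow> ip M (e j) (e k) = (if j = k then of_real (c k) else 0)"
    and coef: "\<And>k. k \<in> J \<Longrightarrow> ip M f (e k) = of_real (c k) * a k"
  shows "nsq M (\<lambda>x. f x - (\<Sum>k\<in>J. a k * e k x)) = nsq M f - (\<Sum>k\<in>J. c k * (cmod (a k))\<^sup>2)"
proof -
  let ?S = "\<lambda>x. \<Sum>k\<in>J. a k * e k x"
  have S: "sq_int M ?S" using e by (auto intro!: sq_int_sum sq_int_cmult)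
  have sum1: "(\<Sum>k\<in>J. cnj (a k) * (of_real (c k) * a k)) = of_real (\<Sum>k\<in>J. c k * (cmod (a k))\<^sup>2)"
    unfolding of_real_sum of_real_mult complex_norm_square by (rule sum.cong) (auto simp: mult_ac)
  have ip_right: "ip M u ?S = (\<Sum>k\<in>J. cnj (a k) * ip M u (e k))" if "sq_int M u" for u
  proof -
    have "ip M u ?S = (\<Sum>k\<in>J. ip M u (\<lambda>x. a k * e k x))"
      using e that by (intro ip_sum_right) (auto intro: sq_int_cmult)
    also have "\<dots> = (\<Sum>k\<in>J. cnj (a k) * ip M u (e k))"
      by (rule sum.cong) (auto simp: ip_def mult_ac simp flip: integral_mult_right_zero)
    finally show ?thesis .
  qed
  have fS: "ip M f ?S = of_real (\<Sum>k\<in>J. c k * (cmod (a k))\<^sup>2)"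
    unfolding ip_right[OF f] sum1[symmetric] by (rule sum.cong) (auto simp: coef mult_ac)
  have "ip M ?S (e k) = of_real (c k) * a k" if "k \<in> J" for k
  proof -
    have "ip M ?S (e k) = (\<Sum>j\<in>J. a j * ip M (e j) (e k))"
      using e that by (subst ip_sum_left) (auto intro: sq_int_cmult simp: ip_cmult_left)
    also have "\<dots> = (\<Sum>j\<in>J. if j = k then a j * of_real (c k) else 0)"
      by (rule sum.cong) (auto simp: ortho that)
    finally show ?thesis using fin that by simp
  qed
  then have "ip M ?S ?S = of_real (\<Sum>k\<in>J. c k * (cmod (a k))\<^sup>2)"
    unfolding ip_right[OF S] sum1[symmetric] by (intro sum.cong) auto
  then have "nsq M ?S = (\<Sum>k\<in>J. c k * (cmod (a k))\<^sup>2)"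
    unfolding ip_self of_real_eq_iff .
  with nsq_diff[OF f S] fS show ?thesis by simp
qed

lemma Bessel_inequality:
  assumes fin: "finite J" and f: "sq_int M f" and e: "\<And>k. k \<in> J \<Longrightarrow> sq_int M (e k)"
    and ortho: "\<And>j k. j \<in> J \<Longrightarrow> k \<in> J \<Longrightarrow> ip M (e j) (e k) = (if j = k then 1 else 0)"
  shows "(\<Sum>k\<in>J. (cmod (ip M f (e k)))\<^sup>2) \<le> nsq M f"
  using nsq_diff_orthogonal_expansion[OF fin f e, where c = "\<lambda>_. 1" and a = "\<lambda>k. ip M f (e k)"]
    nsq_nonneg[of M "\<lambda>x. f x - (\<Sum>k\<in>J. ip M f (e k) * e k x)"] ortho
  by simp

lemma sq_int_finite_measure:
  assumes "finite_measure M" "f \<in> borel_measurable M" "\<And>x. x \<in> space M \<Longrightarrow> cmod (f x) \<le> B"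
  shows "sq_int M f"
proof (rule sq_int_bound[OF assms(2)])
  show "integrable M (\<lambda>_. B\<^sup>2)" using assms(1) by (simp add: finite_measure.integrable_const)
  show "(cmod (f x))\<^sup>2 \<le> B\<^sup>2" if "x \<in> space M" for x using assms(3)[OF that] by (intro power_mono) auto
qed

lemma nsq_zero_iff:
  assumes "sq_int M f"
  shows "nsq M f = 0 \<longleftrightarrow> (AE x in M. f x = 0)"
  unfolding nsq_def
  by (subst integral_nonneg_eq_0_iff_AE) (use assms in \<open>auto simp: sq_int_def\<close>)

section \<open>Growth of log-convex submultiplicative sequences\<close>

text \<open>Log-convexity makes the ratios a(n+1)/a(n) increase, submultiplicativity bounds them by
  a(0), and q is their limit. The model is a(n) = sum of mu^(2n+2) over the eigenvalues mu of an
  operator: then q is the largest mu^2, and the normalized sequence decreases to the number of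
  eigenvalues attaining it, hence stays at least 1.\<close>

lemma log_convex_submultiplicative_rate:
  fixes a :: "nat \<Rightarrow> real"
  assumes pos: "\<And>n. 0 < a n" and conv: "\<And>n. (a (Suc n))\<^sup>2 \<le> a n * a (Suc (Suc n))"
    and sub: "\<And>n m. a (Suc (n + m)) \<le> a n * a m"
  obtains q where "0 < q" "decseq (\<lambda>n. a n / q ^ Suc n)" "\<And>n. 1 \<le> a n / q ^ Suc n"
proof -
  define \<rho> where "\<rho> n = a (Suc n) / a n" for n
  have \<rho>_pos: "0 < \<rho> n" for n by (simp add: \<rho>_def pos)
  have "\<rho> n \<le> \<rho> (Suc n)" for n
    using conv[of n] pos[of n] pos[of "Suc n"] by (simp add: \<rho>_def field_simps power2_eq_square)
  then have inc: "incseq \<rho>" by (rule incseq_SucI)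
  have "\<rho> n \<le> a 0" for n
    using sub[of n 0] pos[of n] by (simp add: \<rho>_def field_simps)
  then obtain q where q: "\<rho> \<longlonglongrightarrow> q" and \<rho>_le: "\<And>n. \<rho> n \<le> q"
    using incseq_convergent[OF inc] by metis
  have q_pos: "0 < q" using \<rho>_pos[of 0] \<rho>_le[of 0] by linarith
  define b where "b n = a n / q ^ Suc n" for n
  have b_pos: "0 < b n" for n using pos q_pos by (simp add: b_def)
  define \<beta> where "\<beta> n = \<rho> n / q" for n
  have \<beta>_pos: "0 < \<beta> n" and \<beta>_le: "\<beta> n \<le> 1" for n
    using \<rho>_pos[of n] \<rho>_le[of n] q_pos by (auto simp: \<beta>_def)
  have \<beta>_mono: "\<beta> n \<le> \<beta> m" if "n \<le> m" for n m
    using inc that q_pos by (auto simp: \<beta>_def incseq_def divide_right_mono)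
  have b_Suc: "b (Suc n) = \<beta> n * b n" for n
    using pos[of n] by (simp add: b_def \<beta>_def \<rho>_def)
  have "decseq b"
    using b_pos \<beta>_le by (intro decseq_SucI) (simp add: b_Suc mult_left_le_one_le less_imp_le[OF \<beta>_pos] less_imp_le)
  have b_lower: "b N * \<beta> N ^ j \<le> b (N + j)" for N j
  proof (induction j)
    case (Suc j)
    have "b N * \<beta> N ^ Suc j = \<beta> N * (b N * \<beta> N ^ j)" by simp
    also have "\<dots> \<le> \<beta> (N + j) * b (N + j)"
      using Suc \<beta>_mono[of N "N + j"] \<beta>_pos b_pos by (intro mult_mono) (auto simp: less_imp_le)
    finally show ?case by (simp add: b_Suc)
  qed simp
  have b_sub: "b (Suc (n + m)) \<le> b n * b m" for n m
  proof -
    have "q ^ Suc (Suc (n + m)) = q ^ Suc n * q ^ Suc m" by (simp add: power_add)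
    then show ?thesis
      unfolding b_def using sub[of n m] q_pos by (simp only: times_divide_times_eq) (intro divide_right_mono, auto)
  qed
  \<comment> \<open>Repeated use of \<open>b_sub\<close> joins m + 1 blocks of n + 1 indices each;
    counting from 0, the last index is (m + 1)(n + 1) - 1.\<close>
  have b_power: "b (Suc n * m + n) \<le> b n ^ Suc m" for n m
  proof (induction m)
    case (Suc m)
    have "b (Suc n * Suc m + n) = b (Suc (n + (Suc n * m + n)))" by (simp add: algebra_simps)
    also have "\<dots> \<le> b n * b (Suc n * m + n)" by (rule b_sub)
    also have "\<dots> \<le> b n * b n ^ Suc m" using Suc b_pos[of n] by simp
    finally show ?case by simp
  qed simp
  \<comment> \<open>If b(n) < 1, the block estimate forces decay by the factor b(n) over every n + 1
    steps. The successive ratios \<open>\<beta>\<close> tend to 1, so N can be taken with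
    \<open>\<beta>\<close> N ^ (n + 1) > b(n), and from N on the decay is too slow for that.\<close>
  have "1 \<le> b n" for n
  proof (rule ccontr)
    assume "\<not> 1 \<le> b n"
    then have "b n < 1" by simp
    have "\<beta> \<longlonglongrightarrow> q / q" unfolding \<beta>_def using q by (intro tendsto_divide) (use q_pos in auto)
    then have "(\<lambda>N. \<beta> N ^ Suc n) \<longlonglongrightarrow> 1 ^ Suc n"
      using q_pos by (intro tendsto_power) auto
    then have "\<forall>\<^sub>F N in sequentially. b n < \<beta> N ^ Suc n"
      using \<open>b n < 1\<close> by (intro order_tendstoD(1)) auto
    then obtain N where N: "b n < \<beta> N ^ Suc n" by (auto simp: eventually_sequentially)
    define x where "x = b n / \<beta> N ^ Suc n"
    have x: "0 \<le> x" "x < 1" using N b_pos[of n] \<beta>_pos[of N] by (auto simp: x_def)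
    have "b N \<le> x ^ Suc m" if "N \<le> m" for m
    proof -
      have le: "N \<le> Suc n * m + n" using that by (auto simp: algebra_simps)
      then have "b N * \<beta> N ^ (Suc n * m + n - N) \<le> b n ^ Suc m"
        using b_lower[of N "Suc n * m + n - N"] b_power[of n m] by simp
      moreover have "b N * \<beta> N ^ (Suc n * Suc m) \<le> b N * \<beta> N ^ (Suc n * m + n - N)"
        using b_pos[of N] \<beta>_pos[of N] \<beta>_le[of N] by (intro mult_left_mono power_decreasing) auto
      ultimately have "b N * (\<beta> N ^ Suc n) ^ Suc m \<le> b n ^ Suc m"
        unfolding power_mult[symmetric] by linarith
      then show ?thesis
        using \<beta>_pos[of N] unfolding x_def power_divide by (subst pos_le_divide_eq) auto
    qed
    moreover have "(\<lambda>m. x ^ Suc m) \<longlonglongrightarrow> 0" using x by (intro LIMSEQ_Suc LIMSEQ_power_zero) auto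
    then have "\<forall>\<^sub>F m in sequentially. x ^ Suc m < b N" using b_pos by (intro order_tendstoD(2)) auto
    then obtain m where "N \<le> m" "x ^ Suc m < b N"
      using eventually_conj[OF _ eventually_ge_at_top[of N]] unfolding eventually_sequentially by blast
    ultimately show False by force
  qed
  with that[OF q_pos] \<open>decseq b\<close> show ?thesis unfolding b_def by blast
qed

text \<open>Rectangles form an intersection-stable generator, and the sets over which
  \<open>f\<close> integrates to zero are closed under complements and countable disjoint unions. So
  every measurable set has zero integral, which forces f = 0 almost everywhere.\<close>

lemma AE_zero_of_rectangle_integrals:
  fixes f :: "'a \<times> 'b \<Rightarrow> complex"
  assumes M: "finite_measure M" and N: "finite_measure N" and f: "integrable (M \<Otimes>\<^sub>M N) f"
    and rect: "\<And>A B. A \<in> sets M \<Longrightarrow> B \<in> sets N \<Longrightarrow> (LINT p:A \<times> B|M \<Otimes>\<^sub>M N. f p) = 0"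
  shows "AE p in M \<Otimes>\<^sub>M N. f p = 0"
proof -
  interpret M: finite_measure M by fact
  interpret N: finite_measure N by fact
  interpret P: pair_sigma_finite M N ..
  interpret PF: finite_measure "M \<Otimes>\<^sub>M N" by (rule finite_measure_pair_measure) fact+
  let ?P = "M \<Otimes>\<^sub>M N" and ?S = "space M \<times> space N"
  let ?G = "{a \<times> b | a b. a \<in> sets M \<and> b \<in> sets N}"
  have set_int: "set_integrable ?P C f" if "C \<in> sets ?P" for C
    using that f unfolding set_integrable_def by (rule integrable_mult_indicator)
  have "(LINT p:C|?P. f p) = 0" if "C \<in> sets ?P" for C
  proof -
    from that have "C \<in> sigma_sets ?S ?G" by (simp add: sets_pair_measure)
    from Int_stable_pair_measure_generator[of M N] pair_measure_closed[of M N] this show ?thesis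
    proof (induction rule: sigma_sets_induct_disjoint)
      case (basic C) then show ?case using rect by auto
    next
      case empty show ?case by (simp add: set_lebesgue_integral_def)
    next
      case (compl C)
      then have C: "C \<in> sets ?P" by (simp add: sets_pair_measure)
      have CS: "C \<subseteq> ?S" using sets.sets_into_space[OF C] by (simp add: space_pair_measure)
      have "(LINT p:C \<union> (?S - C)|?P. f p) = (LINT p:C|?P. f p) + (LINT p:?S - C|?P. f p)"
        using C by (intro set_integral_Un set_int) (auto intro: sets.Diff)
      moreover have "C \<union> (?S - C) = ?S" using CS by auto
      ultimately show ?case using compl(2) rect[OF sets.top sets.top] by simp
    next
      case (union C)
      then have C: "C i \<in> sets ?P" for i by (auto simp: sets_pair_measure)
      have "(LINT p:(\<Union>i. C i)|?P. f p) = (\<Sum>i. LINT p:C i|?P. f p)"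
        using union C by (intro lebesgue_integral_countable_add set_int) (auto simp: disjoint_family_on_def)
      then show ?case using union by simp
    qed
  qed
  moreover have "sigma_finite_measure ?P" by unfold_locales
  ultimately show ?thesis by (intro sigma_finite_measure.density_zero f)
qed

section \<open>Iterated kernels\<close>

lemma (in finite_measure) integrable_bounded:
  fixes f :: "'a \<Rightarrow> complex"
  assumes "f \<in> borel_measurable M" "\<And>x. x \<in> space M \<Longrightarrow> cmod (f x) \<le> B"
  shows "integrable M f"
  using assms by (intro integrable_const_bound[of _ B]) auto

lemma (in finite_measure) norm_integral_le_bound:
  fixes f :: "'a \<Rightarrow> complex"
  assumes "f \<in> borel_measurable M" "\<And>x. x \<in> space M \<Longrightarrow> cmod (f x) \<le> B"
  shows "cmod (LINT x|M. f x) \<le> B * measure M (space M)"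
proof -
  have "cmod (LINT x|M. f x) \<le> (LINT x|M. cmod (f x))" by (rule integral_norm_bound)
  also have "\<dots> \<le> (LINT x|M. B)"
    using integrable_bounded[OF assms] assms(2) by (intro integral_mono) auto
  finally show ?thesis by (simp add: mult.commute)
qed

lemma (in finite_measure) swap_bounded_integral:
  fixes f :: "'a \<Rightarrow> 'a \<Rightarrow> complex"
  assumes [measurable]: "case_prod f \<in> borel_measurable (M \<Otimes>\<^sub>M M)"
    and bd: "\<And>x y. x \<in> space M \<Longrightarrow> y \<in> space M \<Longrightarrow> cmod (f x y) \<le> B"
  shows "(LINT x|M. LINT y|M. f x y) = (LINT y|M. LINT x|M. f x y)"
    and "(LINT x|M. LINT y|M. f x y) = (LINT p|(M \<Otimes>\<^sub>M M). f (fst p) (snd p))"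
proof -
  interpret P: pair_sigma_finite M M ..
  interpret PF: finite_measure "M \<Otimes>\<^sub>M M" by (rule finite_measure_pair_measure) unfold_locales
  have int: "integrable (M \<Otimes>\<^sub>M M) (case_prod f)"
    using bd by (intro PF.integrable_bounded[of _ B]) (auto simp: space_pair_measure)
  show "(LINT x|M. LINT y|M. f x y) = (LINT y|M. LINT x|M. f x y)"
    using P.Fubini_integral[OF int] by simp
  show "(LINT x|M. LINT y|M. f x y) = (LINT p|(M \<Otimes>\<^sub>M M). f (fst p) (snd p))"
    using P.integral_fst'[OF int] by (simp add: case_prod_beta')
qed

text \<open>Boundedness on a finite measure space makes every product below integrable and gives
  each iterated kernel a value at every point, so that eigenvalue equations come out pointwise and
  not merely almost everywhere.\<close>

locale bounded_hermitian_kernel = finite_measure M for M :: "'a measure" +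
  fixes r :: "'a \<Rightarrow> 'a \<Rightarrow> complex" and B :: real
  assumes r_measurable[measurable]: "case_prod r \<in> borel_measurable (M \<Otimes>\<^sub>M M)"
    and r_bound: "x \<in> space M \<Longrightarrow> y \<in> space M \<Longrightarrow> cmod (r x y) \<le> B"
    and r_hermitian: "x \<in> space M \<Longrightarrow> y \<in> space M \<Longrightarrow> r y x = cnj (r x y)"
begin

sublocale PF: finite_measure "M \<Otimes>\<^sub>M M"
  by (rule finite_measure_pair_measure) unfold_locales

sublocale P: pair_sigma_finite M M ..

text \<open>\<open>kp n\<close> is the kernel of the \<open>(n + 1)\<close>-st power of the operator.\<close>

fun kp :: "nat \<Rightarrow> 'a \<Rightarrow> 'a \<Rightarrow> complex" where
  "kp 0 = r"
| "kp (Suc n) = (\<lambda>z w. LINT y|M. r z y * kp n y w)"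

definition K :: "nat \<Rightarrow> 'a \<times> 'a \<Rightarrow> complex" where "K n = case_prod (kp n)"

lemma kp_measurable[measurable]: "case_prod (kp n) \<in> borel_measurable (M \<Otimes>\<^sub>M M)"
proof (induction n)
  case (Suc n)
  note [measurable] = Suc
  have "(\<lambda>p. LINT y|M. r (fst p) y * kp n y (snd p)) \<in> borel_measurable (M \<Otimes>\<^sub>M M)"
    by measurable
  then show ?case by (simp add: case_prod_beta')
qed simp

lemma kp_bounded: "\<exists>C. \<forall>z\<in>space M. \<forall>w\<in>space M. cmod (kp n z w) \<le> C"
proof (induction n)
  case 0 show ?case using r_bound by auto
next
  case (Suc n)
  then obtain C where C: "\<And>z w. z \<in> space M \<Longrightarrow> w \<in> space M \<Longrightarrow> cmod (kp n z w) \<le> C" by blast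
  have "cmod (kp (Suc n) z w) \<le> B * C * measure M (space M)" if [simp]: "z \<in> space M" "w \<in> space M" for z w
    unfolding kp.simps
  proof (rule norm_integral_le_bound)
    show "(\<lambda>y. r z y * kp n y w) \<in> borel_measurable M" by measurable
    show "cmod (r z y * kp n y w) \<le> B * C" if "y \<in> space M" for y
      using r_bound[of z y] C[of y w] that order_trans[OF norm_ge_zero r_bound[of z y]]
      by (auto simp: norm_mult intro!: mult_mono)
  qed
  then show ?case by blast
qed

lemma kp_boundedE:
  obtains C where "0 \<le> C" "\<And>z w. z \<in> space M \<Longrightarrow> w \<in> space M \<Longrightarrow> cmod (kp n z w) \<le> C"
proof -
  obtain C where "\<And>z w. z \<in> space M \<Longrightarrow> w \<in> space M \<Longrightarrow> cmod (kp n z w) \<le> C"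
    using kp_bounded by blast
  then show ?thesis by (intro that[of "max C 0"]) (auto simp: le_max_iff_disj)
qed

text \<open>Associativity of kernel composition, by Fubini. The index is \<open>Suc (n + m)\<close>
  because \<open>kp n\<close> belongs to the power n + 1, and the powers n + 1 and m + 1 compose to
  n + m + 2.\<close>

lemma kp_add:
  assumes [simp]: "z \<in> space M" "w \<in> space M"
  shows "(LINT y|M. kp n z y * kp m y w) = kp (Suc (n + m)) z w"
  using assms(1)
proof (induction n arbitrary: z)
  case (Suc n)
  note [simp] = Suc.prems
  obtain C where C: "0 \<le> C" "\<And>z w. z \<in> space M \<Longrightarrow> w \<in> space M \<Longrightarrow> cmod (kp n z w) \<le> C"
    using kp_boundedE[of n] by blast
  obtain D where D: "0 \<le> D" "\<And>z w. z \<in> space M \<Longrightarrow> w \<in> space M \<Longrightarrow> cmod (kp m z w) \<le> D"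
    using kp_boundedE[of m] by blast
  have "(LINT y|M. kp (Suc n) z y * kp m y w) = (LINT y|M. LINT x|M. r z x * kp n x y * kp m y w)"
    by simp
  also have "\<dots> = (LINT x|M. LINT y|M. r z x * kp n x y * kp m y w)"
  proof (rule swap_bounded_integral(1))
    show "(\<lambda>(y, x). r z x * kp n x y * kp m y w) \<in> borel_measurable (M \<Otimes>\<^sub>M M)" by measurable
    show "cmod (r z x * kp n x y * kp m y w) \<le> B * C * D" if "x \<in> space M" "y \<in> space M" for x y
      using r_bound[of z x] C(2)[of x y] D(2)[of y w] that C(1) D(1) order_trans[OF norm_ge_zero r_bound[of z x]]
      by (auto simp: norm_mult intro!: mult_mono)
  qed
  also have "\<dots> = (LINT x|M. r z x * kp (Suc (n + m)) x w)"
    using Suc.IH by (intro Bochner_Integration.integral_cong) (simp_all add: mult.assoc)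
  finally show ?case by simp
qed simp

lemma kp_hermitian: "z \<in> space M \<Longrightarrow> w \<in> space M \<Longrightarrow> kp n w z = cnj (kp n z w)"
proof (induction n arbitrary: z w)
  case (Suc n)
  have "kp (Suc n) w z = (LINT y|M. cnj (kp n z y * kp 0 y w))"
    unfolding kp.simps using Suc.prems
    by (intro Bochner_Integration.integral_cong) (auto simp: r_hermitian[of _ w] Suc.IH[of z] mult.commute)
  also have "\<dots> = cnj (kp (Suc (n + 0)) z w)"
    using Suc.prems by (simp only: Bochner_Integration.integral_cnj kp_add)
  finally show ?case by simp
qed (simp, rule r_hermitian)

lemma K_measurable[measurable]: "K n \<in> borel_measurable (M \<Otimes>\<^sub>M M)"
  unfolding K_def by measurable

lemma sq_int_K: "sq_int (M \<Otimes>\<^sub>M M) (K n)"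
proof -
  obtain C where "0 \<le> C" "\<And>z w. z \<in> space M \<Longrightarrow> w \<in> space M \<Longrightarrow> cmod (kp n z w) \<le> C"
    using kp_boundedE[of n] by blast
  then show ?thesis
    by (intro sq_int_finite_measure[of _ _ C] PF.finite_measure_axioms)
       (auto simp: K_def space_pair_measure)
qed

text \<open>The Hilbert-Schmidt product of two powers of a self-adjoint operator is the trace of
  their composition. Only n + m matters, so inner products between different powers can be rewritten
  as squared norms of intermediate ones.\<close>

lemma ip_K: "ip (M \<Otimes>\<^sub>M M) (K n) (K m) = (LINT z|M. kp (Suc (n + m)) z z)"
proof -
  obtain C where C: "0 \<le> C" "\<And>z w. z \<in> space M \<Longrightarrow> w \<in> space M \<Longrightarrow> cmod (kp n z w) \<le> C"
    using kp_boundedE[of n] by blast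
  obtain D where D: "0 \<le> D" "\<And>z w. z \<in> space M \<Longrightarrow> w \<in> space M \<Longrightarrow> cmod (kp m z w) \<le> D"
    using kp_boundedE[of m] by blast
  have "ip (M \<Otimes>\<^sub>M M) (K n) (K m) = (LINT p|(M \<Otimes>\<^sub>M M). kp n (fst p) (snd p) * cnj (kp m (fst p) (snd p)))"
    by (simp add: ip_def K_def case_prod_beta')
  also have "\<dots> = (LINT z|M. LINT w|M. kp n z w * cnj (kp m z w))"
  proof (rule swap_bounded_integral(2)[symmetric])
    show "(\<lambda>(z, w). kp n z w * cnj (kp m z w)) \<in> borel_measurable (M \<Otimes>\<^sub>M M)" by measurable
    show "cmod (kp n z w * cnj (kp m z w)) \<le> C * D" if "z \<in> space M" "w \<in> space M" for z w
      using C D that by (auto simp: norm_mult intro!: mult_mono)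
  qed
  also have "\<dots> = (LINT z|M. LINT w|M. kp n z w * kp m w z)"
  proof (intro Bochner_Integration.integral_cong refl)
    fix z w assume "z \<in> space M" "w \<in> space M"
    then show "kp n z w * cnj (kp m z w) = kp n z w * kp m w z" by (simp add: kp_hermitian[of z w])
  qed
  also have "\<dots> = (LINT z|M. kp (Suc (n + m)) z z)"
    by (intro Bochner_Integration.integral_cong refl) (simp only: kp_add)
  finally show ?thesis .
qed

text \<open>Both <K(n+1), K(n+1)> and <K(n), K(n+2)> are the same trace; Cauchy-Schwarz applies to
  the second.\<close>

lemma nsq_K_log_convex:
  "(nsq (M \<Otimes>\<^sub>M M) (K (Suc n)))\<^sup>2 \<le> nsq (M \<Otimes>\<^sub>M M) (K n) * nsq (M \<Otimes>\<^sub>M M) (K (Suc (Suc n)))"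
proof -
  have "complex_of_real (nsq (M \<Otimes>\<^sub>M M) (K (Suc n))) = ip (M \<Otimes>\<^sub>M M) (K n) (K (Suc (Suc n)))"
    unfolding ip_self[symmetric] ip_K by simp
  then have "nsq (M \<Otimes>\<^sub>M M) (K (Suc n)) = cmod (ip (M \<Otimes>\<^sub>M M) (K n) (K (Suc (Suc n))))"
    by (metis nsq_nonneg norm_of_real abs_of_nonneg)
  then show ?thesis using Cauchy_Schwarz_ip[OF sq_int_K[of n] sq_int_K[of "Suc (Suc n)"]] by simp
qed

lemma sq_int_kp_section:
  assumes [simp]: "z \<in> space M"
  shows "sq_int M (kp n z)" "sq_int M (\<lambda>y. kp n y z)"
proof -
  obtain C where C: "0 \<le> C" "\<And>z w. z \<in> space M \<Longrightarrow> w \<in> space M \<Longrightarrow> cmod (kp n z w) \<le> C"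
    using kp_boundedE[of n] by blast
  show "sq_int M (kp n z)" "sq_int M (\<lambda>y. kp n y z)"
    using C by (auto intro!: sq_int_finite_measure[of _ _ C] finite_measure_axioms)
qed

lemma nsq_K_eq:
  shows "nsq (M \<Otimes>\<^sub>M M) (K n) = (LINT z|M. nsq M (kp n z))"
    and "nsq (M \<Otimes>\<^sub>M M) (K n) = (LINT w|M. nsq M (\<lambda>z. kp n z w))"
proof -
  have int: "integrable (M \<Otimes>\<^sub>M M) (\<lambda>(z, w). (cmod (kp n z w))\<^sup>2)"
    using sq_int_K[of n] by (simp add: sq_int_def K_def case_prod_beta')
  show "nsq (M \<Otimes>\<^sub>M M) (K n) = (LINT z|M. nsq M (kp n z))"
    using P.integral_fst'[OF int] by (simp add: nsq_def K_def case_prod_beta')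
  show "nsq (M \<Otimes>\<^sub>M M) (K n) = (LINT w|M. nsq M (\<lambda>z. kp n z w))"
    using P.integral_snd[OF int] by (simp add: nsq_def K_def case_prod_beta')
qed

lemma nsq_kp_measurable[measurable]:
  "(\<lambda>z. nsq M (kp n z)) \<in> borel_measurable M" "(\<lambda>w. nsq M (\<lambda>y. kp n y w)) \<in> borel_measurable M"
  unfolding nsq_def by measurable

lemma nsq_kp_integrable:
  "integrable M (\<lambda>z. nsq M (kp n z))" "integrable M (\<lambda>w. nsq M (\<lambda>y. kp n y w))"
proof -
  have int: "integrable (M \<Otimes>\<^sub>M M) (\<lambda>(z, w). (cmod (kp n z w))\<^sup>2)"
    using sq_int_K[of n] by (simp add: sq_int_def K_def case_prod_beta')
  show "integrable M (\<lambda>z. nsq M (kp n z))" "integrable M (\<lambda>w. nsq M (\<lambda>y. kp n y w))"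
    unfolding nsq_def using P.integrable_fst[OF int] P.integrable_snd[OF int] by auto
qed

declare kp.simps(2)[simp del]

text \<open>A value of the composed kernel is the inner product of a row of the first kernel with a
  column of the second; Cauchy-Schwarz pointwise, then integration in both variables.\<close>

lemma nsq_K_submultiplicative:
  "nsq (M \<Otimes>\<^sub>M M) (K (Suc (n + m))) \<le> nsq (M \<Otimes>\<^sub>M M) (K n) * nsq (M \<Otimes>\<^sub>M M) (K m)"
proof -
  have pt: "(cmod (kp (Suc (n + m)) z w))\<^sup>2 \<le> nsq M (kp n z) * nsq M (\<lambda>y. kp m y w)"
    if "z \<in> space M" "w \<in> space M" for z w
  proof -
    have "kp (Suc (n + m)) z w = ip M (kp n z) (kp m w)"
      unfolding kp_add[OF that, symmetric] ip_def
      using that by (intro Bochner_Integration.integral_cong) (auto simp: kp_hermitian[of w])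
    moreover have "nsq M (kp m w) = nsq M (\<lambda>y. kp m y w)"
      unfolding nsq_def using that
      by (intro Bochner_Integration.integral_cong) (auto simp: kp_hermitian[of w])
    ultimately show ?thesis
      using Cauchy_Schwarz_ip[OF sq_int_kp_section(1)[OF that(1)] sq_int_kp_section(1)[OF that(2)]] by metis
  qed
  have "nsq M (kp (Suc (n + m)) z) \<le> nsq M (kp n z) * nsq (M \<Otimes>\<^sub>M M) (K m)" if z: "z \<in> space M" for z
  proof -
    have "nsq M (kp (Suc (n + m)) z) \<le> (LINT w|M. nsq M (kp n z) * nsq M (\<lambda>y. kp m y w))"
      unfolding nsq_def[of M "kp (Suc (n + m)) z"]
      using pt z sq_int_integrable[OF sq_int_kp_section(1)[OF z]] nsq_kp_integrable
      by (intro integral_mono) auto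
    then show ?thesis by (simp add: nsq_K_eq(2))
  qed
  then have "(LINT z|M. nsq M (kp (Suc (n + m)) z)) \<le> (LINT z|M. nsq M (kp n z) * nsq (M \<Otimes>\<^sub>M M) (K m))"
    using nsq_kp_integrable by (intro integral_mono) auto
  then show ?thesis by (simp add: nsq_K_eq(1))
qed

end

section \<open>Existence of eigenvectors\<close>

lemma decseq_bounded_below_convergent:
  fixes b :: "nat \<Rightarrow> real"
  assumes "decseq b" "\<And>n. 1 \<le> b n"
  shows "\<exists>L. b \<longlonglongrightarrow> L"
  using decseq_convergent[OF assms(1), of 1] assms(2) by metis

context bounded_hermitian_kernel
begin

definition bounded_measurable :: "('a \<Rightarrow> complex) \<Rightarrow> bool" where
  "bounded_measurable f \<longleftrightarrow> f \<in> borel_measurable M \<and> (\<exists>C\<ge>0. \<forall>x\<in>space M. cmod (f x) \<le> C)"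

definition opr :: "('a \<Rightarrow> complex) \<Rightarrow> 'a \<Rightarrow> complex" where
  "opr f z = (LINT y|M. r z y * f y)"

lemma bounded_measurableD[measurable_dest]: "bounded_measurable f \<Longrightarrow> f \<in> borel_measurable M"
  by (simp add: bounded_measurable_def)

lemma sq_int_bounded_measurable: "bounded_measurable f \<Longrightarrow> sq_int M f"
  unfolding bounded_measurable_def by (auto intro: sq_int_finite_measure finite_measure_axioms)

lemma r_bound_nonneg: "x \<in> space M \<Longrightarrow> 0 \<le> B"
  using r_bound[of x x] norm_ge_zero order_trans by blast

lemma bounded_measurable_opr:
  assumes f: "bounded_measurable f"
  shows "bounded_measurable (opr f)"
proof -
  note [measurable] = bounded_measurableD[OF f]
  obtain C where C: "0 \<le> C" "\<And>x. x \<in> space M \<Longrightarrow> cmod (f x) \<le> C"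
    using f by (auto simp: bounded_measurable_def)
  have "opr f \<in> borel_measurable M" unfolding opr_def by measurable
  moreover have "cmod (opr f z) \<le> \<bar>B * C * measure M (space M)\<bar>" if [simp]: "z \<in> space M" for z
    unfolding opr_def
  proof (rule order_trans[OF norm_integral_le_bound abs_ge_self])
    show "cmod (r z y * f y) \<le> B * C" if "y \<in> space M" for y
      using r_bound[of z y] C that r_bound_nonneg[of z] by (auto simp: norm_mult intro!: mult_mono)
  qed measurable
  ultimately show ?thesis unfolding bounded_measurable_def by (metis abs_ge_zero)
qed

lemma opr_opr:
  assumes f: "bounded_measurable f" and [simp]: "z \<in> space M"
  shows "opr (opr f) z = (LINT y|M. kp 1 z y * f y)"
proof -
  note [measurable] = bounded_measurableD[OF f]
  obtain C where C: "0 \<le> C" "\<And>x. x \<in> space M \<Longrightarrow> cmod (f x) \<le> C"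
    using f by (auto simp: bounded_measurable_def)
  have "opr (opr f) z = (LINT x|M. LINT y|M. r z x * (r x y * f y))"
    by (simp add: opr_def)
  also have "\<dots> = (LINT y|M. LINT x|M. r z x * (r x y * f y))"
  proof (rule swap_bounded_integral(1))
    show "(\<lambda>(x, y). r z x * (r x y * f y)) \<in> borel_measurable (M \<Otimes>\<^sub>M M)" by measurable
    show "cmod (r z x * (r x y * f y)) \<le> B * (B * C)" if "x \<in> space M" "y \<in> space M" for x y
      using r_bound[of z x] r_bound[of x y] C that r_bound_nonneg[of z]
      by (auto simp: norm_mult intro!: mult_mono)
  qed
  also have "\<dots> = (LINT y|M. kp 1 z y * f y)"
    by (simp add: kp.simps(2) mult.assoc[symmetric])
  finally show ?thesis .
qed

lemma opr_selfadjoint: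
  assumes f: "bounded_measurable f" and g: "bounded_measurable g"
  shows "ip M (opr f) g = ip M f (opr g)"
proof -
  note [measurable] = bounded_measurableD[OF f] bounded_measurableD[OF g]
  obtain C where C: "0 \<le> C" "\<And>x. x \<in> space M \<Longrightarrow> cmod (f x) \<le> C"
    using f by (auto simp: bounded_measurable_def)
  obtain D where D: "0 \<le> D" "\<And>x. x \<in> space M \<Longrightarrow> cmod (g x) \<le> D"
    using g by (auto simp: bounded_measurable_def)
  have "ip M (opr f) g = (LINT x|M. LINT y|M. r x y * f y * cnj (g x))"
    by (simp add: opr_def ip_def)
  also have "\<dots> = (LINT y|M. LINT x|M. r x y * f y * cnj (g x))"
  proof (rule swap_bounded_integral(1))
    show "(\<lambda>(x, y). r x y * f y * cnj (g x)) \<in> borel_measurable (M \<Otimes>\<^sub>M M)" by measurable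
    show "cmod (r x y * f y * cnj (g x)) \<le> B * C * D" if "x \<in> space M" "y \<in> space M" for x y
      using r_bound[of x y] C D that r_bound_nonneg[of x] by (auto simp: norm_mult intro!: mult_mono)
  qed
  also have "\<dots> = (LINT y|M. LINT x|M. f y * cnj (r y x * g x))"
  proof (intro Bochner_Integration.integral_cong refl)
    fix x y assume "x \<in> space M" "y \<in> space M"
    then show "r x y * f y * cnj (g x) = f y * cnj (r y x * g x)"
      by (simp add: r_hermitian[of y x])
  qed
  also have "\<dots> = ip M f (opr g)"
    by (simp add: opr_def ip_def Bochner_Integration.integral_cnj del: complex_cnj_mult)
  finally show ?thesis .
qed

text \<open>If T^2 = 0, then ||T f||^2 = <f, T^2 f> = 0 for every bounded f. Taking indicators for
  f, the kernel of T has zero integral over every rectangle.\<close>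

lemma kernel_zero_if_square_zero:
  assumes "nsq (M \<Otimes>\<^sub>M M) (K 1) = 0"
  shows "AE p in M \<Otimes>\<^sub>M M. K 0 p = 0"
proof (rule AE_zero_of_rectangle_integrals)
  show "integrable (M \<Otimes>\<^sub>M M) (K 0)"
    using r_bound by (intro PF.integrable_bounded[of _ B]) (auto simp: K_def space_pair_measure)
  have "AE p in M \<Otimes>\<^sub>M M. K 1 p = 0" using assms sq_int_K by (simp add: nsq_zero_iff)
  then have ae: "AE z in M. AE y in M. kp 1 z y = 0"
    by (auto dest: P.AE_pair simp: K_def)
  fix A C assume [measurable]: "A \<in> sets M" "C \<in> sets M"
  let ?f = "indicator C :: 'a \<Rightarrow> complex"
  have bm: "bounded_measurable ?f"
    unfolding bounded_measurable_def by (auto intro!: exI[of _ 1] simp: indicator_def)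
  have zero: "AE z in M. opr (opr ?f) z = 0"
    using ae AE_space
  proof eventually_elim
    case (elim z)
    then show ?case unfolding opr_opr[OF bm elim(2)] by (intro integral_eq_zero_AE) auto
  qed
  have "ip M (opr ?f) (opr ?f) = ip M ?f (opr (opr ?f))"
    using bm bounded_measurable_opr by (intro opr_selfadjoint) auto
  also have "\<dots> = 0" unfolding ip_def using zero by (intro integral_eq_zero_AE) auto
  finally have "nsq M (opr ?f) = 0" by (simp add: ip_self)
  then have "AE z in M. opr ?f z = 0"
    using nsq_zero_iff[OF sq_int_bounded_measurable[OF bounded_measurable_opr[OF bm]]] by simp
  then have "(LINT z|M. indicator A z * opr ?f z) = 0"
    by (intro integral_eq_zero_AE) auto
  moreover have "(LINT z|M. indicator A z * opr ?f z) = (LINT z|M. LINT y|M. indicator A z * (r z y * ?f y))"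
    by (simp add: opr_def)
  moreover have "\<dots> = (LINT p|(M \<Otimes>\<^sub>M M). indicator A (fst p) * (r (fst p) (snd p) * ?f (snd p)))"
    by (rule swap_bounded_integral(2)[where B = B])
       (measurable, auto simp: norm_mult indicator_def r_bound r_bound_nonneg)
  moreover have "\<dots> = (LINT p:A \<times> C|M \<Otimes>\<^sub>M M. K 0 p)"
    unfolding set_lebesgue_integral_def K_def
    by (intro Bochner_Integration.integral_cong) (auto simp: indicator_def)
  ultimately show "(LINT p:A \<times> C|M \<Otimes>\<^sub>M M. K 0 p) = 0" by simp
qed unfold_locales

text \<open>Two consecutive positive values make the next one positive by log-convexity; the second
  starting value is positive because T^2 = 0 only for T = 0.\<close>

lemma nsq_K_pos:
  assumes "nsq (M \<Otimes>\<^sub>M M) (K 0) \<noteq> 0"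
  shows "0 < nsq (M \<Otimes>\<^sub>M M) (K n)"
proof -
  have 0: "0 < nsq (M \<Otimes>\<^sub>M M) (K 0)" using assms nsq_nonneg by (simp add: order_less_le)
  have 1: "0 < nsq (M \<Otimes>\<^sub>M M) (K 1)"
    using assms kernel_zero_if_square_zero nsq_zero_iff[OF sq_int_K] nsq_nonneg by (metis order_less_le)
  have "0 < nsq (M \<Otimes>\<^sub>M M) (K n) \<and> 0 < nsq (M \<Otimes>\<^sub>M M) (K (Suc n))"
  proof (induction n)
    case (Suc n)
    then have "0 < (nsq (M \<Otimes>\<^sub>M M) (K (Suc n)))\<^sup>2" by simp
    then have "0 < nsq (M \<Otimes>\<^sub>M M) (K n) * nsq (M \<Otimes>\<^sub>M M) (K (Suc (Suc n)))"
      using nsq_K_log_convex[of n] by linarith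
    with Suc show ?case by (simp add: zero_less_mult_iff)
  qed (use 0 1 in simp)
  then show ?thesis by simp
qed

text \<open>The kernels of T^2/q raised to growing powers form a Cauchy sequence in Hilbert-Schmidt
  norm, and one more factor T on each side turns this into uniform convergence. The limit kernel is
  reproduced by T^2 up to the factor q and is not null, so one of its columns is the
  eigenvector.\<close>

lemma squared_eigenvector_exists:
  assumes nz: "nsq (M \<Otimes>\<^sub>M M) (K 0) \<noteq> 0"
  obtains q v where "0 < q" "bounded_measurable v" "\<not> (AE z in M. v z = 0)"
    "\<And>z. z \<in> space M \<Longrightarrow> opr (opr v) z = of_real q * v z"
proof -
  let ?P = "M \<Otimes>\<^sub>M M"
  define a where "a n = nsq ?P (K n)" for n
  obtain q where q: "0 < q" and dec: "decseq (\<lambda>n. a n / q ^ Suc n)" and ge1: "\<And>n. 1 \<le> a n / q ^ Suc n"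
    using log_convex_submultiplicative_rate[of a] nsq_K_pos[OF nz] nsq_K_log_convex nsq_K_submultiplicative
    unfolding a_def by blast
  define b where "b n = a n / q ^ Suc n" for n
  obtain L where L: "b \<longlonglongrightarrow> L"
    using decseq_bounded_below_convergent[OF dec ge1] unfolding b_def by blast
  \<comment> \<open>\<open>e n\<close> is the kernel of T^(2n+2) / q^(n+1). In spectral terms the
    part of T^2 below q dies out and the projection onto the eigenspace of q remains.\<close>
  define e where "e n z w = kp (Suc (2 * n)) z w / of_real (q ^ Suc n)" for n z w
  define E where "E n = case_prod (e n)" for n
  have e_meas[measurable]: "case_prod (e n) \<in> borel_measurable ?P" for n
    unfolding e_def by measurable
  have E_K: "E n = (\<lambda>p. of_real (1 / q ^ Suc n) * K (Suc (2 * n)) p)" for n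
    by (auto simp: E_def e_def K_def)
  have E_sq: "sq_int ?P (E n)" for n
    unfolding E_K by (intro sq_int_cmult sq_int_K)
  have ip_E: "ip ?P (E n) (E m) = of_real (b (Suc (n + m)))" for n m
  proof -
    have "ip ?P (E n) (E m) = of_real (1 / q ^ Suc n) * (of_real (1 / q ^ Suc m) * ip ?P (K (Suc (2 * n))) (K (Suc (2 * m))))"
      unfolding E_K ip_cmult_left
      by (simp add: ip_def mult_ac flip: integral_mult_right_zero)
    also have "ip ?P (K (Suc (2 * n))) (K (Suc (2 * m))) = ip ?P (K (Suc (n + m))) (K (Suc (n + m)))"
      unfolding ip_K by (simp add: mult_2 add_ac)
    finally show ?thesis by (simp add: ip_self b_def a_def power_add)
  qed
  define D where "D n m = nsq ?P (\<lambda>p. E n p - E m p)" for n m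
  \<comment> \<open>All three terms have the same limit as \<open>b\<close>, so D tends to L - 2 L +
    L = 0.\<close>
  have D: "D n m = b (Suc (n + n)) - 2 * b (Suc (n + m)) + b (Suc (m + m))" for n m
  proof -
    have "nsq ?P (E n) = b (Suc (n + n))" for n
      using ip_E[of n n] unfolding ip_self of_real_eq_iff .
    then show ?thesis unfolding D_def nsq_diff[OF E_sq E_sq] by (simp add: ip_E)
  qed
  define m where "m = measure ?P (space ?P)"
  have L1: "(LINT p|?P. cmod (f p)) \<le> sqrt (nsq ?P f * m)" if "sq_int ?P f" for f
  proof -
    have "sq_int ?P (\<lambda>_. 1)" by (rule sq_int_finite_measure[of _ _ 1]) (auto intro: PF.finite_measure_axioms)
    from Cauchy_Schwarz_integral[OF that this] show ?thesis
      by (intro real_le_rsqrt) (simp add: nsq_def m_def)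
  qed
  \<comment> \<open>Composing any bounded kernel \<open>c\<close> with T on both sides bounds its
    values at every point by its L^1 norm; with \<open>L1\<close> this becomes a bound by the L^2
    norm.\<close>
  have step: "cmod (LINT y|M. LINT x|M. r z y * (c y x * r x w)) \<le> B\<^sup>2 * (LINT p|?P. cmod (c (fst p) (snd p)))"
    if [simp]: "z \<in> space M" "w \<in> space M" and c[measurable]: "case_prod c \<in> borel_measurable ?P"
      and bd: "\<exists>C. \<forall>z\<in>space M. \<forall>w\<in>space M. cmod (c z w) \<le> C" for c z w
  proof -
    obtain C where C: "\<And>z w. z \<in> space M \<Longrightarrow> w \<in> space M \<Longrightarrow> cmod (c z w) \<le> C"
      using bd by blast
    have B0: "0 \<le> B" using r_bound_nonneg[of z] by simp
    have pt: "cmod (r z y * (c y x * r x w)) \<le> B\<^sup>2 * cmod (c y x)" if "x \<in> space M" "y \<in> space M" for x y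
    proof -
      have "cmod (r z y) * cmod (r x w) * cmod (c y x) \<le> B * B * cmod (c y x)"
        using r_bound[of z y] r_bound[of x w] that B0 by (intro mult_mono mult_nonneg_nonneg) auto
      then show ?thesis by (simp add: norm_mult power2_eq_square mult_ac)
    qed
    have "(LINT y|M. LINT x|M. r z y * (c y x * r x w)) = (LINT p|?P. r z (fst p) * (c (fst p) (snd p) * r (snd p) w))"
    proof (rule swap_bounded_integral(2))
      show "cmod (r z y * (c y x * r x w)) \<le> B\<^sup>2 * C" if "y \<in> space M" "x \<in> space M" for x y
        using pt[OF that(2,1)] C[OF that] by (meson mult_left_mono order_trans zero_le_power2)
    qed measurable
    also have "cmod \<dots> \<le> (LINT p|?P. cmod (r z (fst p) * (c (fst p) (snd p) * r (snd p) w)))"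
      by (rule integral_norm_bound)
    also have "\<dots> \<le> (LINT p|?P. B\<^sup>2 * cmod (c (fst p) (snd p)))"
    proof (rule integral_mono)
      have ic: "integrable ?P (\<lambda>p. c (fst p) (snd p))"
        by (rule PF.integrable_bounded[of _ C]) (measurable, auto simp: space_pair_measure C)
      then show "integrable ?P (\<lambda>p. B\<^sup>2 * cmod (c (fst p) (snd p)))" by simp
      then show "integrable ?P (\<lambda>p. cmod (r z (fst p) * (c (fst p) (snd p) * r (snd p) w)))"
        by (rule Bochner_Integration.integrable_bound)
           (measurable, use pt in \<open>auto simp: space_pair_measure abs_mult intro!: AE_I2\<close>)
    qed (use pt in \<open>auto simp: space_pair_measure\<close>)
    finally show ?thesis by simp
  qed
  have kp3: "kp (Suc (2 * Suc n)) z w = (LINT y|M. LINT x|M. r z y * (kp (Suc (2 * n)) y x * r x w))"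
    if zw[simp]: "z \<in> space M" "w \<in> space M" for n z w
  proof -
    have "kp (Suc (2 * Suc n)) z w = (LINT y|M. kp 0 z y * kp (Suc (Suc (2 * n) + 0)) y w)"
      using kp_add[OF zw, of 0 "Suc (Suc (2 * n))"] by simp
    also have "\<dots> = (LINT y|M. kp 0 z y * (LINT x|M. kp (Suc (2 * n)) y x * kp 0 x w))"
      by (intro Bochner_Integration.integral_cong refl) (simp only: kp_add zw)
    finally show ?thesis by simp
  qed
  have bd_e: "\<exists>C. \<forall>z\<in>space M. \<forall>w\<in>space M. cmod (e n z w) \<le> C" for n
  proof -
    obtain C where C: "\<And>z w. z \<in> space M \<Longrightarrow> w \<in> space M \<Longrightarrow> cmod (kp (Suc (2 * n)) z w) \<le> C"
      using kp_bounded by blast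
    have "cmod (e n z w) \<le> C / q ^ Suc n" if "z \<in> space M" "w \<in> space M" for z w
      using C[OF that] q unfolding e_def norm_divide by (simp add: divide_right_mono norm_power norm_mult)
    then show ?thesis by blast
  qed
  have e_Suc: "e (Suc n) z w = (LINT y|M. LINT x|M. r z y * (e n y x * r x w)) / q"
    if "z \<in> space M" "w \<in> space M" for n z w
    unfolding e_def[of "Suc n"] kp3[OF that] by (simp add: e_def)
  have e_bound: "cmod (e (Suc n) z w) \<le> B\<^sup>2 * sqrt (b 0 * m) / q" if "z \<in> space M" "w \<in> space M" for n z w
  proof -
    have "cmod (e (Suc n) z w) \<le> B\<^sup>2 * (LINT p|?P. cmod (e n (fst p) (snd p))) / q"
      unfolding e_Suc[OF that] using step[OF that e_meas bd_e] q
      by (simp add: norm_divide divide_right_mono)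
    also have "(LINT p|?P. cmod (e n (fst p) (snd p))) \<le> sqrt (nsq ?P (E n) * m)"
      using L1[OF E_sq[of n]] by (simp add: E_def case_prod_beta')
    also have "nsq ?P (E n) \<le> b 0"
      using ip_E[of n n] dec unfolding ip_self of_real_eq_iff b_def[symmetric] by (auto simp: decseq_def)
    finally show ?thesis using q by (simp add: divide_right_mono mult_left_mono mult_right_mono m_def)
  qed
  have e_diff: "cmod (e (Suc n) z w - e (Suc k) z w) \<le> B\<^sup>2 * sqrt (D n k * m) / q"
    if zw[simp]: "z \<in> space M" "w \<in> space M" for n k z w
  proof -
    have ii: "(LINT y|M. LINT x|M. r z y * ((e n y x - e k y x) * r x w))
      = (LINT y|M. LINT x|M. r z y * (e n y x * r x w)) - (LINT y|M. LINT x|M. r z y * (e k y x * r x w))"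
    proof -
      have i1: "integrable M (\<lambda>x. r z y * (e n y x * r x w))" if [simp]: "y \<in> space M" for n y
      proof -
        obtain C where "\<And>z w. z \<in> space M \<Longrightarrow> w \<in> space M \<Longrightarrow> cmod (e n z w) \<le> C" using bd_e by blast
        moreover from this[of z z] have "0 \<le> C" using norm_ge_zero order_trans zw(1) by blast
        ultimately show ?thesis
          using r_bound_nonneg[of z]
          by (intro integrable_bounded[of _ "B * (C * B)"])
             (measurable, auto simp: norm_mult r_bound intro!: mult_mono)
      qed
      have i2: "integrable M (\<lambda>y. LINT x|M. r z y * (e n y x * r x w))" for n
      proof -
        obtain C where C: "\<And>z w. z \<in> space M \<Longrightarrow> w \<in> space M \<Longrightarrow> cmod (e n z w) \<le> C" using bd_e by blast
        moreover from this[of z z] have "0 \<le> C" using norm_ge_zero order_trans zw(1) by blast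
        ultimately have "cmod (LINT x|M. r z y * (e n y x * r x w)) \<le> B * (C * B) * measure M (space M)" if [simp]: "y \<in> space M" for y
          using r_bound_nonneg[of z]
          by (intro norm_integral_le_bound) (measurable, auto simp: norm_mult r_bound intro!: mult_mono)
        then show ?thesis by (intro integrable_bounded) measurable
      qed
      have "(LINT y|M. LINT x|M. r z y * ((e n y x - e k y x) * r x w))
        = (LINT y|M. (LINT x|M. r z y * (e n y x * r x w)) - (LINT x|M. r z y * (e k y x * r x w)))"
      proof (intro Bochner_Integration.integral_cong refl)
        fix y assume y: "y \<in> space M"
        show "(LINT x|M. r z y * ((e n y x - e k y x) * r x w))
          = (LINT x|M. r z y * (e n y x * r x w)) - (LINT x|M. r z y * (e k y x * r x w))"
          by (simp only: left_diff_distrib right_diff_distrib Bochner_Integration.integral_diff[OF i1[OF y] i1[OF y]])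
      qed
      then show ?thesis by (simp only: Bochner_Integration.integral_diff[OF i2 i2])
    qed
    have "\<exists>C. \<forall>z\<in>space M. \<forall>w\<in>space M. cmod (e n z w - e k z w) \<le> C"
    proof -
      obtain C C' where "\<And>z w. z \<in> space M \<Longrightarrow> w \<in> space M \<Longrightarrow> cmod (e n z w) \<le> C"
        "\<And>z w. z \<in> space M \<Longrightarrow> w \<in> space M \<Longrightarrow> cmod (e k z w) \<le> C'" using bd_e by meson
      then have "\<forall>z\<in>space M. \<forall>w\<in>space M. cmod (e n z w - e k z w) \<le> C + C'"
        by (meson add_mono norm_triangle_ineq4 order_trans)
      then show ?thesis by blast
    qed
    then have "cmod (e (Suc n) z w - e (Suc k) z w)
        \<le> B\<^sup>2 * (LINT p|?P. cmod (e n (fst p) (snd p) - e k (fst p) (snd p))) / q"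
      unfolding e_Suc[OF zw] diff_divide_distrib[symmetric] ii[symmetric] norm_divide norm_of_real abs_of_pos[OF q]
      using q by (intro divide_right_mono step zw) auto
    also have "(LINT p|?P. cmod (e n (fst p) (snd p) - e k (fst p) (snd p))) \<le> sqrt (D n k * m)"
      using L1[OF sq_int_diff[OF E_sq[of n] E_sq[of k]]] by (simp add: E_def D_def case_prod_beta')
    finally show ?thesis using q by (simp add: divide_right_mono mult_left_mono)
  qed
  have D_small: "\<exists>N. \<forall>n\<ge>N. \<forall>k\<ge>N. D n k < \<epsilon>" if "0 < \<epsilon>" for \<epsilon>
  proof -
    obtain N where N: "\<And>n. N \<le> n \<Longrightarrow> \<bar>b n - L\<bar> < \<epsilon> / 4"
      using LIMSEQ_D[OF L, of "\<epsilon> / 4"] \<open>0 < \<epsilon>\<close> by (auto simp: field_simps)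
    have "D n k < \<epsilon>" if "N \<le> n" "N \<le> k" for n k
      using N[of "Suc (n + n)"] N[of "Suc (n + k)"] N[of "Suc (k + k)"] that unfolding D by linarith
    then show ?thesis by blast
  qed
  have conv: "convergent (\<lambda>n. e n z w)" if "z \<in> space M" "w \<in> space M" for z w
  proof -
    have "Cauchy (\<lambda>n. e (Suc n) z w)"
    proof (rule CauchyI)
      fix \<epsilon> :: real assume \<epsilon>: "0 < \<epsilon>"
      \<comment> \<open>Chosen so that B^2 sqrt(\<open>\<eta>\<close> (m + 1)) / q =
        \<open>\<epsilon>\<close> B^2 / (B^2 + 1), which is strictly below
        \<open>\<epsilon>\<close>. The added ones cover B = 0 and m = 0.\<close>
      define \<eta> where "\<eta> = (\<epsilon> * q / (B\<^sup>2 + 1))\<^sup>2 / (m + 1)"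
      have m0: "0 \<le> m" by (simp add: m_def)
      have "0 < \<eta>" using \<epsilon> q m0 unfolding \<eta>_def by (intro divide_pos_pos zero_less_power mult_pos_pos) (auto intro: add_nonneg_pos)
      then obtain N where N: "\<And>n k. N \<le> n \<Longrightarrow> N \<le> k \<Longrightarrow> D n k < \<eta>" using D_small by blast
      have "norm (e (Suc n) z w - e (Suc k) z w) < \<epsilon>" if "N \<le> n" "N \<le> k" for n k
      proof -
        have "D n k * m \<le> \<eta> * (m + 1)"
          using N[OF that] m0 \<open>0 < \<eta>\<close> by (intro mult_mono) auto
        also have "\<dots> = (\<epsilon> * q / (B\<^sup>2 + 1))\<^sup>2" using m0 by (simp add: \<eta>_def)
        finally have "sqrt (D n k * m) \<le> sqrt ((\<epsilon> * q / (B\<^sup>2 + 1))\<^sup>2)" by (rule real_sqrt_le_mono)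
        also have "\<dots> = \<epsilon> * q / (B\<^sup>2 + 1)" using \<epsilon> q by (intro real_sqrt_unique) (auto simp: add_nonneg_pos)
        finally have "B\<^sup>2 * sqrt (D n k * m) / q \<le> B\<^sup>2 * (\<epsilon> * q / (B\<^sup>2 + 1)) / q"
          using q by (intro divide_right_mono mult_left_mono) auto
        also have "\<dots> = \<epsilon> * (B\<^sup>2 / (B\<^sup>2 + 1))" using q by simp
        also have "\<dots> < \<epsilon> * 1"
          using \<epsilon> by (intro mult_strict_left_mono) (subst pos_divide_less_eq, auto intro: add_nonneg_pos)
        finally show ?thesis using e_diff[OF \<open>z \<in> space M\<close> \<open>w \<in> space M\<close>, of n k] by simp
      qed
      then show "\<exists>N. \<forall>n\<ge>N. \<forall>k\<ge>N. norm (e (Suc n) z w - e (Suc k) z w) < \<epsilon>" by blast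
    qed
    then have "convergent (\<lambda>n. e (Suc n) z w)" by (simp only: Cauchy_convergent_iff)
    then show ?thesis by (rule convergent_Suc_iff[THEN iffD1])
  qed
  define l where "l z w = lim (\<lambda>n. e n z w)" for z w
  have e_l: "(\<lambda>n. e (Suc n) z w) \<longlonglongrightarrow> l z w" if "z \<in> space M" "w \<in> space M" for z w
    using conv[OF that] unfolding l_def by (intro LIMSEQ_Suc) (simp add: convergent_LIMSEQ_iff)
  have [measurable]: "case_prod l \<in> borel_measurable ?P"
  proof -
    have "(\<lambda>p. lim (\<lambda>n. e n (fst p) (snd p))) \<in> borel_measurable ?P"
      by (rule borel_measurable_lim_metric) measurable
    then show ?thesis by (simp add: l_def case_prod_beta')
  qed
  define C where "C = B\<^sup>2 * sqrt (b 0 * m) / q"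
  have e_C: "cmod (e (Suc n) z w) \<le> C" if "z \<in> space M" "w \<in> space M" for n z w
    using e_bound[OF that] by (simp add: C_def)
  have l_bound: "cmod (l z w) \<le> C" if "z \<in> space M" "w \<in> space M" for z w
    using tendsto_norm[OF e_l[OF that]] e_C[OF that]
    by (intro LIMSEQ_le_const2) auto
  \<comment> \<open>T^2 maps \<open>e n\<close> to q times \<open>e (n + 1)\<close>; both sides pass
    to the limit, the left one by dominated convergence.\<close>
  have eig: "(LINT y|M. kp 1 z y * l y w) = q * l z w" if zw[simp]: "z \<in> space M" "w \<in> space M" for z w
  proof (rule LIMSEQ_unique)
    obtain C1 where C1: "0 \<le> C1" "\<And>z w. z \<in> space M \<Longrightarrow> w \<in> space M \<Longrightarrow> cmod (kp 1 z w) \<le> C1"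
      using kp_boundedE[of 1] by blast
    show "(\<lambda>n. LINT y|M. kp 1 z y * e (Suc n) y w) \<longlonglongrightarrow> (LINT y|M. kp 1 z y * l y w)"
    proof (rule integral_dominated_convergence[where w="\<lambda>_. C1 * C"])
      show "AE y in M. (\<lambda>n. kp 1 z y * e (Suc n) y w) \<longlonglongrightarrow> kp 1 z y * l y w"
        by (intro AE_I2 tendsto_mult tendsto_const e_l) auto
      show "AE y in M. norm (kp 1 z y * e (Suc n) y w) \<le> C1 * C" for n
        using C1 e_C by (intro AE_I2) (auto simp: norm_mult simp del: One_nat_def intro!: mult_mono)
    qed auto
    have "(LINT y|M. kp 1 z y * e n y w) = q * e (Suc n) z w" for n
    proof -
      have "(LINT y|M. kp 1 z y * e n y w) = (LINT y|M. kp 1 z y * kp (Suc (2 * n)) y w) / of_real (q ^ Suc n)"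
        by (simp add: e_def)
      also have "\<dots> = kp (Suc (2 * Suc n)) z w / of_real (q ^ Suc n)" unfolding kp_add[OF zw] by simp
      finally show ?thesis using q by (simp add: e_def)
    qed
    then show "(\<lambda>n. LINT y|M. kp 1 z y * e (Suc n) y w) \<longlonglongrightarrow> q * l z w"
      using tendsto_mult[OF tendsto_const[of "complex_of_real q"] LIMSEQ_Suc[OF e_l[OF zw]]] by simp
  qed
  \<comment> \<open>The common bound C lets the norms pass to the limit. The squared norm of
    \<open>E n\<close> is b(2n+1), which is at least 1, so the limit kernel cannot vanish almost
    everywhere.\<close>
  have "(\<lambda>n. nsq ?P (E (Suc n))) \<longlonglongrightarrow> nsq ?P (case_prod l)"
    unfolding nsq_def
  proof (rule integral_dominated_convergence[where w="\<lambda>_. C\<^sup>2"])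
    show "AE p in ?P. (\<lambda>n. (cmod (E (Suc n) p))\<^sup>2) \<longlonglongrightarrow> (cmod (case_prod l p))\<^sup>2"
      by (intro AE_I2 tendsto_power tendsto_norm) (auto simp: E_def space_pair_measure intro: e_l)
    show "AE p in ?P. norm ((cmod (E (Suc n) p))\<^sup>2) \<le> C\<^sup>2" for n
      using e_C by (intro AE_I2) (auto simp: E_def space_pair_measure intro!: power_mono)
  qed (use E_sq in \<open>auto simp: sq_int_def\<close>)
  moreover have "1 \<le> nsq ?P (E n)" for n
    using ip_E[of n n] ge1[of "Suc (n + n)"] unfolding ip_self of_real_eq_iff by (simp add: b_def)
  ultimately have "1 \<le> nsq ?P (case_prod l)" by (intro LIMSEQ_le_const) auto
  moreover have "nsq ?P (case_prod l) = 0" if "AE p in ?P. case_prod l p = 0"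
    unfolding nsq_def using that by (intro integral_eq_zero_AE) auto
  ultimately have "\<not> (AE p in ?P. case_prod l p = 0)" by auto
  then have "\<not> (AE w in M. AE z in M. l z w = 0)"
  proof (rule contrapos_nn)
    assume *: "AE w in M. AE z in M. l z w = 0"
    have "AE z in M. AE w in M. l z w = 0"
      by (subst P.AE_commute) (use * in \<open>auto\<close>)
    then show "AE p in ?P. case_prod l p = 0"
      by (intro P.AE_pair_measure) auto
  qed
  then have "\<exists>w\<in>space M. \<not> (AE z in M. l z w = 0)"
    by (blast intro: AE_I2)
  then obtain w where w[simp]: "w \<in> space M" "\<not> (AE z in M. l z w = 0)" by blast
  have bm: "bounded_measurable (\<lambda>z. l z w)"
    unfolding bounded_measurable_def
  proof (intro conjI exI[of _ C] ballI)
    show "(\<lambda>z. l z w) \<in> borel_measurable M" by measurable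
    show "0 \<le> C" using order_trans[OF norm_ge_zero l_bound[OF w(1) w(1)]] .
  qed (simp add: l_bound)
  show ?thesis
    by (rule that[OF q bm w(2)]) (simp only: opr_opr[OF bm] eig w(1))
qed

text \<open>With s = sqrt q, T^2 - q factors as (T - s)(T + s). So u = (T + s) v is annihilated by T
  - s: either u is an eigenvector for s, or u vanishes and v itself is an eigenvector for
  -s.\<close>

theorem eigenvector_exists:
  assumes nz: "\<not> (AE p in M \<Otimes>\<^sub>M M. case_prod r p = 0)"
  obtains \<mu> :: real and v where "\<mu> \<noteq> 0" "bounded_measurable v" "\<not> (AE z in M. v z = 0)"
    "\<And>z. z \<in> space M \<Longrightarrow> opr v z = of_real \<mu> * v z"
proof -
  have "nsq (M \<Otimes>\<^sub>M M) (K 0) \<noteq> 0" using nz nsq_zero_iff[OF sq_int_K[of 0]] by (simp add: K_def)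
  then obtain q v where q: "0 < q" and v: "bounded_measurable v" "\<not> (AE z in M. v z = 0)"
    and eig: "\<And>z. z \<in> space M \<Longrightarrow> opr (opr v) z = of_real q * v z"
    using squared_eigenvector_exists by blast
  define s where "s = sqrt q"
  have s: "0 < s" "complex_of_real s * of_real s = of_real q"
    using q by (auto simp: s_def simp flip: of_real_mult)
  note ov = bounded_measurable_opr[OF v(1)]
  define u where "u z = opr v z + of_real s * v z" for z
  have u_bm: "bounded_measurable u"
  proof -
    obtain C where C: "0 \<le> C" "\<And>x. x \<in> space M \<Longrightarrow> cmod (opr v x) \<le> C"
      using ov by (auto simp: bounded_measurable_def)
    obtain D where D: "0 \<le> D" "\<And>x. x \<in> space M \<Longrightarrow> cmod (v x) \<le> D"
      using v(1) by (auto simp: bounded_measurable_def)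
    have "cmod (u x) \<le> C + s * D" if "x \<in> space M" for x
      unfolding u_def using C(2)[OF that] D(2)[OF that] s(1)
      by (intro norm_triangle_le add_mono) (auto simp: norm_mult)
    moreover have "u \<in> borel_measurable M" unfolding u_def using v(1) ov by measurable
    moreover have "0 \<le> C + s * D" using C D s by auto
    ultimately show ?thesis unfolding bounded_measurable_def by blast
  qed
  have int: "integrable M (\<lambda>y. r z y * f y)" if [simp]: "z \<in> space M" and f: "bounded_measurable f" for z f
  proof -
    obtain C where C: "0 \<le> C" "\<And>x. x \<in> space M \<Longrightarrow> cmod (f x) \<le> C"
      using f by (auto simp: bounded_measurable_def)
    note [measurable] = bounded_measurableD[OF f]
    show ?thesis
      using C r_bound r_bound_nonneg[of z]
      by (intro integrable_bounded[of _ "B * C"]) (measurable, auto simp: norm_mult intro!: mult_mono)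
  qed
  have u_eig: "opr u z = of_real s * u z" if z: "z \<in> space M" for z
  proof -
    have "opr u z = (LINT y|M. r z y * opr v y + of_real s * (r z y * v y))"
      unfolding opr_def[of u] u_def by (simp add: algebra_simps)
    also have "\<dots> = opr (opr v) z + of_real s * opr v z"
      unfolding opr_def[of "opr v"] opr_def[of v z] using int[OF z v(1)] int[OF z ov] by simp
    also have "\<dots> = of_real s * u z"
      unfolding eig[OF z] u_def s(2)[symmetric] by (simp add: algebra_simps)
    finally show ?thesis .
  qed
  show ?thesis
  proof (cases "AE z in M. u z = 0")
    case False
    with u_bm u_eig s show ?thesis by (intro that[of s u]) auto
  next
    case True
    \<comment> \<open>Integration ignores null sets, so T u vanishes at every point; the pointwise
      equation T u = s u then upgrades u = 0 from almost everywhere to everywhere.\<close>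
    have "opr u z = 0" for z
      unfolding opr_def using True by (intro integral_eq_zero_AE) auto
    then have "u z = 0" if "z \<in> space M" for z using u_eig[OF that] s by auto
    then have "opr v z = of_real (- s) * v z" if "z \<in> space M" for z
      using that by (auto simp: u_def add_eq_0_iff)
    with v s show ?thesis by (intro that[of "- s" v]) auto
  qed
qed

end

section \<open>Lebesgue measure on finite products\<close>

interpretation lb: product_sigma_finite "\<lambda>_::nat. lborel :: real measure" ..

lemma sigma_finite_leb: "sigma_finite_measure (leb n)"
  unfolding leb_def by (rule lb.sigma_finite) simp

interpretation leb: sigma_finite_measure "leb n" for n by (rule sigma_finite_leb)

interpretation leb2: pair_sigma_finite "leb n" "leb m" for n m ..

lemma space_leb: "space (leb n) = {..<n} \<rightarrow>\<^sub>E UNIV"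
  by (simp add: leb_def space_PiM)

lemma sets_leb: "sets (leb n) = sets (PiM {..<n} (\<lambda>_. borel))"
  unfolding leb_def by (rule sets_PiM_cong) auto

lemma leb_eqI:
  assumes "sets P = sets (leb n)"
    and "\<And>A. (\<And>i. i < n \<Longrightarrow> A i \<in> sets borel) \<Longrightarrow>
      emeasure P (Pi\<^sub>E {..<n} A) = (\<Prod>i<n. emeasure lborel (A i))"
  shows "P = leb n"
  unfolding leb_def by (rule lb.PiM_eqI) (use assms in \<open>auto simp: leb_def\<close>)

lemma emeasure_leb_PiE:
  "(\<And>i. i < n \<Longrightarrow> A i \<in> sets borel) \<Longrightarrow> emeasure (leb n) (Pi\<^sub>E {..<n} A) = (\<Prod>i<n. emeasure lborel (A i))"
  unfolding leb_def by (rule lb.emeasure_PiM) auto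

lemma PiE_sets_leb: "(\<And>i. i < n \<Longrightarrow> A i \<in> sets borel) \<Longrightarrow> Pi\<^sub>E {..<n} A \<in> sets (leb n)"
  unfolding sets_leb by (intro sets_PiM_I_finite) auto

lemma measurable_leb_component: "i < n \<Longrightarrow> (\<lambda>x. x i) \<in> borel_measurable (leb n)"
  by (subst measurable_cong_sets[OF sets_leb refl]) (auto intro: measurable_component_singleton)

lemma measurable_leb_restrict:
  assumes "\<And>i. i < n \<Longrightarrow> (\<lambda>x. f x i) \<in> borel_measurable N"
  shows "(\<lambda>x. \<lambda>i\<in>{..<n}. f x i) \<in> measurable N (leb n)"
  by (subst measurable_cong_sets[OF refl sets_leb]) (use assms in \<open>auto intro: measurable_restrict\<close>)

lemma measurable_leb_comp:
  assumes "f \<in> measurable N (leb n)" "i < n"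
  shows "(\<lambda>x. f x i) \<in> borel_measurable N"
  using measurable_compose[OF assms(1) measurable_leb_component[OF assms(2)]] .

lemma measurable_vdiff[measurable (raw)]:
  assumes "f \<in> measurable N (leb n)" "g \<in> measurable N (leb n)"
  shows "(\<lambda>x. vdiff n (f x) (g x)) \<in> measurable N (leb n)"
  unfolding vdiff_def
  by (intro measurable_leb_restrict borel_measurable_diff measurable_leb_comp[OF assms(1)] measurable_leb_comp[OF assms(2)])

lemma measurable_dotp[measurable (raw)]:
  assumes "f \<in> measurable N (leb n)" "g \<in> measurable N (leb n)"
  shows "(\<lambda>x. dotp n (f x) (g x)) \<in> borel_measurable N"
  unfolding dotp_def
  by (intro borel_measurable_sum borel_measurable_times measurable_leb_comp[OF assms(1)] measurable_leb_comp[OF assms(2)]) auto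

lemma measurable_tpart[measurable (raw)]:
  assumes "f \<in> measurable N (leb (2 * n))"
  shows "(\<lambda>x. tpart n (f x)) \<in> measurable N (leb n)"
  unfolding tpart_def by (intro measurable_leb_restrict measurable_leb_comp[OF assms]) auto

lemma measurable_fpart[measurable (raw)]:
  assumes "f \<in> measurable N (leb (2 * n))"
  shows "(\<lambda>x. fpart n (f x)) \<in> measurable N (leb n)"
  unfolding fpart_def by (intro measurable_leb_restrict measurable_leb_comp[OF assms]) auto

lemma emeasure_lborel_affine:
  assumes c: "\<bar>c\<bar> = 1" and A: "A \<in> sets borel"
  shows "emeasure lborel ((\<lambda>t. a + c * t) -` A) = emeasure lborel (A :: real set)"
proof -
  have "lborel = density (distr lborel borel (\<lambda>t. a + c * t)) (\<lambda>_. ennreal \<bar>c\<bar>)"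
    using c by (intro lborel_real_affine) auto
  also have "\<dots> = distr lborel borel (\<lambda>t. a + c * t)" using c by (simp add: density_1)
  finally have "emeasure lborel A = emeasure (distr lborel borel (\<lambda>t. a + c * t)) A" by simp
  then show ?thesis using A by (simp add: emeasure_distr)
qed

lemma measurable_affine:
  "(\<lambda>t. \<lambda>i\<in>{..<n}. a i + c * t i) \<in> measurable (leb n) (leb n)"
  by (intro measurable_leb_restrict borel_measurable_add borel_measurable_times measurable_leb_component) auto

text \<open>Checked on boxes, one coordinate at a time. Besides translations (c = 1) the reflections
  (c = -1) are needed, for substitutions of the form u = x - t.\<close>

lemma distr_leb_affine:
  assumes c: "\<bar>c\<bar> = 1"
  shows "distr (leb n) (leb n) (\<lambda>t. \<lambda>i\<in>{..<n}. a i + c * t i) = leb n"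
proof (rule leb_eqI)
  fix A :: "nat \<Rightarrow> real set" assume A: "\<And>i. i < n \<Longrightarrow> A i \<in> sets borel"
  have eq: "(\<lambda>t. \<lambda>i\<in>{..<n}. a i + c * t i) -` Pi\<^sub>E {..<n} A \<inter> space (leb n)
      = Pi\<^sub>E {..<n} (\<lambda>i. (\<lambda>t. a i + c * t) -` A i)"
    by (auto simp: space_leb PiE_iff)
  have m: "(\<lambda>t. a i + c * t) -` A i \<in> sets borel" if "i < n" for i
  proof -
    have "(\<lambda>t. a i + c * t) -` A i \<inter> space borel \<in> sets borel"
      by (rule measurable_sets[OF _ A[OF that]]) measurable
    then show ?thesis by simp
  qed
  show "emeasure (distr (leb n) (leb n) (\<lambda>t. \<lambda>i\<in>{..<n}. a i + c * t i)) (Pi\<^sub>E {..<n} A)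
      = (\<Prod>i<n. emeasure lborel (A i))"
    using A m by (subst emeasure_distr) (auto simp: eq measurable_affine PiE_sets_leb emeasure_leb_PiE
        emeasure_lborel_affine[OF c] intro!: prod.cong)
qed simp

lemma distr_vdiff_left: "distr (leb n) (leb n) (\<lambda>t. vdiff n t x) = leb n"
  using distr_leb_affine[where c = 1 and n = n and a = "\<lambda>i. - x i"] by (simp add: vdiff_def)

lemma distr_vdiff_right: "distr (leb n) (leb n) (\<lambda>t. vdiff n x t) = leb n"
  using distr_leb_affine[where c = "-1" and n = n and a = x] by (simp add: vdiff_def)

lemma vdiff_measurable_fixed[measurable]:
  "(\<lambda>t. vdiff n t x) \<in> measurable (leb n) (leb n)" "(\<lambda>t. vdiff n x t) \<in> measurable (leb n) (leb n)"
  using measurable_affine[where n = n and a = "\<lambda>i. - x i" and c = 1] measurable_affine[where n = n and a = x and c = "-1"] by (simp_all add: vdiff_def)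

lemma nn_integral_vdiff:
  assumes "f \<in> borel_measurable (leb n)"
  shows "(\<integral>\<^sup>+t. f (vdiff n t x) \<partial>leb n) = integral\<^sup>N (leb n) f"
    and "(\<integral>\<^sup>+t. f (vdiff n x t) \<partial>leb n) = integral\<^sup>N (leb n) f"
  using nn_integral_distr[OF vdiff_measurable_fixed(1)[of n x], of f]
    nn_integral_distr[OF vdiff_measurable_fixed(2)[of n x], of f] assms
  by (simp_all add: distr_vdiff_left distr_vdiff_right)

lemma integral_vdiff:
  fixes f :: "_ \<Rightarrow> 'b :: {banach, second_countable_topology}"
  assumes "f \<in> borel_measurable (leb n)"
  shows "(LINT t|leb n. f (vdiff n t x)) = integral\<^sup>L (leb n) f"
    and "(LINT t|leb n. f (vdiff n x t)) = integral\<^sup>L (leb n) f"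
  using integral_distr[OF vdiff_measurable_fixed(1)[of n x] , of f]
    integral_distr[OF vdiff_measurable_fixed(2)[of n x] , of f] assms
  by (simp_all add: distr_vdiff_left distr_vdiff_right)

lemma integrable_vdiff:
  fixes f :: "_ \<Rightarrow> 'b :: {banach, second_countable_topology}"
  assumes "integrable (leb n) f"
  shows "integrable (leb n) (\<lambda>t. f (vdiff n t x))" "integrable (leb n) (\<lambda>t. f (vdiff n x t))"
proof -
  show "integrable (leb n) (\<lambda>t. f (vdiff n t x))"
    by (rule integrable_distr[of _ _ "leb n"]) (use assms in \<open>auto simp: distr_vdiff_left\<close>)
  show "integrable (leb n) (\<lambda>t. f (vdiff n x t))"
    by (rule integrable_distr[of _ _ "leb n"]) (use assms in \<open>auto simp: distr_vdiff_right\<close>)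
qed

section \<open>Phase space as the product of time and frequency\<close>

definition vjoin :: "nat \<Rightarrow> (nat \<Rightarrow> real) \<Rightarrow> (nat \<Rightarrow> real) \<Rightarrow> nat \<Rightarrow> real" where
  "vjoin d x y = (\<lambda>i\<in>{..<2 * d}. if i < d then x i else y (i - d))"

lemma vjoin_measurable[measurable]: "case_prod (vjoin d) \<in> measurable (leb d \<Otimes>\<^sub>M leb d) (leb (2 * d))"
proof -
  have "(\<lambda>p. \<lambda>i\<in>{..<2 * d}. if i < d then fst p i else snd p (i - d)) \<in> measurable (leb d \<Otimes>\<^sub>M leb d) (leb (2 * d))"
  proof (rule measurable_leb_restrict)
    fix i assume "i < 2 * d"
    then show "(\<lambda>p. if i < d then fst p i else snd p (i - d)) \<in> borel_measurable (leb d \<Otimes>\<^sub>M leb d)"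
      by (cases "i < d") (auto intro!: measurable_leb_comp[where n=d])
  qed
  then show ?thesis by (simp add: vjoin_def case_prod_beta')
qed

text \<open>The preimage of a box under joining is the product of its time box and its frequency
  box. This turns integrals over phase space into iterated integrals in x and \<xi>.\<close>

lemma distr_vjoin: "distr (leb d \<Otimes>\<^sub>M leb d) (leb (2 * d)) (case_prod (vjoin d)) = leb (2 * d)"
proof (rule leb_eqI)
  fix A :: "nat \<Rightarrow> real set" assume A: "\<And>i. i < 2 * d \<Longrightarrow> A i \<in> sets borel"
  have eq: "case_prod (vjoin d) -` Pi\<^sub>E {..<2 * d} A \<inter> space (leb d \<Otimes>\<^sub>M leb d)
      = Pi\<^sub>E {..<d} A \<times> Pi\<^sub>E {..<d} (\<lambda>i. A (d + i))"
  proof (intro set_eqI iffI)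
    fix p assume p: "p \<in> case_prod (vjoin d) -` Pi\<^sub>E {..<2 * d} A \<inter> space (leb d \<Otimes>\<^sub>M leb d)"
    have *: "(if i < d then fst p i else snd p (i - d)) \<in> A i" if "i < 2 * d" for i
      using p that by (auto simp: PiE_iff vjoin_def case_prod_beta' Pi_iff)
    have "fst p i \<in> A i" if "i < d" for i using *[of i] that by auto
    moreover have "snd p i \<in> A (d + i)" if "i < d" for i using *[of "d + i"] that by auto
    ultimately show "p \<in> Pi\<^sub>E {..<d} A \<times> Pi\<^sub>E {..<d} (\<lambda>i. A (d + i))"
      using p by (auto simp: PiE_iff space_pair_measure space_leb)
  next
    fix p assume p: "p \<in> Pi\<^sub>E {..<d} A \<times> Pi\<^sub>E {..<d} (\<lambda>i. A (d + i))"
    then obtain x y where xy: "p = (x, y)" "x \<in> Pi\<^sub>E {..<d} A" "y \<in> Pi\<^sub>E {..<d} (\<lambda>i. A (d + i))"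
      by blast
    have "vjoin d x y i \<in> A i" if "i < 2 * d" for i
    proof (cases "i < d")
      case True
      then show ?thesis using PiE_mem[OF xy(2), of i] by (simp add: vjoin_def)
    next
      case False
      then show ?thesis using PiE_mem[OF xy(3), of "i - d"] that by (simp add: vjoin_def)
    qed
    then have "vjoin d x y \<in> Pi\<^sub>E {..<2 * d} A" by (simp add: PiE_iff) (simp add: vjoin_def)
    moreover have "x \<in> space (leb d)" "y \<in> space (leb d)"
      using xy(2,3) by (simp_all add: space_leb PiE_iff)
    ultimately show "p \<in> case_prod (vjoin d) -` Pi\<^sub>E {..<2 * d} A \<inter> space (leb d \<Otimes>\<^sub>M leb d)"
      by (simp add: xy(1) space_pair_measure)
  qed
  have m: "A i \<in> sets borel" "A (d + i) \<in> sets borel" if "i < d" for i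
    using A[of i] A[of "d + i"] that by auto
  have split: "(\<Prod>i<2 * d. f i) = (\<Prod>i<d. f i) * (\<Prod>i<d. f (d + i))" for f :: "nat \<Rightarrow> ennreal"
    using prod.nat_group[of f d 2] by (simp add: numeral_2_eq_2 lessThan_Suc mult.commute atLeast0LessThan[symmetric]
        prod.shift_bounds_nat_ivl[of f 0 d d, simplified, symmetric] add.commute)
  show "emeasure (distr (leb d \<Otimes>\<^sub>M leb d) (leb (2 * d)) (case_prod (vjoin d))) (Pi\<^sub>E {..<2 * d} A)
      = (\<Prod>i<2 * d. emeasure lborel (A i))"
    using A m by (subst emeasure_distr)
      (auto simp: eq PiE_sets_leb emeasure_leb_PiE leb.emeasure_pair_measure_Times split)
qed simp

lemma tpart_vjoin[simp]: "x \<in> space (leb d) \<Longrightarrow> tpart d (vjoin d x y) = x"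
  by (auto simp: tpart_def vjoin_def space_leb PiE_iff extensional_def fun_eq_iff)

lemma fpart_vjoin[simp]: "y \<in> space (leb d) \<Longrightarrow> fpart d (vjoin d x y) = y"
  by (auto simp: fpart_def vjoin_def space_leb PiE_iff extensional_def fun_eq_iff)

lemma nn_integral_vjoin:
  assumes [measurable]: "f \<in> borel_measurable (leb (2 * d))"
  shows "integral\<^sup>N (leb (2 * d)) f = (\<integral>\<^sup>+x. \<integral>\<^sup>+y. f (vjoin d x y) \<partial>leb d \<partial>leb d)"
proof -
  have "integral\<^sup>N (leb (2 * d)) f = (\<integral>\<^sup>+p. f (case_prod (vjoin d) p) \<partial>(leb d \<Otimes>\<^sub>M leb d))"
    by (subst distr_vjoin[symmetric], subst nn_integral_distr) measurable
  also have "\<dots> = (\<integral>\<^sup>+x. \<integral>\<^sup>+y. f (vjoin d x y) \<partial>leb d \<partial>leb d)"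
    by (subst leb.nn_integral_fst[symmetric]) (auto simp: case_prod_beta')
  finally show ?thesis .
qed

section \<open>Continuity of translations\<close>

lemma sq_int_indicator: "A \<in> sets M \<Longrightarrow> emeasure M A < \<infinity> \<Longrightarrow> sq_int M (indicator A)"
proof -
  assume "A \<in> sets M" "emeasure M A < \<infinity>"
  moreover have "(\<lambda>x. (cmod (indicator A x))\<^sup>2) = (indicator A :: _ \<Rightarrow> real)"
    by (auto simp: indicator_def)
  ultimately show ?thesis by (simp add: sq_int_def)
qed

text \<open>Density of simple functions with level sets of finite measure: a measurable f is a
  pointwise limit of simple functions of modulus at most 2 |f|, and dominated convergence with 9
  |f|^2 gives convergence in L^2.\<close>

lemma sq_int_induct[consumes 1, case_names indicator cmult add lim]:
  assumes f: "sq_int M f"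
    and ind: "\<And>A. A \<in> sets M \<Longrightarrow> emeasure M A < \<infinity> \<Longrightarrow> P (indicator A)"
    and cmult: "\<And>c f. sq_int M f \<Longrightarrow> P f \<Longrightarrow> P (\<lambda>x. c * f x)"
    and add: "\<And>f g. sq_int M f \<Longrightarrow> sq_int M g \<Longrightarrow> P f \<Longrightarrow> P g \<Longrightarrow> P (\<lambda>x. f x + g x)"
    and lim: "\<And>f s. sq_int M f \<Longrightarrow> (\<And>i::nat. sq_int M (s i)) \<Longrightarrow> (\<And>i. P (s i)) \<Longrightarrow>
        (\<lambda>i. nsq M (\<lambda>x. f x - s i x)) \<longlonglongrightarrow> 0 \<Longrightarrow> P f"
  shows "P f"
proof -
  note [measurable] = sq_int_measurable[OF f]
  obtain s :: "nat \<Rightarrow> 'a \<Rightarrow> complex" where s: "\<And>i. simple_function M (s i)"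
    and s_lim: "\<And>x. x \<in> space M \<Longrightarrow> (\<lambda>i. s i x) \<longlonglongrightarrow> f x"
    and s_bd: "\<And>i x. x \<in> space M \<Longrightarrow> norm (s i x) \<le> 2 * norm (f x)"
    using borel_measurable_implies_sequence_metric[OF sq_int_measurable[OF f], of 0] by (metis dist_0_norm dist_commute)
  have [measurable]: "s i \<in> borel_measurable M" for i
    using s borel_measurable_simple_function by blast
  have s_sq: "sq_int M (s i)" for i
  proof (rule sq_int_bound)
    show "integrable M (\<lambda>x. 4 * (cmod (f x))\<^sup>2)" using f by (simp add: sq_int_def)
    show "(cmod (s i x))\<^sup>2 \<le> 4 * (cmod (f x))\<^sup>2" if "x \<in> space M" for x
      using power_mono[OF s_bd[OF that, of i] norm_ge_zero, of 2] by (simp add: power_mult_distrib)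
  qed measurable
  have Ps: "P (s i)" for i
  proof -
    let ?Y = "s i ` space M - {0}"
    let ?A = "\<lambda>y. {x \<in> space M. s i x = y}"
    have finY: "finite ?Y" using s[of i] by (simp add: simple_function_def)
    have Am: "?A y \<in> sets M" for y by measurable
    \<comment> \<open>By Markov's inequality a level set of a square-integrable function has finite
      measure, unless the level is 0; this is why \<open>?Y\<close> leaves 0 out.\<close>
    have Af: "emeasure M (?A y) < \<infinity>" if "y \<noteq> 0" for y
    proof -
      have "integrable M (\<lambda>x. (cmod (s i x))\<^sup>2)" using s_sq by (simp add: sq_int_def)
      from integral_Markov_inequality[OF this, of "(cmod y)\<^sup>2"] that
      have "emeasure M {x \<in> space M. (cmod (s i x))\<^sup>2 \<ge> (cmod y)\<^sup>2} < \<infinity>"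
        by (auto intro: order_le_less_trans)
      moreover have "emeasure M (?A y) \<le> emeasure M {x \<in> space M. (cmod (s i x))\<^sup>2 \<ge> (cmod y)\<^sup>2}"
        by (intro emeasure_mono) auto
      ultimately show ?thesis by (rule order_le_less_trans[rotated])
    qed
    have "sq_int M (\<lambda>x. \<Sum>y\<in>Y. y * indicator (?A y) x) \<and> P (\<lambda>x. \<Sum>y\<in>Y. y * indicator (?A y) x)"
      if "finite Y" "0 \<notin> Y" for Y
      using that
    proof (induction Y)
      case empty
      have "P (\<lambda>x. 0)" using cmult[of "indicator {}" 0] ind[of "{}"] sq_int_indicator[of "{}" M] by simp
      then show ?case by simp
    next
      case (insert y Y)
      then have "sq_int M (indicator (?A y))" "P (indicator (?A y))"
        using Af Am by (auto intro: sq_int_indicator ind)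
      moreover from insert have "sq_int M (\<lambda>x. \<Sum>y\<in>Y. y * indicator (?A y) x)"
        "P (\<lambda>x. \<Sum>y\<in>Y. y * indicator (?A y) x)" by blast+
      ultimately show ?case
        unfolding sum.insert[OF insert(1,2)] by (intro conjI add cmult sq_int_add sq_int_cmult)
    qed
    from this[OF finY] have sq: "sq_int M (\<lambda>x. \<Sum>y\<in>?Y. y * indicator (?A y) x)"
      and Pq: "P (\<lambda>x. \<Sum>y\<in>?Y. y * indicator (?A y) x)" by auto
    have eq: "s i x = (\<Sum>y\<in>?Y. y * indicator (?A y) x)" if "x \<in> space M" for x
    proof -
      have "(\<Sum>y\<in>?Y. y * indicator (?A y) x) = (\<Sum>y\<in>?Y. if y = s i x then y else 0)"
        using that by (intro sum.cong) (auto simp: indicator_def)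
      then show ?thesis using finY that by simp
    qed
    \<comment> \<open>The finite combination agrees with \<open>s i\<close> only on
      \<open>space M\<close>, so the two need not be equal as functions. The rule
      \<open>lim\<close>, applied to a constant sequence, bridges the gap.\<close>
    have "nsq M (\<lambda>x. s i x - (\<Sum>y\<in>?Y. y * indicator (?A y) x)) = 0"
      unfolding nsq_def
    proof (intro integral_eq_zero_AE AE_I2)
      fix x assume "x \<in> space M"
      from eq[OF this] have "s i x - (\<Sum>y\<in>?Y. y * indicator (?A y) x) = 0" by (metis diff_self)
      then show "(cmod (s i x - (\<Sum>y\<in>?Y. y * indicator (?A y) x)))\<^sup>2 = 0" by (metis norm_zero zero_power2)
    qed
    then have "(\<lambda>_::nat. nsq M (\<lambda>x. s i x - (\<Sum>y\<in>?Y. y * indicator (?A y) x))) \<longlonglongrightarrow> 0"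
      by (simp only: tendsto_const)
    with s_sq sq Pq show ?thesis by (rule lim)
  qed
  have "(\<lambda>i. nsq M (\<lambda>x. f x - s i x)) \<longlonglongrightarrow> (LINT x|M. (0::real))"
    unfolding nsq_def
  proof (rule integral_dominated_convergence[where w="\<lambda>x. 9 * (cmod (f x))\<^sup>2"])
    show "integrable M (\<lambda>x. 9 * (cmod (f x))\<^sup>2)" using f by (simp add: sq_int_def)
    show "AE x in M. (\<lambda>i. (cmod (f x - s i x))\<^sup>2) \<longlonglongrightarrow> 0"
    proof (rule AE_I2)
      fix x assume "x \<in> space M"
      then have "(\<lambda>i. (cmod (f x - s i x))\<^sup>2) \<longlonglongrightarrow> (cmod (f x - f x))\<^sup>2"
        by (intro tendsto_intros s_lim)
      then show "(\<lambda>i. (cmod (f x - s i x))\<^sup>2) \<longlonglongrightarrow> 0" by simp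
    qed
    show "AE x in M. norm ((cmod (f x - s i x))\<^sup>2) \<le> 9 * (cmod (f x))\<^sup>2" for i
    proof (rule AE_I2)
      fix x assume "x \<in> space M"
      then have "cmod (f x - s i x) \<le> 3 * cmod (f x)"
        using norm_triangle_ineq4[of "f x" "s i x"] s_bd[of x i] by simp
      from power_mono[OF this norm_ge_zero, of 2]
      show "norm ((cmod (f x - s i x))\<^sup>2) \<le> 9 * (cmod (f x))\<^sup>2" by (simp add: power_mult_distrib)
    qed
  qed measurable
  then show ?thesis using lim[OF f s_sq Ps] by simp
qed

lemma sq_int_vdiff:
  assumes "sq_int (leb n) f"
  shows "sq_int (leb n) (\<lambda>t. f (vdiff n t v))" "nsq (leb n) (\<lambda>t. f (vdiff n t v)) = nsq (leb n) f"
proof -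
  note [measurable] = sq_int_measurable[OF assms]
  show "sq_int (leb n) (\<lambda>t. f (vdiff n t v))"
    using integrable_vdiff(1)[OF sq_int_integrable[OF assms]] unfolding sq_int_def by simp
  show "nsq (leb n) (\<lambda>t. f (vdiff n t v)) = nsq (leb n) f"
    unfolding nsq_def by (rule integral_vdiff) measurable
qed

lemma tendsto_zero_ennreal_le:
  fixes f g :: "nat \<Rightarrow> ennreal"
  assumes "g \<longlonglongrightarrow> 0" "\<And>k. f k \<le> g k"
  shows "f \<longlonglongrightarrow> 0"
  using assms by (intro tendsto_sandwich[of "\<lambda>_. 0" f sequentially g 0]) auto

section \<open>Stability of measurable sets under small shifts\<close>

definition window :: "nat \<Rightarrow> nat \<Rightarrow> (nat \<Rightarrow> real) set" where
  "window n N = Pi\<^sub>E {..<n} (\<lambda>_. {- real N..real N})"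

lemma window_sets[measurable]: "window n N \<in> sets (leb n)"
  unfolding window_def by (rule PiE_sets_leb) auto

lemma emeasure_window_finite: "emeasure (leb n) (window n N) < \<infinity>"
  unfolding window_def by (subst emeasure_leb_PiE) (auto simp: ennreal_prod_eq_top less_top[symmetric] ennreal_power)

lemma window_mono: "N \<le> N' \<Longrightarrow> window n N \<subseteq> window n N'"
  unfolding window_def by (intro PiE_mono) auto

lemma window_exhausts: "(\<Union>N. window n N) = space (leb n)"
proof (intro set_eqI iffI)
  fix x assume x: "x \<in> space (leb n)"
  obtain N :: nat where N: "(\<Sum>i<n. \<bar>x i\<bar>) \<le> real N" using real_arch_simple by blast
  have "\<bar>x i\<bar> \<le> real N" if "i < n" for i
    using member_le_sum[of i "{..<n}" "\<lambda>i. \<bar>x i\<bar>"] that N by auto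
  then have "x i \<in> {- real N..real N}" if "i < n" for i using that by (auto simp: abs_le_iff minus_le_iff)
  then have "x \<in> window n N" using x by (auto simp: window_def space_leb PiE_iff)
  then show "x \<in> (\<Union>N. window n N)" by blast
qed (auto simp: window_def space_leb PiE_iff)

definition shift_diff :: "nat \<Rightarrow> (nat \<Rightarrow> real) \<Rightarrow> (nat \<Rightarrow> real) set \<Rightarrow> (nat \<Rightarrow> real) set" where
  "shift_diff n u E = {t \<in> space (leb n). (vdiff n t u \<in> E) \<noteq> (t \<in> E)}"

lemma shift_diff_sets[measurable]:
  assumes [measurable]: "E \<in> sets (leb n)"
  shows "shift_diff n u E \<in> sets (leb n)"
  unfolding shift_diff_def by measurable

locale null_shifts =
  fixes n :: nat and u :: "nat \<Rightarrow> nat \<Rightarrow> real"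
  assumes u_lim: "i < n \<Longrightarrow> (\<lambda>k. u k i) \<longlonglongrightarrow> 0"
begin

definition stable :: "(nat \<Rightarrow> real) set \<Rightarrow> bool" where
  "stable E \<longleftrightarrow> E \<in> sets (leb n) \<and>
    (\<forall>N. (\<lambda>k. emeasure (leb n) (window n N \<inter> shift_diff n (u k) E)) \<longlonglongrightarrow> 0)"

lemma stable_sets: "stable E \<Longrightarrow> E \<in> sets (leb n)"
  by (simp add: stable_def)

lemma stable_compl: "stable E \<Longrightarrow> stable (space (leb n) - E)"
proof -
  have "vdiff n t v \<in> space (leb n)" for t v by (simp add: vdiff_def space_leb)
  then have "shift_diff n v (space (leb n) - E) = shift_diff n v E" for v
    by (auto simp: shift_diff_def)
  then show "stable E \<Longrightarrow> stable (space (leb n) - E)" by (auto simp: stable_def)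
qed

lemma stable_empty: "stable {}"
  by (simp add: stable_def shift_diff_def)

lemma stable_Un: assumes "stable E" "stable F" shows "stable (E \<union> F)"
  unfolding stable_def
proof (intro conjI allI)
  note [measurable] = stable_sets[OF assms(1)] stable_sets[OF assms(2)]
  show "E \<union> F \<in> sets (leb n)" by measurable
  fix N
  let ?e = "\<lambda>E k. emeasure (leb n) (window n N \<inter> shift_diff n (u k) E)"
  have "(\<lambda>k. ?e E k + ?e F k) \<longlonglongrightarrow> 0 + 0"
    using assms by (intro tendsto_add) (auto simp: stable_def)
  then have lim: "(\<lambda>k. ?e E k + ?e F k) \<longlonglongrightarrow> 0" by simp
  show "(\<lambda>k. ?e (E \<union> F) k) \<longlonglongrightarrow> 0"
  proof (rule tendsto_zero_ennreal_le[rotated, where g = "\<lambda>k. ?e E k + ?e F k"])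
    fix k
    have "?e (E \<union> F) k \<le> emeasure (leb n) ((window n N \<inter> shift_diff n (u k) E) \<union> (window n N \<inter> shift_diff n (u k) F))"
      by (intro emeasure_mono) (auto simp: shift_diff_def)
    also have "\<dots> \<le> ?e E k + ?e F k" by (intro emeasure_subadditive) auto
    finally show "?e (E \<union> F) k \<le> ?e E k + ?e F k" .
  qed (rule lim)
qed

lemma stable_finite_Union: "(\<And>j. stable (E j)) \<Longrightarrow> stable (\<Union>j<m::nat. E j)"
  by (induction m) (auto simp: lessThan_Suc stable_empty stable_Un)

text \<open>A countable union differs from a finite one by a tail \<open>R m\<close>, whose measure
  inside a window tends to 0. A shifted point may involve the tail before or after the shift, hence
  the factor 2; the window grows by one because the shifts are eventually below 1 in each
  coordinate.\<close>

lemma stable_Union: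
  fixes E :: "nat \<Rightarrow> (nat \<Rightarrow> real) set"
  assumes E: "\<And>j. stable (E j)"
  shows "stable (\<Union>j. E j)"
  unfolding stable_def
proof (intro conjI allI)
  note [measurable] = stable_sets[OF E]
  show S: "(\<Union>j. E j) \<in> sets (leb n)" by measurable
  fix N
  define R where "R m = (\<Union>j. E j) - (\<Union>j<m. E j)" for m :: nat
  have R[measurable]: "R m \<in> sets (leb n)" for m unfolding R_def by measurable
  let ?e = "\<lambda>E k. emeasure (leb n) (window n N \<inter> shift_diff n (u k) E)"
  have "(\<lambda>m. emeasure (leb n) (window n (Suc N) \<inter> R m)) \<longlonglongrightarrow> emeasure (leb n) (\<Inter>m. window n (Suc N) \<inter> R m)"
  proof (rule Lim_emeasure_decseq)
    show "decseq (\<lambda>m. window n (Suc N) \<inter> R m)" by (force simp: decseq_def R_def)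
    show "emeasure (leb n) (window n (Suc N) \<inter> R m) \<noteq> \<infinity>" for m
      using emeasure_mono[of "window n (Suc N) \<inter> R m" "window n (Suc N)" "leb n"] emeasure_window_finite[of n "Suc N"]
      by (auto simp: top_unique less_top[symmetric])
  qed auto
  moreover have "(\<Inter>m. window n (Suc N) \<inter> R m) = {}" by (auto simp: R_def)
  ultimately have R_lim: "(\<lambda>m. emeasure (leb n) (window n (Suc N) \<inter> R m)) \<longlonglongrightarrow> 0" by simp
  have "\<forall>\<^sub>F k in sequentially. \<forall>i\<in>{..<n}. \<bar>u k i\<bar> < 1"
    using u_lim by (intro eventually_ball_finite) (use tendstoD[OF u_lim, of _ 1] in \<open>simp_all add: dist_real_def\<close>)
  then have ev: "\<forall>\<^sub>F k in sequentially. ?e (\<Union>j. E j) k \<le> ?e (\<Union>j<m. E j) k + 2 * emeasure (leb n) (window n (Suc N) \<inter> R m)" for m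
  proof eventually_elim
    case (elim k)
    have shifted: "emeasure (leb n) {t \<in> space (leb n). vdiff n t (u k) \<in> window n (Suc N) \<inter> R m}
        = emeasure (leb n) (window n (Suc N) \<inter> R m)"
    proof -
      have "emeasure (leb n) (window n (Suc N) \<inter> R m)
          = emeasure (distr (leb n) (leb n) (\<lambda>t. vdiff n t (u k))) (window n (Suc N) \<inter> R m)"
        by (simp add: distr_vdiff_left)
      also have "\<dots> = emeasure (leb n) ((\<lambda>t. vdiff n t (u k)) -` (window n (Suc N) \<inter> R m) \<inter> space (leb n))"
        by (rule emeasure_distr) measurable
      finally show ?thesis by (simp add: vimage_def Int_def conj_commute)
    qed
    have win: "vdiff n t (u k) \<in> window n (Suc N)" if "t \<in> window n N" for t
    proof -
      have "t i - u k i \<in> {- real (Suc N)..real (Suc N)}" if "i < n" for i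
      proof -
        have "t i \<in> {- real N..real N}" 
          using PiE_mem[of t "{..<n}" "\<lambda>_. {- real N..real N}" i] \<open>t \<in> window n N\<close> that
          by (simp only: window_def lessThan_iff)
        moreover have "\<bar>u k i\<bar> < 1" using elim that by blast
        ultimately show ?thesis unfolding atLeastAtMost_iff abs_less_iff of_nat_Suc by linarith
      qed
      then show ?thesis unfolding window_def vdiff_def by (intro PiE_I) simp_all
    qed
    have "?e (\<Union>j. E j) k \<le> emeasure (leb n) ((window n N \<inter> shift_diff n (u k) (\<Union>j<m. E j)) \<union>
        ({t \<in> space (leb n). vdiff n t (u k) \<in> window n (Suc N) \<inter> R m} \<union> (window n (Suc N) \<inter> R m)))"
      using win window_mono[of N "Suc N" n]
      by (intro emeasure_mono) (auto simp: shift_diff_def R_def)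
    also have "\<dots> \<le> ?e (\<Union>j<m. E j) k + emeasure (leb n) ({t \<in> space (leb n). vdiff n t (u k) \<in> window n (Suc N) \<inter> R m} \<union> (window n (Suc N) \<inter> R m))"
      by (intro emeasure_subadditive) auto
    also have "emeasure (leb n) ({t \<in> space (leb n). vdiff n t (u k) \<in> window n (Suc N) \<inter> R m} \<union> (window n (Suc N) \<inter> R m))
        \<le> emeasure (leb n) (window n (Suc N) \<inter> R m) + emeasure (leb n) (window n (Suc N) \<inter> R m)"
      by (rule order_trans[OF emeasure_subadditive]) (measurable, simp only: shifted order_refl)
    finally show ?case by (simp add: mult_2 add_left_mono)
  qed
  show "(\<lambda>k. ?e (\<Union>j. E j) k) \<longlonglongrightarrow> 0"
  proof (rule order_tendstoI)
    fix y :: ennreal assume y: "0 < y"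
    obtain z where z: "0 < z" "z < y" using dense[OF y] by blast
    have "(\<lambda>m. 2 * emeasure (leb n) (window n (Suc N) \<inter> R m)) \<longlonglongrightarrow> 2 * 0"
      by (intro ennreal_tendsto_cmult R_lim) auto
    then have "\<forall>\<^sub>F m in sequentially. 2 * emeasure (leb n) (window n (Suc N) \<inter> R m) < z"
      using z by (intro order_tendstoD(2)) auto
    then obtain m where m: "2 * emeasure (leb n) (window n (Suc N) \<inter> R m) < z"
      by (auto simp: eventually_sequentially)
    have "(\<lambda>k. ?e (\<Union>j<m. E j) k + z) \<longlonglongrightarrow> 0 + z"
      using stable_finite_Union[of E m, OF E] by (intro tendsto_add tendsto_const) (auto simp: stable_def)
    then have "\<forall>\<^sub>F k in sequentially. ?e (\<Union>j<m. E j) k + z < y"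
      using z by (intro order_tendstoD(2)) auto
    with ev[of m] show "\<forall>\<^sub>F k in sequentially. ?e (\<Union>j. E j) k < y"
    proof eventually_elim
      case (elim k)
      have "?e (\<Union>j. E j) k \<le> ?e (\<Union>j<m. E j) k + z"
        using elim(1) m by (meson add_left_mono less_imp_le order_trans)
      then show ?case using elim(2) by (rule order_le_less_trans)
    qed
  qed simp
qed

text \<open>A point whose membership changes lies in the slab of width 2 |u i| about the bounding
  hyperplane, and the window cuts this slab to a box of vanishing volume.\<close>

lemma stable_halfspace:
  assumes i: "i < n"
  shows "stable {f \<in> space (leb n). f i \<le> a}"
  unfolding stable_def
proof (intro conjI allI)
  have [measurable]: "(\<lambda>f. f i) \<in> borel_measurable (leb n)" using i by (rule measurable_leb_component)
  show "{f \<in> space (leb n). f i \<le> a} \<in> sets (leb n)" by measurable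
  fix N
  let ?E = "{f \<in> space (leb n). f i \<le> a}"
  let ?A = "\<lambda>k j. if j = i then {a - \<bar>u k i\<bar>..a + \<bar>u k i\<bar>} else {- real N..real N}"
  have le: "emeasure (leb n) (window n N \<inter> shift_diff n (u k) ?E)
      \<le> ennreal (2 * \<bar>u k i\<bar> * (2 * real N) ^ (n - 1))" for k
  proof -
    have "window n N \<inter> shift_diff n (u k) ?E \<subseteq> Pi\<^sub>E {..<n} (?A k)"
    proof
      fix t assume t: "t \<in> window n N \<inter> shift_diff n (u k) ?E"
      then have "(t i - u k i \<le> a) \<noteq> (t i \<le> a)"
        using i by (auto simp: shift_diff_def vdiff_def space_leb)
      then have "t i \<in> {a - \<bar>u k i\<bar>..a + \<bar>u k i\<bar>}" by auto
      then show "t \<in> Pi\<^sub>E {..<n} (?A k)" using t by (auto simp: window_def PiE_iff)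
    qed
    then have "emeasure (leb n) (window n N \<inter> shift_diff n (u k) ?E) \<le> emeasure (leb n) (Pi\<^sub>E {..<n} (?A k))"
      by (intro emeasure_mono PiE_sets_leb) auto
    also have "\<dots> = (\<Prod>j<n. emeasure lborel (?A k j))" by (rule emeasure_leb_PiE) auto
    also have "\<dots> = emeasure lborel (?A k i) * (\<Prod>j\<in>{..<n} - {i}. emeasure lborel (?A k j))"
      using i by (intro prod.remove) auto
    also have "(\<Prod>j\<in>{..<n} - {i}. emeasure lborel (?A k j)) = (\<Prod>j\<in>{..<n} - {i}. ennreal (2 * real N))"
      by (rule prod.cong) auto
    also have "\<dots> = ennreal ((2 * real N) ^ (n - 1))" using i by (simp add: ennreal_power card_Diff_singleton)
    also have "emeasure lborel (?A k i) = ennreal (2 * \<bar>u k i\<bar>)" by simp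
    finally show ?thesis by (simp add: ennreal_mult)
  qed
  have "(\<lambda>k. ennreal (2 * \<bar>u k i\<bar> * (2 * real N) ^ (n - 1))) \<longlonglongrightarrow> ennreal (2 * \<bar>0\<bar> * (2 * real N) ^ (n - 1))"
    by (intro tendsto_ennrealI tendsto_intros u_lim i)
  then have "(\<lambda>k. ennreal (2 * \<bar>u k i\<bar> * (2 * real N) ^ (n - 1))) \<longlonglongrightarrow> 0" by simp
  then show "(\<lambda>k. emeasure (leb n) (window n N \<inter> shift_diff n (u k) ?E)) \<longlonglongrightarrow> 0"
    using le by (rule tendsto_zero_ennreal_le)
qed

text \<open>The stable sets form a sigma-algebra containing all coordinate half-spaces. The identity
  is therefore measurable from that sigma-algebra to the Borel sets, so every Borel set is
  stable.\<close>

lemma stable_all: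
  assumes "E \<in> sets (leb n)"
  shows "stable E"
proof -
  let ?S = "Collect stable" and ?\<Omega> = "space (leb n)"
  have sub: "?S \<subseteq> Pow ?\<Omega>" using stable_sets sets.sets_into_space by blast
  have "sigma_algebra ?\<Omega> ?S"
    unfolding sigma_algebra_iff2 using sub stable_empty stable_compl
    by (auto intro!: stable_Union simp: image_subset_iff)
  then have sets: "sets (sigma ?\<Omega> ?S) = ?S" using sub by (simp add: sigma_algebra.sigma_sets_eq)
  have "(\<lambda>x. \<lambda>i\<in>{..<n}. x i) \<in> measurable (sigma ?\<Omega> ?S) (leb n)"
  proof (rule measurable_leb_restrict)
    fix i assume "i < n"
    then show "(\<lambda>x. x i) \<in> borel_measurable (sigma ?\<Omega> ?S)"
      unfolding borel_measurable_iff_le sets using stable_halfspace sub by (simp add: space_measure_of)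
  qed
  from measurable_sets[OF this assms]
  have "(\<lambda>x. \<lambda>i\<in>{..<n}. x i) -` E \<inter> ?\<Omega> \<in> ?S" using sub by (simp add: sets space_measure_of)
  moreover have "(\<lambda>x. \<lambda>i\<in>{..<n}. x i) -` E \<inter> ?\<Omega> = E"
    using sets.sets_into_space[OF assms] by (auto simp: space_leb PiE_restrict subset_iff)
  ultimately show ?thesis by simp
qed

text \<open>The inner products differ by at most the measure of the part of F where membership in E
  changes. Since F has finite measure, a large window misses little of it, and stability of E
  handles what lies inside.\<close>

lemma indicator_translation_continuous:
  assumes E: "E \<in> sets (leb n)" "emeasure (leb n) E < \<infinity>" and F: "F \<in> sets (leb n)" "emeasure (leb n) F < \<infinity>"
  shows "(\<lambda>k. ip (leb n) (\<lambda>t. indicator E (vdiff n t (u k))) (indicator F)) \<longlonglongrightarrow> ip (leb n) (indicator E) (indicator F)"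
proof -
  note [measurable] = E(1) F(1)
  have sq: "sq_int (leb n) (indicator E)" "sq_int (leb n) (indicator F)"
    using E F by (auto intro: sq_int_indicator)
  have bound: "cmod (ip (leb n) (\<lambda>t. indicator E (vdiff n t (u k))) (indicator F) - ip (leb n) (indicator E) (indicator F))
      \<le> measure (leb n) (F \<inter> shift_diff n (u k) E)" for k
  proof -
    let ?G = "F \<inter> shift_diff n (u k) E"
    have fin: "emeasure (leb n) ?G < \<infinity>"
      by (rule order_le_less_trans[OF emeasure_mono F(2)]) auto
    have "ip (leb n) (\<lambda>t. indicator E (vdiff n t (u k))) (indicator F) - ip (leb n) (indicator E) (indicator F)
        = (LINT t|leb n. (indicator E (vdiff n t (u k)) - indicator E t) * cnj (indicator F t))"
      unfolding ip_def
      by (subst Bochner_Integration.integral_diff[symmetric])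
        (auto intro!: integrable_mult_cnj sq sq_int_vdiff simp: left_diff_distrib)
    also have "cmod \<dots> \<le> (LINT t|leb n. cmod ((indicator E (vdiff n t (u k)) - indicator E t) * cnj (indicator F t)))"
      by (rule integral_norm_bound)
    also have "\<dots> = (LINT t|leb n. indicator ?G t)"
      by (intro Bochner_Integration.integral_cong) (auto simp: indicator_def shift_diff_def)
    finally show ?thesis using fin by simp
  qed
  have "(\<lambda>k. emeasure (leb n) (F \<inter> shift_diff n (u k) E)) \<longlonglongrightarrow> 0"
  proof (rule order_tendstoI)
    fix y :: ennreal assume y: "0 < y"
    obtain z where z: "0 < z" "z < y" using dense[OF y] by blast
    have "(\<lambda>N. emeasure (leb n) (F - window n N)) \<longlonglongrightarrow> emeasure (leb n) (\<Inter>N. F - window n N)"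
    proof (rule Lim_emeasure_decseq)
      show "decseq (\<lambda>N. F - window n N)" using window_mono by (force simp: decseq_def)
      show "emeasure (leb n) (F - window n N) \<noteq> \<infinity>" for N
        using emeasure_mono[of "F - window n N" F "leb n"] F by (auto simp: top_unique less_top[symmetric])
    qed auto
    moreover have "(\<Inter>N. F - window n N) = {}"
      using window_exhausts[of n] sets.sets_into_space[OF F(1)] by auto
    ultimately have "(\<lambda>N. emeasure (leb n) (F - window n N)) \<longlonglongrightarrow> 0" by (simp only: emeasure_empty)
    then have "\<forall>\<^sub>F N in sequentially. emeasure (leb n) (F - window n N) < z"
      using z by (intro order_tendstoD(2)) auto
    then obtain N where N: "emeasure (leb n) (F - window n N) < z" by (auto simp: eventually_sequentially)
    have "(\<lambda>k. emeasure (leb n) (window n N \<inter> shift_diff n (u k) E) + z) \<longlonglongrightarrow> 0 + z"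
      using stable_all[OF E(1)] by (intro tendsto_add tendsto_const) (auto simp: stable_def)
    then have "\<forall>\<^sub>F k in sequentially. emeasure (leb n) (window n N \<inter> shift_diff n (u k) E) + z < y"
      using z by (intro order_tendstoD(2)) auto
    then show "\<forall>\<^sub>F k in sequentially. emeasure (leb n) (F \<inter> shift_diff n (u k) E) < y"
    proof eventually_elim
      case (elim k)
      have "emeasure (leb n) (F \<inter> shift_diff n (u k) E)
          \<le> emeasure (leb n) ((window n N \<inter> shift_diff n (u k) E) \<union> (F - window n N))"
        by (intro emeasure_mono) auto
      also have "\<dots> \<le> emeasure (leb n) (window n N \<inter> shift_diff n (u k) E) + emeasure (leb n) (F - window n N)"
        by (intro emeasure_subadditive) auto
      also have "\<dots> \<le> emeasure (leb n) (window n N \<inter> shift_diff n (u k) E) + z"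
        using N by (intro add_left_mono) auto
      finally show ?case using elim by (rule order_le_less_trans)
    qed
  qed simp
  then have "(\<lambda>k. measure (leb n) (F \<inter> shift_diff n (u k) E)) \<longlonglongrightarrow> 0"
    unfolding measure_def by (intro tendsto_enn2real) auto
  then have "(\<lambda>k. ip (leb n) (\<lambda>t. indicator E (vdiff n t (u k))) (indicator F) - ip (leb n) (indicator E) (indicator F)) \<longlonglongrightarrow> 0"
    by (rule Lim_null_comparison[OF always_eventually, rotated]) (use bound in simp)
  then show ?thesis by (rule LIM_zero_cancel)
qed

text \<open>A three-epsilon argument: the functionals are Lipschitz in the L^2 norm with a constant
  independent of k. They are left abstract so that the argument applies to either slot of the inner
  product.\<close>

lemma translation_weakly_continuous_closed:
  assumes h: "sq_int (leb n) h" and f: "sq_int (leb n) f" and s: "\<And>i::nat. sq_int (leb n) (s i)"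
    and lim: "(\<lambda>i. nsq (leb n) (\<lambda>x. f x - s i x)) \<longlonglongrightarrow> 0"
    and conv: "\<And>i. (\<lambda>k. \<Phi> k (s i)) \<longlonglongrightarrow> \<Phi>' (s i)"
    and bd: "\<And>k g g'. sq_int (leb n) g \<Longrightarrow> sq_int (leb n) g' \<Longrightarrow>
        (cmod (\<Phi> k g - \<Phi> k g'))\<^sup>2 \<le> nsq (leb n) (\<lambda>x. g x - g' x) * nsq (leb n) h"
    and bd': "\<And>g g'. sq_int (leb n) g \<Longrightarrow> sq_int (leb n) g' \<Longrightarrow>
        (cmod (\<Phi>' g - \<Phi>' g'))\<^sup>2 \<le> nsq (leb n) (\<lambda>x. g x - g' x) * nsq (leb n) h"
  shows "(\<lambda>k. \<Phi> k f) \<longlonglongrightarrow> (\<Phi>' f :: complex)"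
proof (rule tendstoI)
  fix \<epsilon> :: real assume \<epsilon>: "0 < \<epsilon>"
  have "(\<lambda>i. sqrt (nsq (leb n) (\<lambda>x. f x - s i x) * nsq (leb n) h)) \<longlonglongrightarrow> sqrt (0 * nsq (leb n) h)"
    by (intro tendsto_intros lim)
  then have "\<forall>\<^sub>F i in sequentially. sqrt (nsq (leb n) (\<lambda>x. f x - s i x) * nsq (leb n) h) < \<epsilon> / 3"
    using \<epsilon> by (intro order_tendstoD(2)) auto
  then obtain i where i: "sqrt (nsq (leb n) (\<lambda>x. f x - s i x) * nsq (leb n) h) < \<epsilon> / 3"
    by (auto simp: eventually_sequentially)
  have a: "cmod (\<Phi> k f - \<Phi> k (s i)) < \<epsilon> / 3" for k
    using real_le_rsqrt[OF bd[OF f s[of i], of k]] i by linarith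
  have b: "cmod (\<Phi>' f - \<Phi>' (s i)) < \<epsilon> / 3"
    using real_le_rsqrt[OF bd'[OF f s[of i]]] i by linarith
  have "\<forall>\<^sub>F k in sequentially. dist (\<Phi> k (s i)) (\<Phi>' (s i)) < \<epsilon> / 3"
    using \<epsilon> by (intro tendstoD[OF conv]) auto
  then show "\<forall>\<^sub>F k in sequentially. dist (\<Phi> k f) (\<Phi>' f) < \<epsilon>"
  proof eventually_elim
    case (elim k)
    have "\<Phi> k f - \<Phi>' f = (\<Phi> k f - \<Phi> k (s i)) + (\<Phi> k (s i) - \<Phi>' (s i)) - (\<Phi>' f - \<Phi>' (s i))" by simp
    then have "cmod (\<Phi> k f - \<Phi>' f) \<le> cmod (\<Phi> k f - \<Phi> k (s i)) + cmod (\<Phi> k (s i) - \<Phi>' (s i)) + cmod (\<Phi>' f - \<Phi>' (s i))"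
      by (metis add.assoc add_mono_thms_linordered_semiring(3) norm_triangle_ineq norm_triangle_ineq4 order_trans)
    then show ?case using a[of k] b elim unfolding dist_norm by linarith
  qed
qed

text \<open>Indicators are handled first in both slots; L^2 induction then extends f for a fixed
  indicator h, and afterwards h for a general f. Weak continuity suffices, as only autocorrelations
  are evaluated.\<close>

theorem translation_weakly_continuous:
  assumes f: "sq_int (leb n) f" and h: "sq_int (leb n) h"
  shows "(\<lambda>k. ip (leb n) (\<lambda>t. f (vdiff n t (u k))) h) \<longlonglongrightarrow> ip (leb n) f h"
proof -
  have step: "(\<lambda>k. ip (leb n) (\<lambda>t. f (vdiff n t (u k))) (indicator F)) \<longlonglongrightarrow> ip (leb n) f (indicator F)"
    if F: "F \<in> sets (leb n)" "emeasure (leb n) F < \<infinity>" for F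
    using f
  proof (induction rule: sq_int_induct)
    case (indicator A)
    then show ?case using F by (intro indicator_translation_continuous)
  next
    case (cmult c f)
    then show ?case unfolding ip_cmult_left by (intro tendsto_intros)
  next
    case (add f g)
    then show ?case using sq_int_indicator[OF F] by (simp add: ip_add_left sq_int_vdiff tendsto_add)
  next
    case (lim f s)
    note sqF = sq_int_indicator[OF F]
    show ?case
    proof (rule translation_weakly_continuous_closed[where \<Phi> = "\<lambda>k f. ip (leb n) (\<lambda>t. f (vdiff n t (u k))) (indicator F)"
          and \<Phi>' = "\<lambda>f. ip (leb n) f (indicator F)" and h = "indicator F" and s = s])
      fix k g g' assume g: "sq_int (leb n) g" "sq_int (leb n) g'"
      have eq: "ip (leb n) (\<lambda>t. g (vdiff n t (u k))) (indicator F) - ip (leb n) (\<lambda>t. g' (vdiff n t (u k))) (indicator F)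
        = ip (leb n) (\<lambda>t. g (vdiff n t (u k)) - g' (vdiff n t (u k))) (indicator F)"
        using g sqF by (simp add: ip_diff_left sq_int_vdiff)
      have eq2: "nsq (leb n) (\<lambda>t. g (vdiff n t (u k)) - g' (vdiff n t (u k))) = nsq (leb n) (\<lambda>x. g x - g' x)"
        by (rule sq_int_vdiff(2)[OF sq_int_diff[OF g]])
      show "(cmod (ip (leb n) (\<lambda>t. g (vdiff n t (u k))) (indicator F) - ip (leb n) (\<lambda>t. g' (vdiff n t (u k))) (indicator F)))\<^sup>2
          \<le> nsq (leb n) (\<lambda>x. g x - g' x) * nsq (leb n) (indicator F)"
        using Cauchy_Schwarz_ip[OF sq_int_vdiff(1)[OF sq_int_diff[OF g], of "u k"] sqF] unfolding eq eq2 .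
    next
      fix g g' assume g: "sq_int (leb n) g" "sq_int (leb n) g'"
      show "(cmod (ip (leb n) g (indicator F) - ip (leb n) g' (indicator F)))\<^sup>2
          \<le> nsq (leb n) (\<lambda>x. g x - g' x) * nsq (leb n) (indicator F)"
        using Cauchy_Schwarz_ip[OF sq_int_diff[OF g] sqF] ip_diff_left[OF g sqF] by simp
    qed (use lim sqF in auto)
  qed
  show ?thesis
    using h
  proof (induction rule: sq_int_induct)
    case (indicator A)
    then show ?case by (rule step)
  next
    case (cmult c h)
    then have "(\<lambda>k. cnj (c * ip (leb n) h (\<lambda>t. f (vdiff n t (u k))))) \<longlonglongrightarrow> cnj (c * ip (leb n) h f)"
      unfolding complex_cnj_mult cnj_ip by (intro tendsto_intros)
    then show ?case unfolding ip_cmult_left[symmetric] cnj_ip .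
  next
    case (add h h')
    then have "(\<lambda>k. cnj (ip (leb n) h (\<lambda>t. f (vdiff n t (u k))) + ip (leb n) h' (\<lambda>t. f (vdiff n t (u k)))))
        \<longlonglongrightarrow> cnj (ip (leb n) h f + ip (leb n) h' f)"
      unfolding complex_cnj_add cnj_ip by (intro tendsto_intros)
    then show ?case using add(1,2) f by (simp add: ip_add_left[symmetric] sq_int_vdiff cnj_ip del: complex_cnj_add)
  next
    case (lim h s)
    show ?case
    proof (rule translation_weakly_continuous_closed[where \<Phi> = "\<lambda>k h. ip (leb n) (\<lambda>t. f (vdiff n t (u k))) h"
          and \<Phi>' = "\<lambda>h. ip (leb n) f h" and h = f and s = s])
      fix k g g' assume g: "sq_int (leb n) g" "sq_int (leb n) g'"
      show "(cmod (ip (leb n) (\<lambda>t. f (vdiff n t (u k))) g - ip (leb n) (\<lambda>t. f (vdiff n t (u k))) g'))\<^sup>2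
          \<le> nsq (leb n) (\<lambda>x. g x - g' x) * nsq (leb n) f"
        using Cauchy_Schwarz_ip[OF sq_int_vdiff(1)[OF f, of "u k"] sq_int_diff[OF g]]
          ip_diff_right[OF g sq_int_vdiff(1)[OF f, of "u k"]] by (simp add: sq_int_vdiff(2)[OF f] mult.commute)
    next
      fix g g' assume g: "sq_int (leb n) g" "sq_int (leb n) g'"
      show "(cmod (ip (leb n) f g - ip (leb n) f g'))\<^sup>2 \<le> nsq (leb n) (\<lambda>x. g x - g' x) * nsq (leb n) f"
        using Cauchy_Schwarz_ip[OF f sq_int_diff[OF g]] ip_diff_right[OF g f] by (simp add: mult.commute)
    qed (use lim f in auto)
  qed
qed

end

section \<open>Gaussian regularization of the Fourier transform\<close>

definition gauss_weight :: "nat \<Rightarrow> real \<Rightarrow> (nat \<Rightarrow> real) \<Rightarrow> real" where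
  "gauss_weight d \<epsilon> \<xi> = (\<Prod>i<d. exp (- ((\<epsilon> * \<xi> i)\<^sup>2) / 2))"

definition gauss_kernel :: "nat \<Rightarrow> real \<Rightarrow> (nat \<Rightarrow> real) \<Rightarrow> real" where
  "gauss_kernel d \<sigma> u = (\<Prod>i<d. normal_density 0 \<sigma> (u i))"

lemma std_normal_fourier:
  "integrable lborel (\<lambda>x. complex_of_real (std_normal_density x) * cis (t * x))"
  "(LINT x|lborel. complex_of_real (std_normal_density x) * cis (t * x)) = of_real (exp (- t\<^sup>2 / 2))"
proof -
  show "integrable lborel (\<lambda>x. complex_of_real (std_normal_density x) * cis (t * x))"
  proof (rule Bochner_Integration.integrable_bound)
    show "integrable lborel std_normal_density" by (rule integrable_normal_density) simp
    show "(\<lambda>x. complex_of_real (std_normal_density x) * cis (t * x)) \<in> borel_measurable lborel"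
      unfolding cis_conv_exp by measurable
  qed (simp add: norm_mult)
  have "complex_of_real (exp (- t\<^sup>2 / 2)) = char std_normal_distribution t"
    by (simp add: char_std_normal_distribution)
  also have "\<dots> = (LINT x|lborel. std_normal_density x *\<^sub>R iexp (t * x))"
    unfolding char_def by (subst integral_density) auto
  finally show "(LINT x|lborel. complex_of_real (std_normal_density x) * cis (t * x)) = of_real (exp (- t\<^sup>2 / 2))"
    by (simp add: cis_conv_exp scaleR_conv_of_real)
qed

text \<open>Read off from the characteristic function of the standard normal law after the
  substitution x -> \<open>\<epsilon>\<close> x. With 2 pi in the exponent, a weight of scale
  1/\<open>\<epsilon>\<close> corresponds to a normal density of deviation \<open>\<epsilon>\<close>
  / (2 pi).\<close>

lemma gauss_fourier_1d:
  assumes \<epsilon>: "0 < \<epsilon>"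
  shows "integrable lborel (\<lambda>x. complex_of_real (exp (- ((\<epsilon> * x)\<^sup>2) / 2)) * cis (- (2 * pi * x * \<tau>)))"
    and "(LINT x|lborel. complex_of_real (exp (- ((\<epsilon> * x)\<^sup>2) / 2)) * cis (- (2 * pi * x * \<tau>)))
      = of_real (normal_density 0 (\<epsilon> / (2 * pi)) \<tau>)"
proof -
  \<comment> \<open>The frequency for which \<open>?t\<close> times \<open>\<epsilon>\<close> x
    equals -2 pi x \<open>\<tau>\<close>.\<close>
  let ?t = "- 2 * pi * \<tau> / \<epsilon>"
  let ?f = "\<lambda>x. complex_of_real (std_normal_density x) * cis (?t * x)"
  have eq: "?f (0 + \<epsilon> * x) = of_real (1 / sqrt (2 * pi)) * (complex_of_real (exp (- ((\<epsilon> * x)\<^sup>2) / 2)) * cis (- (2 * pi * x * \<tau>)))" for x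
    using \<epsilon> by (simp add: std_normal_density_def mult_ac)
  have s0: "complex_of_real (1 / sqrt (2 * pi)) \<noteq> 0" by simp
  have "integrable lborel (\<lambda>x. ?f (0 + \<epsilon> * x))"
    using \<epsilon> by (intro lborel_integrable_real_affine std_normal_fourier(1)) simp
  then have "integrable lborel (\<lambda>x. complex_of_real (sqrt (2 * pi)) * ?f (0 + \<epsilon> * x))"
    by (rule integrable_mult_right)
  then show "integrable lborel (\<lambda>x. complex_of_real (exp (- ((\<epsilon> * x)\<^sup>2) / 2)) * cis (- (2 * pi * x * \<tau>)))"
  proof -
    have "complex_of_real (sqrt (2 * pi)) * ?f (0 + \<epsilon> * x)
        = complex_of_real (exp (- ((\<epsilon> * x)\<^sup>2) / 2)) * cis (- (2 * pi * x * \<tau>))" for x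
      unfolding eq by simp
    then show "integrable lborel (\<lambda>x. complex_of_real (sqrt (2 * pi)) * ?f (0 + \<epsilon> * x)) \<Longrightarrow> ?thesis"
      by (simp only:)
  qed
  have "(LINT x|lborel. ?f x) = \<bar>\<epsilon>\<bar> *\<^sub>R (LINT x|lborel. ?f (0 + \<epsilon> * x))"
    using \<epsilon> by (intro lborel_integral_real_affine) simp
  then have "complex_of_real (exp (- ?t\<^sup>2 / 2)) = \<epsilon> * (of_real (1 / sqrt (2 * pi)) *
      (LINT x|lborel. complex_of_real (exp (- ((\<epsilon> * x)\<^sup>2) / 2)) * cis (- (2 * pi * x * \<tau>))))"
    unfolding eq std_normal_fourier(2) integral_mult_right_zero scaleR_conv_of_real abs_of_pos[OF \<epsilon>] .
  then have "(LINT x|lborel. complex_of_real (exp (- ((\<epsilon> * x)\<^sup>2) / 2)) * cis (- (2 * pi * x * \<tau>)))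
      = of_real (sqrt (2 * pi) / \<epsilon> * exp (- ?t\<^sup>2 / 2))"
    using \<epsilon> s0 by (simp add: field_simps)
  also have "sqrt (2 * pi) / \<epsilon> * exp (- ?t\<^sup>2 / 2) = normal_density 0 (\<epsilon> / (2 * pi)) \<tau>"
  proof -
    have "sqrt (2 * pi * (\<epsilon> / (2 * pi))\<^sup>2) = sqrt (\<epsilon>\<^sup>2 / (2 * pi))" by (simp add: power2_eq_square)
    also have "\<dots> = \<epsilon> / sqrt (2 * pi)" using \<epsilon> by (simp add: real_sqrt_divide)
    finally have 1: "sqrt (2 * pi * (\<epsilon> / (2 * pi))\<^sup>2) = \<epsilon> / sqrt (2 * pi)" .
    have 2: "- (\<tau> - 0)\<^sup>2 / (2 * (\<epsilon> / (2 * pi))\<^sup>2) = - ?t\<^sup>2 / 2"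
      using \<epsilon> by (simp add: field_simps power2_eq_square)
    show ?thesis unfolding normal_density_def 1 2 by simp
  qed
  finally show "(LINT x|lborel. complex_of_real (exp (- ((\<epsilon> * x)\<^sup>2) / 2)) * cis (- (2 * pi * x * \<tau>)))
      = of_real (normal_density 0 (\<epsilon> / (2 * pi)) \<tau>)" .
qed

lemma cis_neg_sum: "cis (- (c * (\<Sum>i\<in>A. f i))) = (\<Prod>i\<in>A. cis (- (c * f i)))"
proof (induction A rule: infinite_finite_induct)
  case (insert x F)
  have "cis (- (c * sum f (insert x F))) = cis (- (c * f x)) * cis (- (c * sum f F))"
    using insert(1,2) by (simp add: cis_mult distrib_left)
  then show ?case using insert by simp
qed simp_all

lemma gauss_fourier:
  assumes \<epsilon>: "0 < \<epsilon>"
  shows "(LINT \<xi>|leb d. complex_of_real (gauss_weight d \<epsilon> \<xi>) * cis (- (2 * pi * dotp d \<xi> \<tau>)))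
      = of_real (gauss_kernel d (\<epsilon> / (2 * pi)) \<tau>)"
proof -
  let ?f = "\<lambda>i x. complex_of_real (exp (- ((\<epsilon> * x)\<^sup>2) / 2)) * cis (- (2 * pi * x * \<tau> i))"
  have "complex_of_real (gauss_weight d \<epsilon> \<xi>) * cis (- (2 * pi * dotp d \<xi> \<tau>)) = (\<Prod>i<d. ?f i (\<xi> i))" for \<xi>
    unfolding gauss_weight_def dotp_def cis_neg_sum of_real_prod by (simp add: prod.distrib mult.assoc)
  then have "(LINT \<xi>|leb d. complex_of_real (gauss_weight d \<epsilon> \<xi>) * cis (- (2 * pi * dotp d \<xi> \<tau>)))
      = (\<Prod>i<d. LINT x|lborel. ?f i x)"
    unfolding leb_def using gauss_fourier_1d(1)[OF \<epsilon>]
    by (simp only:, intro lb.product_integral_prod) auto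
  then show ?thesis unfolding gauss_fourier_1d(2)[OF \<epsilon>] by (simp add: gauss_kernel_def)
qed

lemma gauss_weight_measurable[measurable]: "gauss_weight d \<epsilon> \<in> borel_measurable (leb d)"
  unfolding gauss_weight_def
proof (rule borel_measurable_prod)
  fix i assume "i \<in> {..<d}"
  then have [measurable]: "(\<lambda>\<xi>. \<xi> i) \<in> borel_measurable (leb d)" by (simp add: measurable_leb_component)
  show "(\<lambda>\<xi>. exp (- ((\<epsilon> * \<xi> i)\<^sup>2) / 2)) \<in> borel_measurable (leb d)" by measurable
qed

lemma gauss_kernel_measurable[measurable]: "gauss_kernel d \<sigma> \<in> borel_measurable (leb d)"
  unfolding gauss_kernel_def
proof (rule borel_measurable_prod)
  fix i assume "i \<in> {..<d}"
  then have [measurable]: "(\<lambda>\<xi>. \<xi> i) \<in> borel_measurable (leb d)" by (simp add: measurable_leb_component)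
  show "(\<lambda>\<xi>. normal_density 0 \<sigma> (\<xi> i)) \<in> borel_measurable (leb d)" by measurable
qed

lemma gauss_weight_bounds: "0 \<le> gauss_weight d \<epsilon> \<xi>" "gauss_weight d \<epsilon> \<xi> \<le> 1"
  unfolding gauss_weight_def by (auto intro!: prod_nonneg prod_le_1)

lemma gauss_weight_integrable: "0 < \<epsilon> \<Longrightarrow> integrable (leb d) (gauss_weight d \<epsilon>)"
proof -
  assume \<epsilon>: "0 < \<epsilon>"
  have "integrable lborel (\<lambda>x. exp (- ((\<epsilon> * x)\<^sup>2) / 2))"
    using integrable_norm[OF gauss_fourier_1d(1)[OF \<epsilon>, of 0]] by (simp add: norm_mult)
  then show ?thesis
    unfolding gauss_weight_def[abs_def] leb_def by (intro lb.product_integrable_prod) auto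
qed

lemma gauss_weight_tendsto: "(\<lambda>k. gauss_weight d (1 / real (Suc k)) \<xi>) \<longlonglongrightarrow> 1"
proof -
  have "(\<lambda>k. gauss_weight d (1 / real (Suc k)) \<xi>) \<longlonglongrightarrow> (\<Prod>i<d. exp (- ((0 * \<xi> i)\<^sup>2) / 2))"
    unfolding gauss_weight_def using LIMSEQ_inverse_real_of_nat
    by (intro tendsto_intros) (auto simp: inverse_eq_divide)
  then show ?thesis by simp
qed

lemma gauss_kernel_nonneg: "0 \<le> gauss_kernel d \<sigma> u"
  unfolding gauss_kernel_def by (intro prod_nonneg) auto

lemma gauss_kernel_integrable: "0 < \<sigma> \<Longrightarrow> integrable (leb d) (gauss_kernel d \<sigma>)"
  unfolding gauss_kernel_def[abs_def] leb_def by (intro lb.product_integrable_prod) auto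

lemma gauss_kernel_integral: "0 < \<sigma> \<Longrightarrow> (LINT u|leb d. gauss_kernel d \<sigma> u) = 1"
  unfolding gauss_kernel_def leb_def by (subst lb.product_integral_prod) auto

lemma gauss_kernel_nn_integral: "0 < \<sigma> \<Longrightarrow> (\<integral>\<^sup>+u. ennreal (gauss_kernel d \<sigma> u) \<partial>leb d) = 1"
  using gauss_kernel_integrable gauss_kernel_nonneg gauss_kernel_integral
  by (subst nn_integral_eq_integral) auto

lemma gauss_kernel_bounded: "\<exists>C. \<forall>u. gauss_kernel d \<sigma> u \<le> C"
proof -
  have "normal_density 0 \<sigma> x \<le> 1 / sqrt (2 * pi * \<sigma>\<^sup>2)" for x
    unfolding normal_density_def by (auto intro!: divide_right_mono)
  then have "gauss_kernel d \<sigma> u \<le> (\<Prod>i<d. 1 / sqrt (2 * pi * \<sigma>\<^sup>2))" for u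
    unfolding gauss_kernel_def by (intro prod_mono) auto
  then show ?thesis by blast
qed

lemma leb_scale:
  assumes c: "0 < c"
  shows "density (distr (leb d) (leb d) (\<lambda>t. \<lambda>i\<in>{..<d}. c * t i)) (\<lambda>_. ennreal (c ^ d)) = leb d"
proof (rule leb_eqI)
  fix A :: "nat \<Rightarrow> real set" assume A: "\<And>i. i < d \<Longrightarrow> A i \<in> sets borel"
  have eq: "(\<lambda>t. \<lambda>i\<in>{..<d}. c * t i) -` Pi\<^sub>E {..<d} A \<inter> space (leb d)
      = Pi\<^sub>E {..<d} (\<lambda>i. (\<lambda>t. c * t) -` A i)"
    by (auto simp: space_leb PiE_iff)
  have m: "(\<lambda>t. c * t) -` A i \<in> sets borel" if "i < d" for i
  proof -
    have "(\<lambda>t. c * t) -` A i \<inter> space borel \<in> sets borel"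
      by (rule measurable_sets[OF _ A[OF that]]) measurable
    then show ?thesis by simp
  qed
  have one: "ennreal c * emeasure lborel ((\<lambda>t. c * t) -` A i) = emeasure lborel (A i)" if "i < d" for i
  proof -
    have "emeasure lborel (A i) = emeasure (density (distr lborel borel (\<lambda>t. 0 + c * t)) (\<lambda>_. ennreal \<bar>c\<bar>)) (A i)"
      using c by (subst lborel_real_affine[of c 0]) auto
    also have "\<dots> = ennreal c * emeasure lborel ((\<lambda>t. c * t) -` A i)"
      using c A[OF that] by (simp add: emeasure_density_const emeasure_distr)
    finally show ?thesis by simp
  qed
  have ms: "(\<lambda>t. \<lambda>i\<in>{..<d}. c * t i) \<in> measurable (leb d) (leb d)"
    using measurable_affine[where n = d and a = "\<lambda>_. 0" and c = c] by simp
  have "emeasure (density (distr (leb d) (leb d) (\<lambda>t. \<lambda>i\<in>{..<d}. c * t i)) (\<lambda>_. ennreal (c ^ d))) (Pi\<^sub>E {..<d} A)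
      = ennreal (c ^ d) * (\<Prod>i<d. emeasure lborel ((\<lambda>t. c * t) -` A i))"
    using A m by (subst emeasure_density_const) (auto simp: PiE_sets_leb emeasure_distr[OF ms] eq emeasure_leb_PiE)
  also have "\<dots> = (\<Prod>i<d. ennreal c * emeasure lborel ((\<lambda>t. c * t) -` A i))"
    using c by (simp add: prod.distrib ennreal_power)
  also have "\<dots> = (\<Prod>i<d. emeasure lborel (A i))" by (rule prod.cong) (auto simp: one)
  finally show "emeasure (density (distr (leb d) (leb d) (\<lambda>t. \<lambda>i\<in>{..<d}. c * t i)) (\<lambda>_. ennreal (c ^ d))) (Pi\<^sub>E {..<d} A)
      = (\<Prod>i<d. emeasure lborel (A i))" .
qed simp

text \<open>Moves the shrinking width of the kernel into the argument of \<open>\<phi>\<close>,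
  leaving one fixed integrable weight; this is the form in which dominated convergence applies as
  the width tends to 0.\<close>

lemma gauss_kernel_scale:
  assumes c: "0 < c" and [measurable]: "\<phi> \<in> borel_measurable (leb d)"
  shows "(LINT u|leb d. gauss_kernel d (c * \<sigma>) u * \<phi> u) = (LINT v|leb d. gauss_kernel d \<sigma> v * \<phi> (\<lambda>i\<in>{..<d}. c * v i))"
proof -
  have ms[measurable]: "(\<lambda>t. \<lambda>i\<in>{..<d}. c * t i) \<in> measurable (leb d) (leb d)"
    using measurable_affine[where n = d and a = "\<lambda>_. 0" and c = c] by simp
  have nd: "c * normal_density 0 (c * \<sigma>) (c * x) = normal_density 0 \<sigma> x" for x
  proof -
    have "sqrt (2 * pi * (c * \<sigma>)\<^sup>2) = c * sqrt (2 * pi * \<sigma>\<^sup>2)"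
      using c by (simp add: power_mult_distrib real_sqrt_mult)
    then show ?thesis using c unfolding normal_density_def by (simp add: power_mult_distrib)
  qed
  have gk: "c ^ d * gauss_kernel d (c * \<sigma>) (\<lambda>i\<in>{..<d}. c * v i) = gauss_kernel d \<sigma> v" for v
  proof -
    have "c ^ d * gauss_kernel d (c * \<sigma>) (\<lambda>i\<in>{..<d}. c * v i) = (\<Prod>i<d. c * normal_density 0 (c * \<sigma>) (c * v i))"
      by (simp add: gauss_kernel_def prod.distrib)
    then show ?thesis by (simp add: nd gauss_kernel_def)
  qed
  have "(LINT u|leb d. gauss_kernel d (c * \<sigma>) u * \<phi> u)
      = (LINT u|density (distr (leb d) (leb d) (\<lambda>t. \<lambda>i\<in>{..<d}. c * t i)) (\<lambda>_. ennreal (c ^ d)). gauss_kernel d (c * \<sigma>) u * \<phi> u)"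
    by (simp only: leb_scale[OF c])
  also have "\<dots> = (LINT v|leb d. c ^ d * (gauss_kernel d (c * \<sigma>) (\<lambda>i\<in>{..<d}. c * v i) * \<phi> (\<lambda>i\<in>{..<d}. c * v i)))"
    using c by (subst integral_density) (auto simp: integral_distr)
  finally show ?thesis by (simp only: mult.assoc[symmetric] gk)
qed

lemma nn_integral_product:
  assumes [measurable]: "f \<in> borel_measurable (leb d)" "g \<in> borel_measurable (leb d)"
  shows "(\<integral>\<^sup>+x. \<integral>\<^sup>+y. f x * g y \<partial>leb d \<partial>leb d) = integral\<^sup>N (leb d) f * integral\<^sup>N (leb d) g"
  by (simp add: nn_integral_cmult nn_integral_multc)

lemma integrable_pair_dominated:
  fixes h :: "(nat \<Rightarrow> real) \<Rightarrow> (nat \<Rightarrow> real) \<Rightarrow> complex"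
  assumes h[measurable]: "case_prod h \<in> borel_measurable (leb d \<Otimes>\<^sub>M leb d)"
    and f: "integrable (leb d) f" and g: "integrable (leb d) g"
    and le: "\<And>x y. x \<in> space (leb d) \<Longrightarrow> y \<in> space (leb d) \<Longrightarrow> cmod (h x y) \<le> f x * (g y :: real)"
  shows "integrable (leb d \<Otimes>\<^sub>M leb d) (case_prod h)"
proof (rule integrableI_bounded)
  note [measurable] = borel_measurable_integrable[OF f] borel_measurable_integrable[OF g]
  have "(\<integral>\<^sup>+p. ennreal (norm (case_prod h p)) \<partial>(leb d \<Otimes>\<^sub>M leb d)) = (\<integral>\<^sup>+x. \<integral>\<^sup>+y. ennreal (norm (h x y)) \<partial>leb d \<partial>leb d)"
    by (subst leb.nn_integral_fst[symmetric]) auto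
  also have "\<dots> \<le> (\<integral>\<^sup>+x. \<integral>\<^sup>+y. ennreal (norm (f x)) * ennreal (norm (g y)) \<partial>leb d \<partial>leb d)"
  proof (intro nn_integral_mono)
    fix x y assume "x \<in> space (leb d)" "y \<in> space (leb d)"
    from le[OF this] have "cmod (h x y) \<le> norm (f x) * norm (g y)"
      by (metis abs_mult abs_ge_self order_trans real_norm_def)
    then show "ennreal (norm (h x y)) \<le> ennreal (norm (f x)) * ennreal (norm (g y))"
      by (simp add: ennreal_mult[symmetric] ennreal_leI)
  qed
  also have "\<dots> = (\<integral>\<^sup>+x. ennreal (norm (f x)) \<partial>leb d) * (\<integral>\<^sup>+y. ennreal (norm (g y)) \<partial>leb d)"
    by (rule nn_integral_product) measurable
  also have "\<dots> < \<infinity>" using f g unfolding integrable_iff_bounded by (simp add: ennreal_mult_less_top)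
  finally show "(\<integral>\<^sup>+p. ennreal (norm (case_prod h p)) \<partial>(leb d \<Otimes>\<^sub>M leb d)) < \<infinity>" .
qed measurable

section \<open>Fourier transform of integrable functions\<close>

definition ft :: "nat \<Rightarrow> ((nat \<Rightarrow> real) \<Rightarrow> complex) \<Rightarrow> (nat \<Rightarrow> real) \<Rightarrow> complex" where
  "ft d F \<xi> = (LINT t|leb d. F t * cis (- (2 * pi * dotp d \<xi> t)))"

lemma cis_measurable[measurable (raw)]: "f \<in> borel_measurable M \<Longrightarrow> (\<lambda>x. cis (f x)) \<in> borel_measurable M"
  unfolding cis_conv_exp by measurable

lemma ft_measurable[measurable]:
  assumes [measurable]: "F \<in> borel_measurable (leb d)"
  shows "ft d F \<in> borel_measurable (leb d)"
  unfolding ft_def by measurable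

lemma ft_bound: "cmod (ft d F \<xi>) \<le> (LINT t|leb d. cmod (F t))"
  unfolding ft_def by (rule order_trans[OF integral_norm_bound]) (simp add: norm_mult)

lemma dotp_vdiff: "dotp d \<xi> (vdiff d s t) = dotp d \<xi> s - dotp d \<xi> t"
  by (simp add: dotp_def vdiff_def right_diff_distrib sum_subtractf)

text \<open>An exact form of Plancherel at positive \<open>\<epsilon>\<close>. The Gaussian weight
  makes the integral over \<xi>, s and t absolutely convergent; integrating \<xi> first yields the
  Gaussian kernel at s - t, and u = s - t turns the rest into the autocorrelation of F.\<close>

lemma ft_gauss_integral:
  assumes \<epsilon>: "0 < \<epsilon>" and F: "integrable (leb d) F"
  shows "complex_of_real (LINT \<xi>|leb d. (cmod (ft d F \<xi>))\<^sup>2 * gauss_weight d \<epsilon> \<xi>)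
    = (LINT u|leb d. of_real (gauss_kernel d (\<epsilon> / (2 * pi)) u) * (LINT s|leb d. F s * cnj (F (vdiff d s u))))"
proof -
  let ?G = "\<lambda>\<xi>. complex_of_real (gauss_weight d \<epsilon> \<xi>)" and ?K = "gauss_kernel d (\<epsilon> / (2 * pi))"
  let ?e = "\<lambda>\<xi> t. cis (- (2 * pi * dotp d \<xi> t))"
  note [measurable] = borel_measurable_integrable[OF F]
  note Gi = gauss_weight_integrable[OF \<epsilon>, of d]
  have Fn: "integrable (leb d) (\<lambda>t. cmod (F t))" using F by simp
  define m where "m = (LINT t|leb d. cmod (F t))"
  have "complex_of_real (LINT \<xi>|leb d. (cmod (ft d F \<xi>))\<^sup>2 * gauss_weight d \<epsilon> \<xi>)
      = (LINT \<xi>|leb d. ft d F \<xi> * (cnj (ft d F \<xi>) * ?G \<xi>))"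
    unfolding integral_complex_of_real[symmetric] of_real_mult complex_norm_square mult.assoc ..
  also have "\<dots> = (LINT \<xi>|leb d. LINT s|leb d. F s * ?e \<xi> s * (cnj (ft d F \<xi>) * ?G \<xi>))"
    by (simp add: ft_def)
  also have "\<dots> = (LINT s|leb d. LINT \<xi>|leb d. F s * ?e \<xi> s * (cnj (ft d F \<xi>) * ?G \<xi>))"
  proof (rule leb2.Fubini_integral)
    show "integrable (leb d \<Otimes>\<^sub>M leb d) (\<lambda>(s, \<xi>). F s * ?e \<xi> s * (cnj (ft d F \<xi>) * ?G \<xi>))"
    proof (rule integrable_pair_dominated[OF _ Fn])
      show "integrable (leb d) (\<lambda>\<xi>. m * gauss_weight d \<epsilon> \<xi>)" using Gi by simp
      show "cmod (F x * ?e y x * (cnj (ft d F y) * ?G y)) \<le> cmod (F x) * (m * gauss_weight d \<epsilon> y)" for x y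
        using ft_bound[of d F y] gauss_weight_bounds[of d \<epsilon> y]
        by (auto simp: norm_mult m_def intro!: mult_left_mono mult_right_mono)
    qed measurable
  qed
  also have "\<dots> = (LINT s|leb d. F s * (LINT u|leb d. cnj (F (vdiff d s u)) * of_real (?K u)))"
  proof (intro Bochner_Integration.integral_cong refl)
    fix s assume s[measurable]: "s \<in> space (leb d)"
    have cft: "cnj (ft d F \<xi>) = (LINT t|leb d. cnj (F t) * cnj (?e \<xi> t))" for \<xi>
      unfolding ft_def by (simp flip: Bochner_Integration.integral_cnj)
    have "(LINT \<xi>|leb d. F s * ?e \<xi> s * (cnj (ft d F \<xi>) * ?G \<xi>))
        = F s * (LINT \<xi>|leb d. LINT t|leb d. cnj (F t) * (?G \<xi> * ?e \<xi> (vdiff d s t)))"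
    proof -
      have "F s * ?e \<xi> s * (cnj (ft d F \<xi>) * ?G \<xi>) = F s * (LINT t|leb d. cnj (F t) * (?G \<xi> * ?e \<xi> (vdiff d s t)))" for \<xi>
      proof -
        have "?e \<xi> (vdiff d s t) = ?e \<xi> s * cnj (?e \<xi> t)" for t
          by (simp add: dotp_vdiff cis_mult cis_cnj algebra_simps)
        then have "(LINT t|leb d. cnj (F t) * (?G \<xi> * ?e \<xi> (vdiff d s t)))
            = (LINT t|leb d. (?G \<xi> * ?e \<xi> s) * (cnj (F t) * cnj (?e \<xi> t)))"
          by (simp add: mult_ac)
        also have "\<dots> = (?G \<xi> * ?e \<xi> s) * cnj (ft d F \<xi>)" unfolding cft by (rule integral_mult_right_zero)
        finally show ?thesis by (simp add: mult_ac)
      qed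
      then show ?thesis by (simp only: integral_mult_right_zero)
    qed
    also have "(LINT \<xi>|leb d. LINT t|leb d. cnj (F t) * (?G \<xi> * ?e \<xi> (vdiff d s t)))
        = (LINT t|leb d. LINT \<xi>|leb d. cnj (F t) * (?G \<xi> * ?e \<xi> (vdiff d s t)))"
    proof (rule leb2.Fubini_integral)
      show "integrable (leb d \<Otimes>\<^sub>M leb d) (\<lambda>(t, \<xi>). cnj (F t) * (?G \<xi> * ?e \<xi> (vdiff d s t)))"
      proof (rule integrable_pair_dominated[OF _ Fn Gi])
        show "cmod (cnj (F x) * (?G y * ?e y (vdiff d s x))) \<le> cmod (F x) * gauss_weight d \<epsilon> y" for x y
          using gauss_weight_bounds[of d \<epsilon> y] by (simp add: norm_mult)
      qed measurable
    qed
    also have "\<dots> = (LINT t|leb d. cnj (F t) * of_real (?K (vdiff d s t)))"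
      by (simp add: gauss_fourier[OF \<epsilon>])
    also have "\<dots> = (LINT t|leb d. (\<lambda>u. cnj (F (vdiff d s u)) * of_real (?K u)) (vdiff d s t))"
    proof (intro Bochner_Integration.integral_cong refl)
      fix t assume "t \<in> space (leb d)"
      then have "vdiff d s (vdiff d s t) = t"
        by (auto simp: vdiff_def space_leb PiE_iff extensional_def fun_eq_iff)
      then show "cnj (F t) * of_real (?K (vdiff d s t)) = (\<lambda>u. cnj (F (vdiff d s u)) * of_real (?K u)) (vdiff d s t)"
        by simp
    qed
    also have "\<dots> = (LINT u|leb d. cnj (F (vdiff d s u)) * of_real (?K u))"
      by (rule integral_vdiff(2)) measurable
    finally show "(LINT \<xi>|leb d. F s * ?e \<xi> s * (cnj (ft d F \<xi>) * ?G \<xi>))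
        = F s * (LINT u|leb d. cnj (F (vdiff d s u)) * of_real (?K u))" .
  qed
  also have "\<dots> = (LINT s|leb d. LINT u|leb d. F s * (cnj (F (vdiff d s u)) * of_real (?K u)))"
    by simp
  also have "\<dots> = (LINT u|leb d. LINT s|leb d. F s * (cnj (F (vdiff d s u)) * of_real (?K u)))"
  proof (rule leb2.Fubini_integral[symmetric])
    obtain C where C: "\<And>u. ?K u \<le> C" using gauss_kernel_bounded by blast
    show "integrable (leb d \<Otimes>\<^sub>M leb d) (\<lambda>(s, u). F s * (cnj (F (vdiff d s u)) * of_real (?K u)))"
    proof (rule integrableI_bounded)
      have "(\<integral>\<^sup>+p. ennreal (norm (case_prod (\<lambda>s u. F s * (cnj (F (vdiff d s u)) * complex_of_real (?K u))) p)) \<partial>(leb d \<Otimes>\<^sub>M leb d))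
          = (\<integral>\<^sup>+s. \<integral>\<^sup>+u. ennreal (norm (F s * (cnj (F (vdiff d s u)) * complex_of_real (?K u)))) \<partial>leb d \<partial>leb d)"
        by (subst leb.nn_integral_fst[symmetric]) auto
      also have "\<dots> \<le> (\<integral>\<^sup>+s. \<integral>\<^sup>+u. ennreal (C * cmod (F s)) * ennreal (cmod (F (vdiff d s u))) \<partial>leb d \<partial>leb d)"
      proof (intro nn_integral_mono)
        fix s u
        have C0: "0 \<le> C" using C[of u] gauss_kernel_nonneg[of d "\<epsilon> / (2 * pi)" u] by linarith
        have "norm (F s * (cnj (F (vdiff d s u)) * complex_of_real (?K u))) = ?K u * (cmod (F s) * cmod (F (vdiff d s u)))"
          using gauss_kernel_nonneg by (simp add: norm_mult mult_ac)
        also have "\<dots> \<le> C * (cmod (F s) * cmod (F (vdiff d s u)))" using C by (intro mult_right_mono) auto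
        finally show "ennreal (norm (F s * (cnj (F (vdiff d s u)) * complex_of_real (?K u)))) \<le> ennreal (C * cmod (F s)) * ennreal (cmod (F (vdiff d s u)))"
          using C0 by (simp add: ennreal_mult[symmetric] mult.assoc ennreal_leI)
      qed
      also have "\<dots> = (\<integral>\<^sup>+s. ennreal (C * cmod (F s)) * (\<integral>\<^sup>+u. ennreal (cmod (F u)) \<partial>leb d) \<partial>leb d)"
      proof (intro nn_integral_cong)
        fix s assume [measurable]: "s \<in> space (leb d)"
        have "(\<integral>\<^sup>+u. ennreal (cmod (F (vdiff d s u))) \<partial>leb d) = (\<integral>\<^sup>+u. ennreal (cmod (F u)) \<partial>leb d)"
          by (rule nn_integral_vdiff(2)) measurable
        then show "(\<integral>\<^sup>+u. ennreal (C * cmod (F s)) * ennreal (cmod (F (vdiff d s u))) \<partial>leb d)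
            = ennreal (C * cmod (F s)) * (\<integral>\<^sup>+u. ennreal (cmod (F u)) \<partial>leb d)"
          by (subst nn_integral_cmult) auto
      qed
      also have "\<dots> = (\<integral>\<^sup>+s. ennreal (C * cmod (F s)) \<partial>leb d) * (\<integral>\<^sup>+u. ennreal (cmod (F u)) \<partial>leb d)"
        by (rule nn_integral_multc) measurable
      also have "\<dots> < \<infinity>"
      proof -
        have "integrable (leb d) (\<lambda>s. C * cmod (F s))" using Fn by simp
        then have "(\<integral>\<^sup>+s. ennreal (C * cmod (F s)) \<partial>leb d) < \<infinity>"
          using integrableD(2) by (force simp: less_top)
        then show ?thesis using F unfolding integrable_iff_bounded by (simp add: ennreal_mult_less_top)
      qed
      finally show "(\<integral>\<^sup>+p. ennreal (norm (case_prod (\<lambda>s u. F s * (cnj (F (vdiff d s u)) * complex_of_real (?K u))) p)) \<partial>(leb d \<Otimes>\<^sub>M leb d)) < \<infinity>" .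
    qed measurable
  qed
  also have "\<dots> = (LINT u|leb d. of_real (?K u) * (LINT s|leb d. F s * cnj (F (vdiff d s u))))"
    by (simp add: mult_ac flip: integral_mult_right_zero)
  finally show ?thesis .
qed

section \<open>Moyal identity\<close>

lemma vdiff_in_space[simp]: "vdiff n x y \<in> space (leb n)"
  by (simp add: vdiff_def space_leb)

lemma stft_vjoin:
  assumes "x \<in> space (leb d)" "\<xi> \<in> space (leb d)"
  shows "stft d g f (vjoin d x \<xi>) = ft d (\<lambda>t. f t * cnj (g (vdiff d t x))) \<xi>"
  using assms by (simp add: stft_def ft_def)

lemma stft_measurable[measurable]:
  assumes [measurable]: "f \<in> borel_measurable (leb d)" "g \<in> borel_measurable (leb d)"
  shows "stft d g f \<in> borel_measurable (leb (2 * d))"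
  unfolding stft_def by measurable

text \<open>The autocorrelation of F is bounded by its value at 0, and the Gaussian kernel has
  integral 1, so every regularized integral is at most the squared norm of F. An F that is not
  square-integrable makes the right side infinite.\<close>

lemma Plancherel_le:
  assumes F: "integrable (leb d) F"
  shows "(\<integral>\<^sup>+\<xi>. ennreal ((cmod (ft d F \<xi>))\<^sup>2) \<partial>leb d) \<le> (\<integral>\<^sup>+t. ennreal ((cmod (F t))\<^sup>2) \<partial>leb d)"
proof (cases "integrable (leb d) (\<lambda>t. (cmod (F t))\<^sup>2)")
  case False
  have "(\<integral>\<^sup>+t. ennreal ((cmod (F t))\<^sup>2) \<partial>leb d) = \<infinity>"
  proof (rule ccontr)
    assume "(\<integral>\<^sup>+t. ennreal ((cmod (F t))\<^sup>2) \<partial>leb d) \<noteq> \<infinity>"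
    then have "integrable (leb d) (\<lambda>t. (cmod (F t))\<^sup>2)"
      using borel_measurable_integrable[OF F] by (intro integrableI_nonneg) (auto simp: less_top)
    with False show False by simp
  qed
  then show ?thesis by simp
next
  case True
  note [measurable] = borel_measurable_integrable[OF F]
  have sq: "sq_int (leb d) F" using True by (simp add: sq_int_def)
  let ?\<epsilon> = "\<lambda>k. 1 / real (Suc k)"
  have le: "(\<integral>\<^sup>+\<xi>. ennreal ((cmod (ft d F \<xi>))\<^sup>2 * gauss_weight d (?\<epsilon> k) \<xi>) \<partial>leb d) \<le> ennreal (nsq (leb d) F)" for k
  proof -
    have \<epsilon>: "0 < ?\<epsilon> k" by simp
    let ?K = "gauss_kernel d (?\<epsilon> k / (2 * pi))"
    have K: "integrable (leb d) ?K" by (rule gauss_kernel_integrable) simp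
    have "integrable (leb d) (\<lambda>\<xi>. (LINT t|leb d. cmod (F t))\<^sup>2 * gauss_weight d (?\<epsilon> k) \<xi>)"
      using gauss_weight_integrable[OF \<epsilon>] by simp
    then have "integrable (leb d) (\<lambda>\<xi>. (cmod (ft d F \<xi>))\<^sup>2 * gauss_weight d (?\<epsilon> k) \<xi>)"
    proof (rule Bochner_Integration.integrable_bound)
      show "AE \<xi> in leb d. norm ((cmod (ft d F \<xi>))\<^sup>2 * gauss_weight d (?\<epsilon> k) \<xi>)
          \<le> norm ((LINT t|leb d. cmod (F t))\<^sup>2 * gauss_weight d (?\<epsilon> k) \<xi>)"
        using ft_bound[of d F] gauss_weight_bounds(1)[of d]
        by (intro AE_I2) (auto simp: abs_mult intro!: mult_right_mono power_mono)
    qed measurable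
    then have "(\<integral>\<^sup>+\<xi>. ennreal ((cmod (ft d F \<xi>))\<^sup>2 * gauss_weight d (?\<epsilon> k) \<xi>) \<partial>leb d)
        = ennreal (LINT \<xi>|leb d. (cmod (ft d F \<xi>))\<^sup>2 * gauss_weight d (?\<epsilon> k) \<xi>)"
      using gauss_weight_bounds(1)[of d] by (intro nn_integral_eq_integral) auto
    moreover have "(LINT \<xi>|leb d. (cmod (ft d F \<xi>))\<^sup>2 * gauss_weight d (?\<epsilon> k) \<xi>) \<le> nsq (leb d) F"
    proof -
      have R: "cmod (LINT s|leb d. F s * cnj (F (vdiff d s u))) \<le> nsq (leb d) F" for u
      proof -
        have "(cmod (ip (leb d) F (\<lambda>s. F (vdiff d s u))))\<^sup>2 \<le> (nsq (leb d) F)\<^sup>2"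
          using Cauchy_Schwarz_ip[OF sq sq_int_vdiff(1)[OF sq, of u]] sq_int_vdiff(2)[OF sq, of u]
          by (simp add: power2_eq_square)
        then show ?thesis unfolding ip_def by (rule power2_le_imp_le) simp
      qed
      have "(LINT \<xi>|leb d. (cmod (ft d F \<xi>))\<^sup>2 * gauss_weight d (?\<epsilon> k) \<xi>)
          \<le> cmod (complex_of_real (LINT \<xi>|leb d. (cmod (ft d F \<xi>))\<^sup>2 * gauss_weight d (?\<epsilon> k) \<xi>))"
        by simp
      also have "\<dots> \<le> (LINT u|leb d. cmod (of_real (?K u) * (LINT s|leb d. F s * cnj (F (vdiff d s u)))))"
        unfolding ft_gauss_integral[OF \<epsilon> F] by (rule integral_norm_bound)
      also have "\<dots> \<le> (LINT u|leb d. ?K u * nsq (leb d) F)"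
      proof (rule integral_mono')
        show "integrable (leb d) (\<lambda>u. ?K u * nsq (leb d) F)" using K by simp
        show "cmod (of_real (?K u) * (LINT s|leb d. F s * cnj (F (vdiff d s u)))) \<le> ?K u * nsq (leb d) F" for u
          using R[of u] gauss_kernel_nonneg[of d _ u] by (simp add: norm_mult mult_left_mono)
      qed (simp add: gauss_kernel_nonneg)
      also have "\<dots> = nsq (leb d) F" by (simp add: gauss_kernel_integral)
      finally show ?thesis .
    qed
    ultimately show ?thesis by (simp add: ennreal_leI)
  qed
  have "(\<integral>\<^sup>+\<xi>. ennreal ((cmod (ft d F \<xi>))\<^sup>2) \<partial>leb d)
      = (\<integral>\<^sup>+\<xi>. liminf (\<lambda>k. ennreal ((cmod (ft d F \<xi>))\<^sup>2 * gauss_weight d (?\<epsilon> k) \<xi>)) \<partial>leb d)"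
  proof (intro nn_integral_cong)
    fix \<xi>
    have "(\<lambda>k. ennreal ((cmod (ft d F \<xi>))\<^sup>2 * gauss_weight d (?\<epsilon> k) \<xi>)) \<longlonglongrightarrow> ennreal ((cmod (ft d F \<xi>))\<^sup>2 * 1)"
      by (intro tendsto_ennrealI tendsto_intros gauss_weight_tendsto)
    then show "ennreal ((cmod (ft d F \<xi>))\<^sup>2) = liminf (\<lambda>k. ennreal ((cmod (ft d F \<xi>))\<^sup>2 * gauss_weight d (?\<epsilon> k) \<xi>))"
      by (simp only: mult_1_right lim_imp_Liminf[OF sequentially_bot])
  qed
  \<comment> \<open>Fatou's lemma removes the weights, which tend to 1 pointwise.\<close>
  also have "\<dots> \<le> liminf (\<lambda>k. \<integral>\<^sup>+\<xi>. ennreal ((cmod (ft d F \<xi>))\<^sup>2 * gauss_weight d (?\<epsilon> k) \<xi>) \<partial>leb d)"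
    by (rule nn_integral_liminf) measurable
  also have "\<dots> \<le> limsup (\<lambda>k. \<integral>\<^sup>+\<xi>. ennreal ((cmod (ft d F \<xi>))\<^sup>2 * gauss_weight d (?\<epsilon> k) \<xi>) \<partial>leb d)"
    by (rule Liminf_le_Limsup) simp
  also have "\<dots> \<le> ennreal (nsq (leb d) F)" using le by (intro Limsup_bounded) simp
  also have "\<dots> = (\<integral>\<^sup>+t. ennreal ((cmod (F t))\<^sup>2) \<partial>leb d)"
    unfolding nsq_def using True by (subst nn_integral_eq_integral) auto
  finally show ?thesis .
qed

lemma nn_integral_sq_int: "sq_int M f \<Longrightarrow> (\<integral>\<^sup>+t. ennreal ((cmod (f t))\<^sup>2) \<partial>M) = ennreal (nsq M f)"
  unfolding nsq_def by (subst nn_integral_eq_integral) (auto simp: sq_int_def)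

text \<open>For fixed x the transform is the Fourier transform of t -> f(t) conj g(t - x), which is
  integrable by Cauchy-Schwarz; \<open>Plancherel_le\<close> in \<xi> and Tonelli in (x, t) finish.
  General f is needed because the bound is also applied to the eigenfunctions.\<close>

lemma stft_norm_le:
  assumes f: "sq_int (leb d) f" and g: "sq_int (leb d) g"
  shows "(\<integral>\<^sup>+z. ennreal ((cmod (stft d g f z))\<^sup>2) \<partial>leb (2 * d)) \<le> ennreal (nsq (leb d) f * nsq (leb d) g)"
proof -
  note [measurable] = sq_int_measurable[OF f] sq_int_measurable[OF g]
  have "(\<integral>\<^sup>+z. ennreal ((cmod (stft d g f z))\<^sup>2) \<partial>leb (2 * d))
      = (\<integral>\<^sup>+x. \<integral>\<^sup>+\<xi>. ennreal ((cmod (stft d g f (vjoin d x \<xi>)))\<^sup>2) \<partial>leb d \<partial>leb d)"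
    by (rule nn_integral_vjoin) measurable
  also have "\<dots> = (\<integral>\<^sup>+x. \<integral>\<^sup>+\<xi>. ennreal ((cmod (ft d (\<lambda>t. f t * cnj (g (vdiff d t x))) \<xi>))\<^sup>2) \<partial>leb d \<partial>leb d)"
    by (intro nn_integral_cong) (simp add: stft_vjoin)
  also have "\<dots> \<le> (\<integral>\<^sup>+x. \<integral>\<^sup>+t. ennreal ((cmod (f t * cnj (g (vdiff d t x))))\<^sup>2) \<partial>leb d \<partial>leb d)"
    using f sq_int_vdiff(1)[OF g] by (intro nn_integral_mono Plancherel_le integrable_mult_cnj)
  also have "\<dots> = (\<integral>\<^sup>+t. \<integral>\<^sup>+x. ennreal ((cmod (f t * cnj (g (vdiff d t x))))\<^sup>2) \<partial>leb d \<partial>leb d)"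
    by (rule leb2.Fubini') measurable
  also have "\<dots> = (\<integral>\<^sup>+t. ennreal ((cmod (f t))\<^sup>2) * ennreal (nsq (leb d) g) \<partial>leb d)"
  proof (intro nn_integral_cong)
    fix t assume [measurable]: "t \<in> space (leb d)"
    have "(\<integral>\<^sup>+x. ennreal ((cmod (g (vdiff d t x)))\<^sup>2) \<partial>leb d) = ennreal (nsq (leb d) g)"
      unfolding nn_integral_sq_int[OF g, symmetric] by (rule nn_integral_vdiff(2)) measurable
    then show "(\<integral>\<^sup>+x. ennreal ((cmod (f t * cnj (g (vdiff d t x))))\<^sup>2) \<partial>leb d) = ennreal ((cmod (f t))\<^sup>2) * ennreal (nsq (leb d) g)"
      by (simp add: norm_mult power_mult_distrib ennreal_mult nn_integral_cmult)
  qed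
  also have "\<dots> = ennreal (nsq (leb d) f * nsq (leb d) g)"
    by (simp add: nn_integral_multc nn_integral_sq_int[OF f] ennreal_mult)
  finally show ?thesis .
qed

text \<open>Substituting \<open>t = s - u\<close> in the regularized Plancherel identity turns the \<open>x\<close>-integral into
  two independent autocorrelation integrals.\<close>

lemma stft_gauss_autocorrelation:
  assumes g: "sq_int (leb d) g" and \<epsilon>: "0 < \<epsilon>"
  defines "A \<equiv> \<lambda>u. ip (leb d) (\<lambda>t. g (vdiff d t u)) g"
  shows "ennreal (LINT u|leb d. gauss_kernel d (\<epsilon> / (2 * pi)) u * (cmod (A u))\<^sup>2)
    \<le> (\<integral>\<^sup>+z. ennreal ((cmod (stft d g g z))\<^sup>2) \<partial>leb (2 * d))"
proof -
  note g' = sq_int_vdiff(1)[OF g]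
  note [measurable] = sq_int_measurable[OF g]
  let ?K = "gauss_kernel d (\<epsilon> / (2 * pi))"
  have \<sigma>: "0 < \<epsilon> / (2 * pi)" using \<epsilon> by simp
  define F where "F x t = g t * cnj (g (vdiff d t x))" for x t
  have F_meas[measurable]: "case_prod F \<in> borel_measurable (leb d \<Otimes>\<^sub>M leb d)"
    unfolding F_def by measurable
  have F_int: "integrable (leb d) (F x)" for x
    unfolding F_def using g g' by (rule integrable_mult_cnj)
  define R where "R x u = (LINT s|leb d. F x s * cnj (F x (vdiff d s u)))" for x u
  have R_meas[measurable]: "case_prod R \<in> borel_measurable (leb d \<Otimes>\<^sub>M leb d)"
    unfolding R_def by measurable
  define n1 where "n1 u = (\<integral>\<^sup>+s. ennreal (cmod (F u s)) \<partial>leb d)" for u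
  have n1_le: "n1 u \<le> ennreal (nsq (leb d) g)" for u
  proof -
    have "n1 u = ennreal (LINT s|leb d. cmod (F u s))"
      unfolding n1_def using F_int by (intro nn_integral_eq_integral) auto
    also have "(LINT s|leb d. cmod (F u s)) \<le> nsq (leb d) g"
    proof (rule power2_le_imp_le)
      show "(LINT s|leb d. cmod (F u s))\<^sup>2 \<le> (nsq (leb d) g)\<^sup>2"
        using Cauchy_Schwarz_integral[OF g g'[of u]] sq_int_vdiff(2)[OF g, of u]
        by (simp add: F_def norm_mult power2_eq_square)
    qed simp
    finally show ?thesis by (simp add: ennreal_leI)
  qed
  \<comment> \<open>The product consists of g at s, s - x, s - u and s - u - x, an expression
    symmetric in x and u. After exchanging the two roles, x occurs in only one factor.\<close>
  have F_swap: "F x s * cnj (F x (vdiff d s u)) = F u s * cnj (F u (vdiff d s x))"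
    if "s \<in> space (leb d)" for x s u
  proof -
    have "vdiff d (vdiff d s u) x = vdiff d (vdiff d s x) u"
      by (auto simp: vdiff_def fun_eq_iff)
    then show ?thesis by (simp add: F_def mult_ac)
  qed
  have H_bound: "(\<integral>\<^sup>+x. \<integral>\<^sup>+s. ennreal (cmod (F u s * cnj (F u (vdiff d s x)))) \<partial>leb d \<partial>leb d)
      = n1 u * n1 u" if u[measurable]: "u \<in> space (leb d)" for u
  proof -
    have "(\<integral>\<^sup>+x. \<integral>\<^sup>+s. ennreal (cmod (F u s * cnj (F u (vdiff d s x)))) \<partial>leb d \<partial>leb d)
        = (\<integral>\<^sup>+s. \<integral>\<^sup>+x. ennreal (cmod (F u s)) * ennreal (cmod (F u (vdiff d s x))) \<partial>leb d \<partial>leb d)"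
      by (subst leb2.Fubini') (auto simp: norm_mult ennreal_mult)
    also have "\<dots> = (\<integral>\<^sup>+s. ennreal (cmod (F u s)) * n1 u \<partial>leb d)"
    proof (intro nn_integral_cong)
      fix s assume [measurable]: "s \<in> space (leb d)"
      have "(\<integral>\<^sup>+x. ennreal (cmod (F u (vdiff d s x))) \<partial>leb d) = n1 u"
        unfolding n1_def by (rule nn_integral_vdiff(2)) measurable
      then show "(\<integral>\<^sup>+x. ennreal (cmod (F u s)) * ennreal (cmod (F u (vdiff d s x))) \<partial>leb d) = ennreal (cmod (F u s)) * n1 u"
        by (subst nn_integral_cmult) auto
    qed
    also have "\<dots> = n1 u * n1 u" by (subst nn_integral_multc) (auto simp: n1_def)
    finally show ?thesis .
  qed
  \<comment> \<open>For fixed u the x-integral separates into the integral of \<open>F u\<close>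
    times its conjugate, which is the squared modulus of the autocorrelation of g at u.\<close>
  have inner: "(LINT x|leb d. R x u) = of_real ((cmod (A u))\<^sup>2)" if u[measurable]: "u \<in> space (leb d)" for u
  proof -
    have "(LINT x|leb d. R x u) = (LINT x|leb d. LINT s|leb d. F u s * cnj (F u (vdiff d s x)))"
      unfolding R_def by (intro Bochner_Integration.integral_cong refl F_swap)
    also have "\<dots> = (LINT s|leb d. LINT x|leb d. F u s * cnj (F u (vdiff d s x)))"
    proof (rule leb2.Fubini_integral[symmetric])
      show "integrable (leb d \<Otimes>\<^sub>M leb d) (\<lambda>(x, s). F u s * cnj (F u (vdiff d s x)))"
      proof (rule integrableI_bounded)
        have "(\<integral>\<^sup>+p. ennreal (norm (case_prod (\<lambda>x s. F u s * cnj (F u (vdiff d s x))) p)) \<partial>(leb d \<Otimes>\<^sub>M leb d)) = n1 u * n1 u"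
          by (subst leb.nn_integral_fst[symmetric]) (auto simp: H_bound[OF u])
        also have "\<dots> < \<infinity>" using n1_le[of u] by (auto simp: ennreal_mult_less_top intro: order_le_less_trans)
        finally show "(\<integral>\<^sup>+p. ennreal (norm (case_prod (\<lambda>x s. F u s * cnj (F u (vdiff d s x))) p)) \<partial>(leb d \<Otimes>\<^sub>M leb d)) < \<infinity>" .
      qed measurable
    qed
    also have "\<dots> = (LINT s|leb d. F u s * cnj (A' u))" if "\<And>u. A' u = (LINT t|leb d. F u t)" for A'
    proof (intro Bochner_Integration.integral_cong refl)
      fix s assume [measurable]: "s \<in> space (leb d)"
      have "(LINT x|leb d. F u (vdiff d s x)) = A' u"
        unfolding that by (rule integral_vdiff(2)) measurable
      then show "(LINT x|leb d. F u s * cnj (F u (vdiff d s x))) = F u s * cnj (A' u)"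
        by (simp only: integral_mult_right_zero Bochner_Integration.integral_cnj)
    qed
    also have "(LINT s|leb d. F u s * cnj (LINT t|leb d. F u t)) = of_real ((cmod (LINT t|leb d. F u t))\<^sup>2)"
      by (simp only: integral_mult_left_zero complex_norm_square)
    also have "(LINT t|leb d. F u t) = cnj (A u)"
      unfolding A_def cnj_ip by (simp add: ip_def F_def)
    finally show ?thesis by simp
  qed
  have KR_int: "integrable (leb d \<Otimes>\<^sub>M leb d) (\<lambda>(x, u). of_real (?K u) * R x u)"
  proof (rule integrableI_bounded)
    have "(\<integral>\<^sup>+p. ennreal (norm (case_prod (\<lambda>x u. complex_of_real (?K u) * R x u) p)) \<partial>(leb d \<Otimes>\<^sub>M leb d))
        = (\<integral>\<^sup>+x. \<integral>\<^sup>+u. ennreal (?K u) * ennreal (cmod (R x u)) \<partial>leb d \<partial>leb d)"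
      by (subst leb.nn_integral_fst[symmetric]) (auto simp: norm_mult ennreal_mult gauss_kernel_nonneg)
    also have "\<dots> = (\<integral>\<^sup>+u. \<integral>\<^sup>+x. ennreal (?K u) * ennreal (cmod (R x u)) \<partial>leb d \<partial>leb d)"
      by (rule leb2.Fubini') measurable
    also have "\<dots> \<le> (\<integral>\<^sup>+u. ennreal (?K u) * ennreal ((nsq (leb d) g)\<^sup>2) \<partial>leb d)"
    proof (intro nn_integral_mono)
      fix u assume u[measurable]: "u \<in> space (leb d)"
      have "(\<integral>\<^sup>+x. ennreal (cmod (R x u)) \<partial>leb d) \<le> (\<integral>\<^sup>+x. \<integral>\<^sup>+s. ennreal (cmod (F u s * cnj (F u (vdiff d s x)))) \<partial>leb d \<partial>leb d)"
      proof (intro nn_integral_mono)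
        fix x assume [measurable]: "x \<in> space (leb d)"
        have "R x u = (LINT s|leb d. F u s * cnj (F u (vdiff d s x)))"
          unfolding R_def by (intro Bochner_Integration.integral_cong refl F_swap)
        then show "ennreal (cmod (R x u)) \<le> (\<integral>\<^sup>+s. ennreal (cmod (F u s * cnj (F u (vdiff d s x)))) \<partial>leb d)"
          using integral_norm_bound_ennreal by (cases "integrable (leb d) (\<lambda>s. F u s * cnj (F u (vdiff d s x)))") (auto simp: not_integrable_integral_eq)
      qed
      also have "\<dots> \<le> ennreal ((nsq (leb d) g)\<^sup>2)"
        unfolding H_bound[OF u] using n1_le[of u] by (auto simp: power2_eq_square ennreal_mult intro: mult_mono)
      finally show "(\<integral>\<^sup>+x. ennreal (?K u) * ennreal (cmod (R x u)) \<partial>leb d) \<le> ennreal (?K u) * ennreal ((nsq (leb d) g)\<^sup>2)"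
        by (subst nn_integral_cmult) (auto intro: mult_left_mono)
    qed
    also have "\<dots> = ennreal ((nsq (leb d) g)\<^sup>2)"
      by (subst nn_integral_multc) (auto simp: gauss_kernel_nn_integral[OF \<sigma>])
    also have "\<dots> < \<infinity>" by simp
    finally show "(\<integral>\<^sup>+p. ennreal (norm (case_prod (\<lambda>x u. complex_of_real (?K u) * R x u) p)) \<partial>(leb d \<Otimes>\<^sub>M leb d)) < \<infinity>" .
  qed measurable
  define q where "q x = (LINT \<xi>|leb d. (cmod (ft d (F x) \<xi>))\<^sup>2 * gauss_weight d \<epsilon> \<xi>)" for x
  have q_eq: "complex_of_real (q x) = (LINT u|leb d. of_real (?K u) * R x u)" for x
    unfolding q_def R_def by (rule ft_gauss_integral[OF \<epsilon> F_int])
  have q_int: "integrable (leb d) q"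
  proof -
    have "integrable (leb d) (\<lambda>x. complex_of_real (q x))"
      unfolding q_eq using leb2.integrable_fst[OF KR_int] by simp
    from integrable_Re[OF this] show ?thesis by simp
  qed
  have q_nonneg: "0 \<le> q x" for x
    unfolding q_def using gauss_weight_bounds(1) by (intro integral_nonneg_AE) auto
  have "complex_of_real (LINT x|leb d. q x) = (LINT x|leb d. LINT u|leb d. of_real (?K u) * R x u)"
    unfolding integral_complex_of_real[symmetric] q_eq ..
  also have "\<dots> = (LINT u|leb d. LINT x|leb d. of_real (?K u) * R x u)"
    using leb2.Fubini_integral[OF KR_int] by simp
  also have "\<dots> = (LINT u|leb d. of_real (?K u * (cmod (A u))\<^sup>2))"
    by (intro Bochner_Integration.integral_cong refl) (simp only: integral_mult_right_zero inner of_real_mult)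
  also have "\<dots> = of_real (LINT u|leb d. ?K u * (cmod (A u))\<^sup>2)" by (rule integral_complex_of_real)
  finally have q_total: "(LINT x|leb d. q x) = (LINT u|leb d. ?K u * (cmod (A u))\<^sup>2)"
    by (simp only: of_real_eq_iff)
  have "ennreal (LINT u|leb d. ?K u * (cmod (A u))\<^sup>2) = (\<integral>\<^sup>+x. ennreal (q x) \<partial>leb d)"
    unfolding q_total[symmetric] using q_int q_nonneg by (intro nn_integral_eq_integral[symmetric]) auto
  also have "\<dots> \<le> (\<integral>\<^sup>+x. \<integral>\<^sup>+\<xi>. ennreal ((cmod (ft d (F x) \<xi>))\<^sup>2) \<partial>leb d \<partial>leb d)"
  proof (intro nn_integral_mono)
    fix x assume x[measurable]: "x \<in> space (leb d)"
    have "integrable (leb d) (\<lambda>\<xi>. (LINT t|leb d. cmod (F x t))\<^sup>2 * gauss_weight d \<epsilon> \<xi>)"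
      using gauss_weight_integrable[OF \<epsilon>] by simp
    then have "integrable (leb d) (\<lambda>\<xi>. (cmod (ft d (F x) \<xi>))\<^sup>2 * gauss_weight d \<epsilon> \<xi>)"
    proof (rule Bochner_Integration.integrable_bound)
      show "AE \<xi> in leb d. norm ((cmod (ft d (F x) \<xi>))\<^sup>2 * gauss_weight d \<epsilon> \<xi>)
          \<le> norm ((LINT t|leb d. cmod (F x t))\<^sup>2 * gauss_weight d \<epsilon> \<xi>)"
        using ft_bound[of d "F x"] gauss_weight_bounds(1)[of d]
        by (intro AE_I2) (auto simp: abs_mult intro!: mult_right_mono power_mono)
    qed measurable
    then have "ennreal (q x) = (\<integral>\<^sup>+\<xi>. ennreal ((cmod (ft d (F x) \<xi>))\<^sup>2 * gauss_weight d \<epsilon> \<xi>) \<partial>leb d)"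
      unfolding q_def using gauss_weight_bounds(1)[of d] by (intro nn_integral_eq_integral[symmetric]) auto
    also have "\<dots> \<le> (\<integral>\<^sup>+\<xi>. ennreal ((cmod (ft d (F x) \<xi>))\<^sup>2) \<partial>leb d)"
      using gauss_weight_bounds by (intro nn_integral_mono ennreal_leI mult_right_le_one_le) auto
    finally show "ennreal (q x) \<le> (\<integral>\<^sup>+\<xi>. ennreal ((cmod (ft d (F x) \<xi>))\<^sup>2) \<partial>leb d)" .
  qed
  also have "\<dots> = (\<integral>\<^sup>+x. \<integral>\<^sup>+\<xi>. ennreal ((cmod (stft d g g (vjoin d x \<xi>)))\<^sup>2) \<partial>leb d \<partial>leb d)"
    by (intro nn_integral_cong) (simp add: stft_vjoin F_def[abs_def])
  also have "\<dots> = (\<integral>\<^sup>+z. ennreal ((cmod (stft d g g z))\<^sup>2) \<partial>leb (2 * d))"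
    by (rule nn_integral_vjoin[symmetric]) measurable
  finally show ?thesis .
qed

text \<open>As the width of the Gaussian shrinks, its mass concentrates at shift 0, where the
  autocorrelation of g is ||g||^2. After rescaling, the shifts are v / (k + 1) for a fixed v, so
  weak continuity of translations gives the pointwise limit.\<close>

lemma stft_norm_ge:
  assumes g: "sq_int (leb d) g"
  shows "ennreal ((nsq (leb d) g)\<^sup>2) \<le> (\<integral>\<^sup>+z. ennreal ((cmod (stft d g g z))\<^sup>2) \<partial>leb (2 * d))"
proof -
  note [measurable] = sq_int_measurable[OF g]
  let ?A = "\<lambda>u. ip (leb d) (\<lambda>t. g (vdiff d t u)) g"
  let ?c = "\<lambda>k. 1 / real (Suc k)"
  let ?K = "gauss_kernel d (1 / (2 * pi))"
  have [measurable]: "?A \<in> borel_measurable (leb d)" unfolding ip_def by measurable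
  have A_bd: "(cmod (?A u))\<^sup>2 \<le> (nsq (leb d) g)\<^sup>2" for u
    using Cauchy_Schwarz_ip[OF sq_int_vdiff(1)[OF g] g] by (simp add: sq_int_vdiff(2)[OF g] power2_eq_square)
  have K: "integrable (leb d) ?K" by (rule gauss_kernel_integrable) simp
  have ms[measurable]: "(\<lambda>t. \<lambda>i\<in>{..<d}. c * t i) \<in> measurable (leb d) (leb d)" for c
    using measurable_affine[where n = d and a = "\<lambda>_. 0" and c = c] by simp
  have "(\<lambda>k. LINT v|leb d. ?K v * (cmod (?A (\<lambda>i\<in>{..<d}. ?c k * v i)))\<^sup>2) \<longlonglongrightarrow> (LINT v|leb d. ?K v * (nsq (leb d) g)\<^sup>2)"
  proof (rule integral_dominated_convergence[where w="\<lambda>v. ?K v * (nsq (leb d) g)\<^sup>2"])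
    show "AE v in leb d. (\<lambda>k. ?K v * (cmod (?A (\<lambda>i\<in>{..<d}. ?c k * v i)))\<^sup>2) \<longlonglongrightarrow> ?K v * (nsq (leb d) g)\<^sup>2"
    proof (rule AE_I2)
      fix v
      interpret null_shifts d "\<lambda>k. \<lambda>i\<in>{..<d}. ?c k * v i"
      proof
        fix i assume "i < d"
        have "(\<lambda>k. ?c k * v i) \<longlonglongrightarrow> 0 * v i"
          using LIMSEQ_inverse_real_of_nat by (intro tendsto_intros) (auto simp: inverse_eq_divide)
        then show "(\<lambda>k. (\<lambda>i\<in>{..<d}. ?c k * v i) i) \<longlonglongrightarrow> 0" using \<open>i < d\<close> by simp
      qed
      have "(\<lambda>k. (cmod (?A (\<lambda>i\<in>{..<d}. ?c k * v i)))\<^sup>2) \<longlonglongrightarrow> (cmod (ip (leb d) g g))\<^sup>2"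
        by (intro tendsto_intros translation_weakly_continuous g)
      then have "(\<lambda>k. (cmod (?A (\<lambda>i\<in>{..<d}. ?c k * v i)))\<^sup>2) \<longlonglongrightarrow> (nsq (leb d) g)\<^sup>2"
        by (simp only: ip_self norm_of_real power2_abs)
      then show "(\<lambda>k. ?K v * (cmod (?A (\<lambda>i\<in>{..<d}. ?c k * v i)))\<^sup>2) \<longlonglongrightarrow> ?K v * (nsq (leb d) g)\<^sup>2"
        by (rule tendsto_mult_left)
    qed
    show "AE v in leb d. norm (?K v * (cmod (?A (\<lambda>i\<in>{..<d}. ?c k * v i)))\<^sup>2) \<le> ?K v * (nsq (leb d) g)\<^sup>2" for k
      using A_bd gauss_kernel_nonneg by (intro AE_I2) (auto simp: abs_mult intro!: mult_left_mono)
    show "integrable (leb d) (\<lambda>v. ?K v * (nsq (leb d) g)\<^sup>2)" using K by simp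
  qed measurable
  then have lim: "(\<lambda>k. LINT v|leb d. ?K v * (cmod (?A (\<lambda>i\<in>{..<d}. ?c k * v i)))\<^sup>2) \<longlonglongrightarrow> (nsq (leb d) g)\<^sup>2"
    by (simp add: gauss_kernel_integral)
  have "ennreal (LINT v|leb d. ?K v * (cmod (?A (\<lambda>i\<in>{..<d}. ?c k * v i)))\<^sup>2)
      \<le> (\<integral>\<^sup>+z. ennreal ((cmod (stft d g g z))\<^sup>2) \<partial>leb (2 * d))" for k
  proof -
    have "(LINT u|leb d. gauss_kernel d (?c k * (1 / (2 * pi))) u * (cmod (?A u))\<^sup>2)
        = (LINT v|leb d. ?K v * (cmod (?A (\<lambda>i\<in>{..<d}. ?c k * v i)))\<^sup>2)"
      by (rule gauss_kernel_scale) (simp, measurable)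
    then show ?thesis using stft_gauss_autocorrelation[OF g, of "?c k"] by simp
  qed
  then show ?thesis using tendsto_ennrealI[OF lim] by (intro LIMSEQ_le_const2) auto
qed

theorem stft_norm:
  assumes g: "sq_int (leb d) g" "nsq (leb d) g = 1"
  shows "(\<integral>\<^sup>+z. ennreal ((cmod (stft d g g z))\<^sup>2) \<partial>leb (2 * d)) = 1"
  using stft_norm_ge[OF g(1)] stft_norm_le[OF g(1) g(1)] g(2) by (simp add: antisym)

section \<open>Perimeter and translations\<close>

text \<open>The derivative along lines is part of the definition, so that no multivariate chain rule is
  needed for the cut-off functions built below.\<close>

definition C1_with :: "nat \<Rightarrow> ((nat \<Rightarrow> real) \<Rightarrow> real) \<Rightarrow> (nat \<Rightarrow> (nat \<Rightarrow> real) \<Rightarrow> real) \<Rightarrow> bool" where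
  "C1_with n f D \<longleftrightarrow>
    continuous_map (euc_top n) euclideanreal f \<and> (\<forall>i<n. continuous_map (euc_top n) euclideanreal (D i)) \<and>
    f \<in> borel_measurable (leb n) \<and> (\<forall>i<n. D i \<in> borel_measurable (leb n)) \<and>
    (\<forall>x. f (restrict x {..<n}) = f x) \<and> (\<forall>i<n. \<forall>x. D i (restrict x {..<n}) = D i x) \<and>
    (\<exists>B\<ge>0. \<forall>x. \<bar>f x\<bar> \<le> B \<and> (\<forall>i<n. \<bar>D i x\<bar> \<le> B)) \<and>
    (\<forall>x v. ((\<lambda>s. f (\<lambda>j. x j + s * v j)) has_real_derivative (\<Sum>i<n. v i * D i x)) (at 0))"

lemma C1_withD:
  assumes "C1_with n f D"
  shows "continuous_map (euc_top n) euclideanreal f" "i < n \<Longrightarrow> continuous_map (euc_top n) euclideanreal (D i)"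
    and "f \<in> borel_measurable (leb n)" "i < n \<Longrightarrow> D i \<in> borel_measurable (leb n)"
    and "f (restrict x {..<n}) = f x" "i < n \<Longrightarrow> D i (restrict x {..<n}) = D i x"
    and "((\<lambda>s. f (\<lambda>j. x j + s * v j)) has_real_derivative (\<Sum>i<n. v i * D i x)) (at 0)"
  using assms unfolding C1_with_def by blast+

lemma C1_with_const: "C1_with n (\<lambda>x. c) (\<lambda>i x. 0)"
  unfolding C1_with_def by (auto intro!: exI[of _ "\<bar>c\<bar>"])

lemma C1_with_mult:
  assumes f: "C1_with n f D" and g: "C1_with n g E"
  shows "C1_with n (\<lambda>x. f x * g x) (\<lambda>i x. D i x * g x + f x * E i x)"
proof -
  obtain B where B: "0 \<le> B" "\<And>x. \<bar>f x\<bar> \<le> B" "\<And>x i. i < n \<Longrightarrow> \<bar>D i x\<bar> \<le> B"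
    using f unfolding C1_with_def by blast
  obtain C where C: "0 \<le> C" "\<And>x. \<bar>g x\<bar> \<le> C" "\<And>x i. i < n \<Longrightarrow> \<bar>E i x\<bar> \<le> C"
    using g unfolding C1_with_def by blast
  have 1: "\<bar>f x * g x\<bar> \<le> 2 * (B * C)" for x
  proof -
    have "\<bar>f x\<bar> * \<bar>g x\<bar> \<le> B * C" using B C by (intro mult_mono) auto
    moreover have "0 \<le> B * C" using B C by simp
    ultimately show ?thesis unfolding abs_mult by linarith
  qed
  have 2: "\<bar>D i x * g x + f x * E i x\<bar> \<le> 2 * (B * C)" if "i < n" for i x
  proof -
    have "\<bar>D i x\<bar> * \<bar>g x\<bar> \<le> B * C" "\<bar>f x\<bar> * \<bar>E i x\<bar> \<le> B * C"
      using B C that by (auto intro!: mult_mono)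
    then show ?thesis using abs_triangle_ineq[of "D i x * g x" "f x * E i x"] unfolding abs_mult by linarith
  qed
  have 3: "((\<lambda>s. f (\<lambda>j. x j + s * v j) * g (\<lambda>j. x j + s * v j)) has_real_derivative
      (\<Sum>i<n. v i * (D i x * g x + f x * E i x))) (at 0)" for x v
  proof -
    have "((\<lambda>s. f (\<lambda>j. x j + s * v j)) has_real_derivative (\<Sum>i<n. v i * D i x)) (at 0)"
      "((\<lambda>s. g (\<lambda>j. x j + s * v j)) has_real_derivative (\<Sum>i<n. v i * E i x)) (at 0)"
      using f g unfolding C1_with_def by blast+
    from DERIV_mult[OF this] show ?thesis
      by (rule DERIV_cong) (simp add: sum_distrib_right distrib_left sum.distrib sum_distrib_left mult_ac)
  qed
  have "\<exists>B\<ge>0. \<forall>x. \<bar>f x * g x\<bar> \<le> B \<and> (\<forall>i<n. \<bar>D i x * g x + f x * E i x\<bar> \<le> B)"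
    using 1 2 B C by (intro exI[of _ "2 * (B * C)"]) auto
  moreover have "continuous_map (euc_top n) euclideanreal (\<lambda>x. D i x * g x + f x * E i x)" if "i < n" for i
    using C1_withD(1,2)[OF f] C1_withD(1,2)[OF g] that
    by (intro continuous_map_add continuous_map_real_mult) auto
  moreover have "(\<lambda>x. D i x * g x + f x * E i x) \<in> borel_measurable (leb n)" if "i < n" for i
    using C1_withD(3,4)[OF f] C1_withD(3,4)[OF g] that by simp
  moreover have "continuous_map (euc_top n) euclideanreal (\<lambda>x. f x * g x)" "(\<lambda>x. f x * g x) \<in> borel_measurable (leb n)"
    using C1_withD(1,3)[OF f] C1_withD(1,3)[OF g] by (auto intro: continuous_map_real_mult)
  ultimately show ?thesis
    unfolding C1_with_def using 3 C1_withD(5,6)[OF f] C1_withD(5,6)[OF g] by simp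
qed

lemma C1_with_compl: "C1_with n f D \<Longrightarrow> C1_with n (\<lambda>x. 1 - f x) (\<lambda>i x. - D i x)"
proof -
  assume f: "C1_with n f D"
  obtain B where B: "0 \<le> B" "\<And>x. \<bar>f x\<bar> \<le> B" "\<And>x i. i < n \<Longrightarrow> \<bar>D i x\<bar> \<le> B"
    using f unfolding C1_with_def by blast
  have 1: "\<bar>1 - f x\<bar> \<le> 1 + B" for x using B(2)[of x] by linarith
  have 2: "\<bar>- D i x\<bar> \<le> 1 + B" if "i < n" for i x using B(3)[OF that, of x] by linarith
  have 3: "((\<lambda>s. 1 - f (\<lambda>j. x j + s * v j)) has_real_derivative (\<Sum>i<n. v i * - D i x)) (at 0)" for x v
  proof -
    have "((\<lambda>s. f (\<lambda>j. x j + s * v j)) has_real_derivative (\<Sum>i<n. v i * D i x)) (at 0)"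
      using f unfolding C1_with_def by blast
    from DERIV_diff[OF DERIV_const this] show ?thesis by (rule DERIV_cong) (simp add: sum_negf)
  qed
  have "\<exists>B\<ge>0. \<forall>x. \<bar>1 - f x\<bar> \<le> B \<and> (\<forall>i<n. \<bar>- D i x\<bar> \<le> B)"
    using 1 2 B by (intro exI[of _ "1 + B"]) auto
  moreover have "continuous_map (euc_top n) euclideanreal (\<lambda>x. - D i x)" "(\<lambda>x. - D i x) \<in> borel_measurable (leb n)" if "i < n" for i
    using C1_withD(2,4)[OF f that] by (auto intro: continuous_map_minus)
  moreover have "continuous_map (euc_top n) euclideanreal (\<lambda>x. 1 - f x)" "(\<lambda>x. 1 - f x) \<in> borel_measurable (leb n)"
    using C1_withD(1,3)[OF f] by (auto intro: continuous_map_diff)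
  ultimately show ?thesis
    unfolding C1_with_def using 3 C1_withD(5,6)[OF f] by simp
qed

lemma C1_with_prod:
  assumes "\<And>k. k \<in> A \<Longrightarrow> \<exists>D. C1_with n (f k) D"
  shows "\<exists>D. C1_with n (\<lambda>x. \<Prod>k\<in>A. f k x) D"
  using assms
proof (induction A rule: infinite_finite_induct)
  case (insert k A)
  then obtain D E where "C1_with n (f k) D" "C1_with n (\<lambda>x. \<Prod>k\<in>A. f k x) E" by blast
  from C1_with_mult[OF this] show ?case using insert(1,2) by auto
qed (auto intro: C1_with_const)

lemma C1_with_coord:
  assumes i: "i < n" and b: "\<And>t. (b has_real_derivative b' t) (at t)" and cont: "continuous_on UNIV b'"
    and bd: "\<And>t. \<bar>b t\<bar> \<le> B" "\<And>t. \<bar>b' t\<bar> \<le> B"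
  shows "C1_with n (\<lambda>x. b (x i)) (\<lambda>j x. if j = i then b' (x i) else 0)"
proof -
  have cb: "continuous_on UNIV b" using b by (meson DERIV_isCont continuous_at_imp_continuous_on)
  have proj: "continuous_map (euc_top n) euclideanreal (\<lambda>x. x i)"
    unfolding euc_top_def by (rule continuous_map_product_projection) (use i in simp)
  have comp: "continuous_map (euc_top n) euclideanreal (\<lambda>x. h (x i))" if "continuous_on UNIV h" for h :: "real \<Rightarrow> real"
    using continuous_map_compose[OF proj, of euclideanreal h] that by (simp add: comp_def)
  have meas: "(\<lambda>x. h (x i)) \<in> borel_measurable (leb n)" if "continuous_on UNIV h" for h :: "real \<Rightarrow> real"
    using borel_measurable_continuous_on[OF that measurable_leb_component[OF i]] .
  have B0: "0 \<le> B" using bd(1)[of 0] by linarith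
  have 3: "((\<lambda>s. b (x i + s * v i)) has_real_derivative (\<Sum>j<n. v j * (if j = i then b' (x i) else 0))) (at 0)" for x v
  proof -
    have "((\<lambda>s. b (x i + s * v i)) has_real_derivative b' (x i + 0 * v i) * v i) (at 0)"
      by (rule DERIV_chain2[OF b]) (auto intro!: derivative_eq_intros)
    then show ?thesis
    proof (rule DERIV_cong)
      have "(\<Sum>j<n. v j * (if j = i then b' (x i) else 0)) = (\<Sum>j<n. if j = i then v i * b' (x i) else 0)"
        by (rule sum.cong) auto
      then show "b' (x i + 0 * v i) * v i = (\<Sum>j<n. v j * (if j = i then b' (x i) else 0))"
        using i by simp
    qed
  qed
  have 4: "continuous_map (euc_top n) euclideanreal (\<lambda>x. if j = i then b' (x i) else 0)"
    "(\<lambda>x. if j = i then b' (x i) else 0) \<in> borel_measurable (leb n)" for j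
    using comp[OF cont] meas[OF cont] by (cases "j = i"; simp)+
  have "\<exists>B\<ge>0. \<forall>x. \<bar>b (x i)\<bar> \<le> B \<and> (\<forall>j<n. \<bar>if j = i then b' (x i) else 0\<bar> \<le> B)"
    using B0 bd by (intro exI[of _ B]) auto
  then show ?thesis unfolding C1_with_def using comp[OF cb] meas[OF cb] 3 4 i by simp
qed

text \<open>The derivative at 0 is available at every base point, so a derivative at s is the
  derivative at 0 from the base point x + s v.\<close>

lemma C1_with_line:
  assumes "C1_with n f D"
  shows "((\<lambda>s. f (\<lambda>j. x j + s * v j)) has_real_derivative (\<Sum>i<n. v i * D i (\<lambda>j. x j + s * v j))) (at s)"
proof -
  have "((\<lambda>h. f (\<lambda>j. (x j + s * v j) + h * v j)) has_real_derivative (\<Sum>i<n. v i * D i (\<lambda>j. x j + s * v j))) (at 0)"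
    by (rule C1_withD(7)[OF assms])
  then have "((\<lambda>h. f (\<lambda>j. x j + (h + s) * v j)) has_real_derivative (\<Sum>i<n. v i * D i (\<lambda>j. x j + s * v j))) (at 0)"
    by (simp add: algebra_simps)
  then show ?thesis
    using DERIV_shift[of "\<lambda>s. f (\<lambda>j. x j + s * v j)" _ 0 s] by simp
qed

lemma C1_with_partial:
  assumes f: "C1_with n f D" and i: "i < n"
  shows "((\<lambda>s. f (x(i := s))) has_real_derivative D i x) (at (x i))"
    and "partial_deriv i f x = D i x"
proof -
  define e where "e j = (if j = i then 1 else 0 :: real)" for j
  have eq: "(\<lambda>j. x j + (s - x i) * e j) = x(i := s)" for s by (auto simp: e_def)
  have "(\<Sum>j<n. e j * D j x) = (\<Sum>j<n. if j = i then D i x else 0)" by (rule sum.cong) (auto simp: e_def)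
  then have "(\<Sum>j<n. e j * D j x) = D i x" using i by simp
  then have "((\<lambda>s. f (\<lambda>j. x j + s * e j)) has_real_derivative D i x) (at 0)"
    using C1_withD(7)[OF f, of x e] by simp
  then have "((\<lambda>s. f (\<lambda>j. x j + (s - x i) * e j)) has_real_derivative D i x) (at (x i))"
    using DERIV_shift[of "\<lambda>s. f (\<lambda>j. x j + (s - x i) * e j)" "D i x" 0 "x i"] by simp
  then show *: "((\<lambda>s. f (x(i := s))) has_real_derivative D i x) (at (x i))" unfolding eq .
  then show "partial_deriv i f x = D i x" unfolding partial_deriv_def by (rule DERIV_imp_deriv)
qed

lemma continuous_map_translate:
  "continuous_map (euc_top n) (euc_top n) (\<lambda>x. \<lambda>j\<in>{..<n}. x j + c j)"
  unfolding euc_top_def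
proof (rule continuous_map_componentwise[THEN iffD2], rule conjI)
  show "(\<lambda>x. \<lambda>j\<in>{..<n}. x j + c j) ` topspace (product_topology (\<lambda>_. euclideanreal) {..<n}) \<subseteq> extensional {..<n}"
    by (rule image_subsetI) (rule restrict_extensional)
  show "\<forall>k\<in>{..<n}. continuous_map (product_topology (\<lambda>_. euclideanreal) {..<n}) euclideanreal (\<lambda>x. (\<lambda>j\<in>{..<n}. x j + c j) k)"
  proof (rule ballI)
  fix k assume k: "k \<in> {..<n}"
  have "continuous_map (product_topology (\<lambda>_. euclideanreal) {..<n}) euclideanreal (\<lambda>x. x k)"
      by (rule continuous_map_product_projection) (rule k)
  from continuous_map_add[OF this continuous_map_const[THEN iffD2, OF disjI2]]
  have "continuous_map (product_topology (\<lambda>_. euclideanreal) {..<n}) euclideanreal (\<lambda>x. x k + c k)"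
    by (metis UNIV_I topspace_euclidean)
  then show "continuous_map (product_topology (\<lambda>_. euclideanreal) {..<n}) euclideanreal (\<lambda>x. (\<lambda>j\<in>{..<n}. x j + c j) k)"
    by (simp only: restrict_apply k if_True)
qed 
qed

lemma measurable_translate: "(\<lambda>x. \<lambda>j\<in>{..<n}. x j + c j) \<in> measurable (leb n) (leb n)"
  using measurable_affine[where n = n and a = c and c = 1] by (simp add: add.commute)

text \<open>The translate is taken in all coordinates and thus leaves the extensional functions that
  make up the space. Invariance under restriction to the first n coordinates allows replacing it by
  the restricted translate, for which continuity and measurability are meaningful.\<close>

lemma C1_with_translate:
  assumes f: "C1_with n f D"
  shows "C1_with n (\<lambda>x. f (\<lambda>j. x j + c j)) (\<lambda>i x. D i (\<lambda>j. x j + c j))"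
proof -
  have tr: "h (\<lambda>j. x j + c j) = h (\<lambda>j\<in>{..<n}. x j + c j)" if "\<And>x. h (restrict x {..<n}) = h x" for h :: "_ \<Rightarrow> real" and x
    using that[of "\<lambda>j. x j + c j"] by simp
  have inv_f: "f (restrict x {..<n}) = f x" for x using f unfolding C1_with_def by blast
  have inv_D: "D i (restrict x {..<n}) = D i x" if "i < n" for i x using f that unfolding C1_with_def by blast
  have cont: "continuous_map (euc_top n) euclideanreal (\<lambda>x. h (\<lambda>j. x j + c j))"
    if "continuous_map (euc_top n) euclideanreal h" "\<And>x. h (restrict x {..<n}) = h x" for h :: "_ \<Rightarrow> real"
    unfolding tr[of h, OF that(2)]
    using continuous_map_compose[OF continuous_map_translate that(1)] by (simp add: comp_def)
  have meas: "(\<lambda>x. h (\<lambda>j. x j + c j)) \<in> borel_measurable (leb n)"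
    if "h \<in> borel_measurable (leb n)" "\<And>x. h (restrict x {..<n}) = h x" for h :: "_ \<Rightarrow> real"
    unfolding tr[of h, OF that(2)] using measurable_compose[OF measurable_translate that(1)] .
  have inv: "h (\<lambda>j. restrict x {..<n} j + c j) = h (\<lambda>j. x j + c j)" if h: "\<And>x. h (restrict x {..<n}) = h x"
    for h :: "_ \<Rightarrow> real" and x
  proof -
    have "restrict (\<lambda>j. restrict x {..<n} j + c j) {..<n} = restrict (\<lambda>j. x j + c j) {..<n}" by auto
    then show ?thesis using h by metis
  qed
  obtain B where B: "0 \<le> B" "\<And>x. \<bar>f x\<bar> \<le> B" "\<And>x i. i < n \<Longrightarrow> \<bar>D i x\<bar> \<le> B"
    using f unfolding C1_with_def by blast
  have 3: "((\<lambda>s. f (\<lambda>j. x j + s * v j + c j)) has_real_derivative (\<Sum>i<n. v i * D i (\<lambda>j. x j + c j))) (at 0)" for x v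
  proof -
    have "((\<lambda>s. f (\<lambda>j. (x j + c j) + s * v j)) has_real_derivative (\<Sum>i<n. v i * D i (\<lambda>j. x j + c j))) (at 0)"
      by (rule C1_withD(7)[OF f])
    then show ?thesis by (simp add: add_ac)
  qed
  have cf: "continuous_map (euc_top n) euclideanreal f" "f \<in> borel_measurable (leb n)"
    using f unfolding C1_with_def by blast+
  have cD: "continuous_map (euc_top n) euclideanreal (D i)" "D i \<in> borel_measurable (leb n)" if "i < n" for i
    using f that unfolding C1_with_def by blast+
  have cD': "continuous_map (euc_top n) euclideanreal (\<lambda>x. D i (\<lambda>j. x j + c j))"
    "(\<lambda>x. D i (\<lambda>j. x j + c j)) \<in> borel_measurable (leb n)"
    "D i (\<lambda>j. restrict x {..<n} j + c j) = D i (\<lambda>j. x j + c j)" if "i < n" for i x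
    by (rule cont[OF cD(1)[OF that]], rule inv_D[OF that], rule meas[OF cD(2)[OF that]], rule inv_D[OF that],
        rule inv[of "D i"], rule inv_D[OF that])
  have "\<exists>B\<ge>0. \<forall>x. \<bar>f (\<lambda>j. x j + c j)\<bar> \<le> B \<and> (\<forall>i<n. \<bar>D i (\<lambda>j. x j + c j)\<bar> \<le> B)"
    using B by blast
  then show ?thesis
    unfolding C1_with_def
    using cont[OF cf(1) inv_f] meas[OF cf(2) inv_f] inv[of f, OF inv_f] 3 cD'
    by (intro conjI allI impI) assumption+
qed

text \<open>The constant is the inverse of \<open>(r\<^sup>2 - (r / 2)\<^sup>2)\<^sup>2\<close>, so that the bump equals \<open>1\<close> on the
  half-size interval.\<close>

definition bump :: "real \<Rightarrow> real \<Rightarrow> real \<Rightarrow> real" where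
  "bump a r t = 1 - (max 0 (1 - 16 / (9 * r ^ 4) * (max 0 (r\<^sup>2 - (t - a)\<^sup>2))\<^sup>2))\<^sup>2"

definition bump' :: "real \<Rightarrow> real \<Rightarrow> real \<Rightarrow> real" where
  "bump' a r t = - (2 * max 0 (1 - 16 / (9 * r ^ 4) * (max 0 (r\<^sup>2 - (t - a)\<^sup>2))\<^sup>2) *
     - (16 / (9 * r ^ 4) * (2 * max 0 (r\<^sup>2 - (t - a)\<^sup>2) * - (2 * (t - a)))))"

text \<open>Squaring the positive part removes its corner at 0. \<open>bump\<close> uses this twice,
  once where it leaves the value 0 and once where it reaches the plateau 1.\<close>

lemma DERIV_max0_square: "((\<lambda>t::real. (max 0 t)\<^sup>2) has_real_derivative 2 * max 0 t) (at t)"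
proof -
  consider "t < 0" | "t = 0" | "0 < t" by linarith
  then show ?thesis
  proof cases
    case 1
    have "((\<lambda>t. 0) has_real_derivative 0) (at t)" by simp
    then have "((\<lambda>t::real. (max 0 t)\<^sup>2) has_real_derivative 0) (at t)"
      by (rule has_field_derivative_transform_within_open[of _ _ _ "{..<0}"]) (use 1 in \<open>auto simp: max_def\<close>)
    then show ?thesis using 1 by simp
  next
    case 3
    have "((\<lambda>t. t\<^sup>2) has_real_derivative 2 * t) (at t)" by (auto intro!: derivative_eq_intros)
    then have "((\<lambda>t::real. (max 0 t)\<^sup>2) has_real_derivative 2 * t) (at t)"
      by (rule has_field_derivative_transform_within_open[of _ _ _ "{0<..}"]) (use 3 in \<open>auto simp: max_def\<close>)
    then show ?thesis using 3 by simp
  next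
    case 2
    have "((\<lambda>h. ((max 0 (0 + h))\<^sup>2 - (max 0 (0::real))\<^sup>2) / h) \<longlongrightarrow> 0) (at 0)"
    proof (rule Lim_null_comparison[OF always_eventually])
      show "\<forall>h::real. norm (((max 0 (0 + h))\<^sup>2 - (max 0 (0::real))\<^sup>2) / h) \<le> \<bar>h\<bar>"
        by (auto simp: max_def power2_eq_square)
      show "((\<lambda>h::real. \<bar>h\<bar>) \<longlongrightarrow> 0) (at 0)" by (intro tendsto_rabs_zero tendsto_ident_at)
    qed
    then show ?thesis using 2 by (simp add: DERIV_def)
  qed
qed

lemma DERIV_bump: "(bump a r has_real_derivative bump' a r t) (at t)"
proof -
  note q = DERIV_chain2[OF DERIV_max0_square]
  have 1: "((\<lambda>t. r\<^sup>2 - (t - a)\<^sup>2) has_real_derivative - (2 * (t - a))) (at t)"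
    by (auto intro!: derivative_eq_intros)
  have 2: "((\<lambda>t. 1 - 16 / (9 * r ^ 4) * (max 0 (r\<^sup>2 - (t - a)\<^sup>2))\<^sup>2) has_real_derivative
      - (16 / (9 * r ^ 4) * (2 * max 0 (r\<^sup>2 - (t - a)\<^sup>2) * - (2 * (t - a))))) (at t)"
    using DERIV_diff[OF DERIV_const DERIV_cmult[OF q[OF 1], of "16 / (9 * r ^ 4)"], of 1]
    by (simp only: diff_0)
  show ?thesis
    unfolding bump_def[abs_def] bump'_def using DERIV_diff[OF DERIV_const q[OF 2], of 1] by (simp only: diff_0)
qed

lemma bump_range: "0 \<le> bump a r t" "bump a r t \<le> 1"
proof -
  have "0 \<le> 16 / (9 * r ^ 4) * (max 0 (r\<^sup>2 - (t - a)\<^sup>2))\<^sup>2" by simp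
  then have "(max 0 (1 - 16 / (9 * r ^ 4) * (max 0 (r\<^sup>2 - (t - a)\<^sup>2))\<^sup>2))\<^sup>2 \<le> 1\<^sup>2"
    by (intro power_mono) auto
  then show "0 \<le> bump a r t" by (simp add: bump_def)
  show "bump a r t \<le> 1" by (simp add: bump_def)
qed

lemma bump_outside: "0 < r \<Longrightarrow> r \<le> \<bar>t - a\<bar> \<Longrightarrow> bump a r t = 0 \<and> bump' a r t = 0"
  using power_mono[of r "\<bar>t - a\<bar>" 2] by (simp add: bump_def bump'_def max_def)

lemma bump_inside:
  assumes r: "0 < r" and t: "\<bar>t - a\<bar> \<le> r / 2"
  shows "bump a r t = 1"
proof -
  have "(t - a)\<^sup>2 \<le> (r / 2)\<^sup>2" using power_mono[OF t, of 2] by simp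
  then have "3 / 4 * r\<^sup>2 \<le> r\<^sup>2 - (t - a)\<^sup>2" by (simp add: power_divide)
  then have "3 / 4 * r\<^sup>2 \<le> max 0 (r\<^sup>2 - (t - a)\<^sup>2)" by linarith
  then have "(3 / 4 * r\<^sup>2)\<^sup>2 \<le> (max 0 (r\<^sup>2 - (t - a)\<^sup>2))\<^sup>2" by (intro power_mono) auto
  then have "16 / (9 * r ^ 4) * (3 / 4 * r\<^sup>2)\<^sup>2 \<le> 16 / (9 * r ^ 4) * (max 0 (r\<^sup>2 - (t - a)\<^sup>2))\<^sup>2"
    using r by (intro mult_left_mono) auto
  moreover have "16 / (9 * r ^ 4) * (3 / 4 * r\<^sup>2)\<^sup>2 = 1" using r by (simp add: power_mult_distrib power2_eq_square power4_eq_xxxx)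
  ultimately show ?thesis by (simp add: bump_def)
qed

lemma bump'_continuous: "continuous_on UNIV (bump' a r)"
  unfolding bump'_def[abs_def] by (intro continuous_intros)

text \<open>The derivative is continuous and vanishes outside the interval of radius r, so its
  maximum on that compact interval bounds it globally.\<close>

lemma bump_C1:
  assumes "i < n" and r: "0 < r"
  shows "\<exists>D. C1_with n (\<lambda>x. bump a r (x i)) D"
proof -
  have "compact (bump' a r ` {a - r..a + r})"
    by (intro compact_continuous_image continuous_on_subset[OF bump'_continuous]) auto
  from compact_imp_bounded[OF this] obtain B where "\<forall>y\<in>bump' a r ` {a - r..a + r}. norm y \<le> B"
    unfolding bounded_iff by blast
  then have B: "\<bar>bump' a r t\<bar> \<le> B" if "t \<in> {a - r..a + r}" for t using that by simp
  have "\<bar>bump' a r t\<bar> \<le> max 1 B" for t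
  proof (cases "t \<in> {a - r..a + r}")
    case False
    then show ?thesis using bump_outside[OF r, of t a] by auto
  qed (use B in fastforce)
  moreover have "\<bar>bump a r t\<bar> \<le> max 1 B" for t using bump_range[of a r t] by auto
  ultimately show ?thesis
    using C1_with_coord[OF assms(1) DERIV_bump bump'_continuous, of a r "max 1 B"] by blast
qed

section \<open>From the variational perimeter to translates of smooth functions\<close>

lemma LINT_test_field_le_perimeter:
  assumes fin: "finite_perimeter n \<Omega>" and \<phi>: "\<phi> \<in> test_fields n"
  shows "(LINT x|leb n. indicator \<Omega> x * divergence n \<phi> x) \<le> perimeter n \<Omega>"
proof -
  have le: "ereal (LINT x|leb n. indicator \<Omega> x * divergence n \<phi> x) \<le> variation n (indicator \<Omega>)"
    unfolding variation_def using \<phi> by (rule SUP_upper)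
  moreover have "variation n (indicator \<Omega>) < \<infinity>" using fin by (simp add: finite_perimeter_def)
  ultimately show ?thesis
    unfolding perimeter_def by (cases "variation n (indicator \<Omega>)") auto
qed

text \<open>The test field is -(v / |v|) f: its length is |f|, and its divergence is -1/|v| times
  the derivative of f along v. A zero direction makes both sides 0 and is treated
  separately.\<close>

lemma directional_derivative_le_perimeter:
  assumes fin: "finite_perimeter n \<Omega>" and f: "C1_with n f D" and f1: "\<And>x. \<bar>f x\<bar> \<le> 1"
    and supp: "\<And>x. \<exists>i<n. N < \<bar>x i\<bar> \<Longrightarrow> f x = 0"
  shows "(LINT x|leb n. indicator \<Omega> x * (- (\<Sum>i<n. v i * D i x))) \<le> L2_set v {..<n} * perimeter n \<Omega>"
proof (cases "L2_set v {..<n} = 0")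
  case True
  then have "v i = 0" if "i < n" for i using that by (simp add: L2_set_eq_0_iff)
  then show ?thesis using True by simp
next
  case False
  define L where "L = L2_set v {..<n}"
  have L: "0 < L" using False by (simp add: L_def order_less_le)
  define \<phi> where "\<phi> x i = - (v i / L) * f x" for x i
  have C: "C1_with n (\<lambda>x. \<phi> x i) (\<lambda>j x. - (v i / L) * D j x)" for i
    using C1_with_mult[OF C1_with_const f, of "- (v i / L)"] by (simp add: \<phi>_def)
  have "(\<lambda>x. \<phi> x i) \<in> C1_c n" for i
    unfolding C1_c_def
  proof (intro CollectI conjI allI impI ballI)
    show "continuous_map (euc_top n) euclideanreal (\<lambda>x. \<phi> x i)" using C unfolding C1_with_def by blast
    fix j assume j: "j < n"
    show "(\<lambda>s. \<phi> (x(j := s)) i) differentiable (at (x j))" for x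
      using C1_with_partial(1)[OF C j] by (metis real_differentiable_def)
    show "continuous_map (euc_top n) euclideanreal (partial_deriv j (\<lambda>x. \<phi> x i))"
      unfolding C1_with_partial(2)[OF C j, abs_def] using C j unfolding C1_with_def by blast
  next
    show "\<exists>K. compactin (euc_top n) K \<and> (\<forall>x\<in>topspace (euc_top n) - K. \<phi> x i = 0)"
    proof (intro exI conjI ballI)
      show "compactin (euc_top n) (Pi\<^sub>E {..<n} (\<lambda>_. {- N..N}))"
        unfolding euc_top_def compactin_PiE by simp
      fix x assume x: "x \<in> topspace (euc_top n) - Pi\<^sub>E {..<n} (\<lambda>_. {- N..N})"
      then obtain k where "k < n" "x k \<notin> {- N..N}" by (auto simp: euc_top_def PiE_iff)
      then have "N < \<bar>x k\<bar>" by auto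
      then show "\<phi> x i = 0" using supp \<open>k < n\<close> by (auto simp: \<phi>_def)
    qed
  qed
  moreover have "L2_set (\<phi> x) {..<n} \<le> 1" for x
  proof -
    have "L2_set (\<phi> x) {..<n} = L2_set (\<lambda>i. (\<bar>f x\<bar> / L) * \<bar>v i\<bar>) {..<n}"
      unfolding L2_set_def by (intro arg_cong[where f = sqrt] sum.cong) (auto simp: \<phi>_def power_mult_distrib power_divide)
    also have "\<dots> = \<bar>f x\<bar> / L * L2_set (\<lambda>i. \<bar>v i\<bar>) {..<n}" using L by (intro L2_set_right_distrib[symmetric]) simp
    also have "L2_set (\<lambda>i. \<bar>v i\<bar>) {..<n} = L" by (simp add: L_def L2_set_def)
    finally show ?thesis using L f1[of x] by simp
  qed
  ultimately have "\<phi> \<in> test_fields n" by (simp add: test_fields_def)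
  from LINT_test_field_le_perimeter[OF fin this]
  have "(LINT x|leb n. indicator \<Omega> x * (\<Sum>i<n. - (v i / L) * D i x)) \<le> perimeter n \<Omega>"
    unfolding divergence_def using C1_with_partial(2)[OF C] by simp
  moreover have "indicator \<Omega> x * (\<Sum>i<n. - (v i / L) * D i x) = (indicator \<Omega> x * (- (\<Sum>i<n. v i * D i x))) / L" for x
    by (simp add: sum_divide_distrib[symmetric] sum_negf)
  ultimately have "(LINT x|leb n. indicator \<Omega> x * (- (\<Sum>i<n. v i * D i x))) / L \<le> perimeter n \<Omega>" by simp
  then show ?thesis using L unfolding L_def[symmetric] by (simp add: field_simps)
qed

text \<open>Let m(s) be the integral over Omega of f(x + s v). Its derivative integrates the
  directional derivative of a translate of f, again an admissible cut-off, so -m'(s) is at most |v|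
  times the perimeter for every s; the mean value theorem on [0, 1] concludes.\<close>

lemma translation_smooth_le_perimeter:
  assumes fin: "finite_perimeter n \<Omega>" and f: "C1_with n f D" and f1: "\<And>x. \<bar>f x\<bar> \<le> 1"
    and supp: "\<And>x. \<exists>i<n. N < \<bar>x i\<bar> \<Longrightarrow> f x = 0"
  shows "(LINT x|leb n. indicator \<Omega> x * (f x - f (\<lambda>j. x j + v j))) \<le> L2_set v {..<n} * perimeter n \<Omega>"
proof -
  have \<Omega>: "integrable (leb n) (indicator \<Omega> :: _ \<Rightarrow> real)" using fin by (simp add: finite_perimeter_def)
  note [measurable] = borel_measurable_integrable[OF \<Omega>]
  obtain B where B: "0 \<le> B" "\<And>x i. i < n \<Longrightarrow> \<bar>D i x\<bar> \<le> B"
    using f unfolding C1_with_def by blast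
  define T where "T s x j = x j + s * v j" for s :: real and x :: "nat \<Rightarrow> real" and j
  have CT: "C1_with n (\<lambda>x. f (T s x)) (\<lambda>i x. D i (T s x))" for s
    unfolding T_def by (rule C1_with_translate[OF f])
  have [measurable]: "(\<lambda>x. f (T s x)) \<in> borel_measurable (leb n)" for s
    using CT unfolding C1_with_def by blast
  have [measurable]: "(\<lambda>x. \<Sum>i<n. v i * D i (T s x)) \<in> borel_measurable (leb n)" for s
  proof (rule borel_measurable_sum)
    fix i assume "i \<in> {..<n}"
    then have "(\<lambda>x. D i (T s x)) \<in> borel_measurable (leb n)" using CT unfolding C1_with_def by blast
    then show "(\<lambda>x. v i * D i (T s x)) \<in> borel_measurable (leb n)" by simp
  qed
  have int: "integrable (leb n) (\<lambda>x. indicator \<Omega> x * h x)" if [measurable]: "h \<in> borel_measurable (leb n)" and "\<And>x. \<bar>h x\<bar> \<le> C" for h :: "_ \<Rightarrow> real" and C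
  proof (rule Bochner_Integration.integrable_bound[of _ "\<lambda>x. C * indicator \<Omega> x"])
    show "AE x in leb n. norm (indicator \<Omega> x * h x) \<le> norm (C * indicator \<Omega> x)"
      using that(2) by (intro AE_I2) (auto simp: indicator_def intro: order_trans[OF _ abs_ge_self])
  qed (use \<Omega> in auto)
  define L where "L = (\<Sum>i<n. \<bar>v i\<bar> * B)"
  have dir: "\<bar>\<Sum>i<n. v i * D i x\<bar> \<le> L" for x
    unfolding L_def by (rule order_trans[OF sum_abs]) (auto simp: abs_mult intro!: sum_mono mult_left_mono B)
  define m where "m s = (LINT x|leb n. indicator \<Omega> x * f (T s x))" for s
  define m' where "m' s = (LINT x|leb n. indicator \<Omega> x * (\<Sum>i<n. v i * D i (T s x)))" for s
  have line: "((\<lambda>s. f (T s x)) has_real_derivative (\<Sum>i<n. v i * D i (T s x))) (at s)" for x s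
    unfolding T_def by (rule C1_with_line[OF f])
  \<comment> \<open>Lipschitz continuity along the line dominates all difference quotients by L on
    Omega, which permits differentiation under the integral.\<close>
  have Lip: "\<bar>f (T s x) - f (T t x)\<bar> \<le> L * \<bar>s - t\<bar>" for s t x
    using field_differentiable_bound[of UNIV "\<lambda>s. f (T s x)" "\<lambda>s. \<Sum>i<n. v i * D i (T s x)" L s t] line dir by simp
  have deriv: "(m has_real_derivative m' s) (at s)" for s
    unfolding DERIV_def tendsto_at_iff_sequentially
  proof (intro allI impI)
    fix X :: "nat \<Rightarrow> real" assume X: "\<forall>i. X i \<in> UNIV - {0}" "X \<longlonglongrightarrow> 0"
    have "(\<lambda>k. LINT x|leb n. indicator \<Omega> x * ((f (T (s + X k) x) - f (T s x)) / X k)) \<longlonglongrightarrow> m' s"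
      unfolding m'_def
    proof (rule integral_dominated_convergence[where w = "\<lambda>x. L * indicator \<Omega> x"])
      show "integrable (leb n) (\<lambda>x. L * indicator \<Omega> x)" using \<Omega> by simp
      show "AE x in leb n. (\<lambda>k. indicator \<Omega> x * ((f (T (s + X k) x) - f (T s x)) / X k)) \<longlonglongrightarrow> indicator \<Omega> x * (\<Sum>i<n. v i * D i (T s x))"
      proof (intro AE_I2 tendsto_mult tendsto_const)
        fix x
        show "(\<lambda>k. (f (T (s + X k) x) - f (T s x)) / X k) \<longlonglongrightarrow> (\<Sum>i<n. v i * D i (T s x))"
          using line[of x s] X unfolding DERIV_def tendsto_at_iff_sequentially comp_def by blast
      qed
      show "AE x in leb n. norm (indicator \<Omega> x * ((f (T (s + X k) x) - f (T s x)) / X k)) \<le> L * indicator \<Omega> x" for k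
      proof (rule AE_I2)
        fix x
        have "X k \<noteq> 0" using X(1) by auto
        then have "\<bar>(f (T (s + X k) x) - f (T s x)) / X k\<bar> \<le> L"
          using Lip[of "s + X k" x s] by (simp add: abs_divide divide_le_eq)
        then show "norm (indicator \<Omega> x * ((f (T (s + X k) x) - f (T s x)) / X k)) \<le> L * indicator \<Omega> x"
          by (simp add: indicator_def)
      qed
    qed measurable
    moreover have "(LINT x|leb n. indicator \<Omega> x * ((f (T (s + X k) x) - f (T s x)) / X k)) = (m (s + X k) - m s) / X k" for k
    proof -
      have "m (s + X k) - m s = (LINT x|leb n. indicator \<Omega> x * f (T (s + X k) x) - indicator \<Omega> x * f (T s x))"
        unfolding m_def using f1 by (intro Bochner_Integration.integral_diff[symmetric] int; measurable)
      also have "\<dots> / X k = (LINT x|leb n. (indicator \<Omega> x * f (T (s + X k) x) - indicator \<Omega> x * f (T s x)) / X k)"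
        by (rule integral_divide_zero[symmetric])
      also have "\<dots> = (LINT x|leb n. indicator \<Omega> x * ((f (T (s + X k) x) - f (T s x)) / X k))"
        by (simp only: right_diff_distrib[symmetric] times_divide_eq_right)
      finally show ?thesis by (rule sym)
    qed
    ultimately show "((\<lambda>h. (m (s + h) - m s) / h) \<circ> X) \<longlonglongrightarrow> m' s" by (simp only: comp_def)
  qed
  have m'_le: "- m' s \<le> L2_set v {..<n} * perimeter n \<Omega>" for s
  proof -
    \<comment> \<open>The translate is supported in a larger box; enlarging the side by the sum of
      all |s v j| covers the shift in every coordinate.\<close>
    define N' where "N' = N + (\<Sum>j<n. \<bar>s * v j\<bar>)"
    have "f (T s x) = 0" if "\<exists>i<n. N' < \<bar>x i\<bar>" for x
    proof -
      from that obtain i where i: "i < n" "N' < \<bar>x i\<bar>" by blast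
      have "\<bar>s * v i\<bar> \<le> (\<Sum>j<n. \<bar>s * v j\<bar>)" using i by (intro member_le_sum) auto
      then have "N < \<bar>T s x i\<bar>" using i(2) unfolding N'_def T_def by linarith
      then show ?thesis using supp i(1) by blast
    qed
    then have "(LINT x|leb n. indicator \<Omega> x * (- (\<Sum>i<n. v i * D i (T s x)))) \<le> L2_set v {..<n} * perimeter n \<Omega>"
      using f1 by (intro directional_derivative_le_perimeter[OF fin CT]) auto
    then show ?thesis by (simp add: m'_def)
  qed
  obtain \<xi> where "m 1 - m 0 = (1 - 0) * m' \<xi>"
    using MVT2[of 0 1 m m'] deriv by auto
  then have "m 0 - m 1 \<le> L2_set v {..<n} * perimeter n \<Omega>" using m'_le[of \<xi>] by simp
  moreover have "m 0 - m 1 = (LINT x|leb n. indicator \<Omega> x * f (T 0 x) - indicator \<Omega> x * f (T 1 x))"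
    unfolding m_def using f1 by (intro Bochner_Integration.integral_diff[symmetric] int; measurable)
  moreover have "T 0 x = x" "T 1 x = (\<lambda>j. x j + v j)" for x by (simp_all add: T_def fun_eq_iff)
  ultimately show ?thesis by (simp add: right_diff_distrib)
qed

section \<open>Smooth approximation of compact sets\<close>

lemma openin_euc_coord:
  assumes "i < n" "open U"
  shows "openin (euc_top n) {x \<in> topspace (euc_top n). x i \<in> U}"
proof -
  have "continuous_map (euc_top n) euclideanreal (\<lambda>x. x i)"
    unfolding euc_top_def by (rule continuous_map_product_projection) (use assms in simp)
  from openin_continuous_map_preimage[OF this, of U] show ?thesis using assms by simp
qed

text \<open>Finitely many boxes of radius r/2 centred in Omega cover it, and a product bump of
  radius r equals 1 on each of them. The combination 1 - prod (1 - b) is a smooth union: it is 1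
  where some bump is 1, and 0 where all vanish.\<close>

lemma compactin_smooth_approximation:
  assumes comp: "compactin (euc_top n) \<Omega>" and r: "0 < r"
  obtains f D N where "C1_with n f D" "\<And>x. 0 \<le> f x" "\<And>x. f x \<le> 1" "\<And>x. x \<in> \<Omega> \<Longrightarrow> f x = 1"
    "\<And>x. f x \<noteq> 0 \<Longrightarrow> \<exists>w\<in>\<Omega>. \<forall>i<n. \<bar>x i - w i\<bar> < r"
    "\<And>x. \<exists>i<n. N < \<bar>x i\<bar> \<Longrightarrow> f x = 0"
proof -
  \<comment> \<open>The intersection with the whole space matters for n = 0, where the intersection
    over no coordinates would be the universal set.\<close>
  define U where "U w = topspace (euc_top n) \<inter> (\<Inter>i<n. {x \<in> topspace (euc_top n). x i \<in> ball (w i) (r / 2)})" for w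
  have "openin (euc_top n) (U w)" for w
  proof (cases "n = 0")
    case False
    then have "openin (euc_top n) (\<Inter>i<n. {x \<in> topspace (euc_top n). x i \<in> ball (w i) (r / 2)})"
      by (intro openin_INT2 openin_euc_coord) auto
    then show ?thesis unfolding U_def by blast
  qed (simp add: U_def)
  moreover have sub: "\<Omega> \<subseteq> topspace (euc_top n)" using comp by (rule compactin_subset_topspace)
  have "\<Omega> \<subseteq> \<Union> (U ` \<Omega>)"
    using sub r by (auto simp: U_def)
  ultimately obtain F where F: "finite F" "F \<subseteq> U ` \<Omega>" "\<Omega> \<subseteq> \<Union>F"
    using compactinD[OF comp, of "U ` \<Omega>"] by blast
  then obtain W where W: "finite W" "W \<subseteq> \<Omega>" "F = U ` W" by (meson finite_subset_image)
  define b where "b w x = (\<Prod>i<n. bump (w i) r (x i))" for w x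
  define f where "f x = 1 - (\<Prod>w\<in>W. 1 - b w x)" for x
  have "\<exists>D. C1_with n (b w) D" for w
    unfolding b_def[abs_def] by (rule C1_with_prod) (use r bump_C1 in auto)
  then have "\<exists>D. C1_with n (\<lambda>x. 1 - b w x) D" for w using C1_with_compl by blast
  then have "\<exists>D. C1_with n (\<lambda>x. \<Prod>w\<in>W. 1 - b w x) D" by (intro C1_with_prod)
  then obtain D where D: "C1_with n f D" unfolding f_def[abs_def] using C1_with_compl by blast
  have b01: "0 \<le> b w x" "b w x \<le> 1" for w x
    unfolding b_def using bump_range by (auto intro!: prod_nonneg prod_le_1)
  have f01: "0 \<le> f x" "f x \<le> 1" for x
    unfolding f_def using b01 by (auto intro!: prod_nonneg prod_le_1)
  have f1: "f x = 1" if "x \<in> \<Omega>" for x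
  proof -
    from that obtain w where w: "w \<in> W" "x \<in> U w" using F W by blast
    have "b w x = 1"
      unfolding b_def
    proof (rule prod.neutral, intro ballI)
      fix i assume "i \<in> {..<n}"
      then have "\<bar>x i - w i\<bar> \<le> r / 2" using w(2) by (force simp: U_def dist_real_def abs_minus_commute)
      then show "bump (w i) r (x i) = 1" using r by (intro bump_inside)
    qed
    then have "(\<Prod>w\<in>W. 1 - b w x) = 0" using w(1) W(1) by (intro prod_zero) auto
    then show ?thesis by (simp add: f_def)
  qed
  have near: "\<exists>w\<in>W. \<forall>i<n. \<bar>x i - w i\<bar> < r" if "f x \<noteq> 0" for x
  proof (rule ccontr)
    assume *: "\<not> (\<exists>w\<in>W. \<forall>i<n. \<bar>x i - w i\<bar> < r)"
    have "b w x = 0" if "w \<in> W" for w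
    proof -
      obtain i where "i < n" "r \<le> \<bar>x i - w i\<bar>" using * \<open>w \<in> W\<close> by force
      then show ?thesis unfolding b_def using bump_outside[OF r, of "x i" "w i"] by (intro prod_zero) auto
    qed
    then have "f x = 0" by (simp add: f_def)
    with that show False by simp
  qed
  define N where "N = r + (\<Sum>w\<in>W. \<Sum>i<n. \<bar>w i\<bar>)"
  have "f x = 0" if "\<exists>i<n. N < \<bar>x i\<bar>" for x
  proof (rule ccontr)
    assume "f x \<noteq> 0"
    then obtain w where w: "w \<in> W" "\<And>i. i < n \<Longrightarrow> \<bar>x i - w i\<bar> < r" using near by blast
    from that obtain i where i: "i < n" "N < \<bar>x i\<bar>" by blast
    have "\<bar>w i\<bar> \<le> (\<Sum>i<n. \<bar>w i\<bar>)" using i by (intro member_le_sum) auto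
    also have "\<dots> \<le> (\<Sum>w\<in>W. \<Sum>i<n. \<bar>w i\<bar>)"
      using w(1) W(1) by (intro member_le_sum[of w W "\<lambda>w. \<Sum>i<n. \<bar>w i\<bar>"]) (auto intro: sum_nonneg)
    finally show False using w(2)[OF i(1)] i(2) unfolding N_def by linarith
  qed
  with D f01 f1 near W(2) show ?thesis by (intro that[of f D N]) blast+
qed

text \<open>The smooth bound is applied to cut-offs that equal 1 on Omega and live within 1/(m + 1)
  of it. As Omega is closed, they decrease in the limit to its indicator, and dominated convergence
  transfers the estimate.\<close>

theorem translation_le_perimeter:
  assumes comp: "compactin (euc_top n) \<Omega>" and fin: "finite_perimeter n \<Omega>"
  shows "(LINT x|leb n. indicator \<Omega> x * (1 - indicator \<Omega> (\<lambda>j\<in>{..<n}. x j + v j))) \<le> L2_set v {..<n} * perimeter n \<Omega>"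
proof -
  have \<Omega>: "integrable (leb n) (indicator \<Omega> :: _ \<Rightarrow> real)" using fin by (simp add: finite_perimeter_def)
  have sub: "\<Omega> \<subseteq> topspace (euc_top n)" using comp by (rule compactin_subset_topspace)
  have "\<forall>m. \<exists>f D N. C1_with n f D \<and> (\<forall>x. 0 \<le> f x \<and> f x \<le> 1) \<and> (\<forall>x\<in>\<Omega>. f x = 1) \<and>
    (\<forall>x. f x \<noteq> 0 \<longrightarrow> (\<exists>w\<in>\<Omega>. \<forall>i<n. \<bar>x i - w i\<bar> < 1 / real (Suc m))) \<and> (\<forall>x. (\<exists>i<n. N < \<bar>x i\<bar>) \<longrightarrow> f x = 0)"
  proof
    fix m
    show "\<exists>f D N. C1_with n f D \<and> (\<forall>x. 0 \<le> f x \<and> f x \<le> 1) \<and> (\<forall>x\<in>\<Omega>. f x = 1) \<and>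
      (\<forall>x. f x \<noteq> 0 \<longrightarrow> (\<exists>w\<in>\<Omega>. \<forall>i<n. \<bar>x i - w i\<bar> < 1 / real (Suc m))) \<and> (\<forall>x. (\<exists>i<n. N < \<bar>x i\<bar>) \<longrightarrow> f x = 0)"
      by (rule compactin_smooth_approximation[OF comp, of "1 / real (Suc m)"]) (simp, blast)
  qed
  then obtain f D N where C: "\<And>m. C1_with n (f m) (D m)" and f01: "\<And>m x. 0 \<le> f m x" "\<And>m x. f m x \<le> 1"
    and f1: "\<And>m x. x \<in> \<Omega> \<Longrightarrow> f m x = 1"
    and near: "\<And>m x. f m x \<noteq> 0 \<Longrightarrow> \<exists>w\<in>\<Omega>. \<forall>i<n. \<bar>x i - w i\<bar> < 1 / real (Suc m)"
    and supp: "\<And>m x. \<exists>i<n. N m < \<bar>x i\<bar> \<Longrightarrow> f m x = 0"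
    by metis
  have lim: "(\<lambda>m. f m x) \<longlonglongrightarrow> indicator \<Omega> x" if x: "x \<in> topspace (euc_top n)" for x
  proof (cases "x \<in> \<Omega>")
    case False
    \<comment> \<open>The sets of points differing from x by more than 1/(k + 1) in some coordinate
      cover Omega when x is outside it. A finite subcover keeps Omega at positive distance from x,
      so the cut-offs vanish at x from some index on.\<close>
    define V where "V k = (\<Union>i<n. {y \<in> topspace (euc_top n). y i \<in> {t. 1 / real (Suc k) < \<bar>x i - t\<bar>}})" for k :: nat
    have V_open: "open {t. 1 / real (Suc k) < \<bar>x i - t\<bar>}" for k i
      by (intro open_Collect_less continuous_intros)
    then have "openin (euc_top n) (V k)" for k
      unfolding V_def by (intro openin_Union) (use openin_euc_coord[OF _ V_open] in blast)
    moreover have "\<Omega> \<subseteq> \<Union> (range V)"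
    proof
      fix y assume y: "y \<in> \<Omega>"
      then have "y \<noteq> x" "y \<in> topspace (euc_top n)" using False sub by auto
      then obtain i where i: "i < n" "y i \<noteq> x i"
        using x PiE_ext[of y "{..<n}" "\<lambda>_. UNIV" x] unfolding euc_top_def topspace_product_topology topspace_euclidean
        by blast
      then obtain k where "1 / real (Suc k) < \<bar>x i - y i\<bar>"
        using nat_approx_posE[of "\<bar>x i - y i\<bar>"] by (auto simp: inverse_eq_divide)
      then show "y \<in> \<Union> (range V)" using i y sub by (auto simp: V_def)
    qed
    ultimately obtain F where F: "finite F" "F \<subseteq> range V" "\<Omega> \<subseteq> \<Union>F"
      using compactinD[OF comp, of "range V"] by blast
    then obtain K where K: "finite K" "F = V ` K" by (meson finite_subset_image)
    have "f m x = 0" if "m \<ge> Max (insert 0 K)" for m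
    proof (rule ccontr)
      assume "f m x \<noteq> 0"
      then obtain w where w: "w \<in> \<Omega>" "\<And>i. i < n \<Longrightarrow> \<bar>x i - w i\<bar> < 1 / real (Suc m)" using near by blast
      then obtain k i where k: "k \<in> K" "i < n" "1 / real (Suc k) < \<bar>x i - w i\<bar>"
        using F(3) K(2) by (auto simp: V_def)
      have "k \<le> m" using that K(1) k(1) by (simp add: Max_ge_iff)
      then have "1 / real (Suc m) \<le> 1 / real (Suc k)" by (simp add: frac_le)
      then show False using w(2)[OF k(2)] k(3) by linarith
    qed
    then have "\<forall>\<^sub>F m in sequentially. f m x = 0" unfolding eventually_sequentially by blast
    then show ?thesis using False by (simp add: tendsto_eventually)
  qed (use f1 in simp)
  have inv: "f m (\<lambda>j. x j + v j) = f m (\<lambda>j\<in>{..<n}. x j + v j)" for m x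
    using C unfolding C1_with_def by (metis (no_types, lifting))
  have [measurable]: "(\<lambda>x. f m x) \<in> borel_measurable (leb n)" "(\<lambda>x. f m (\<lambda>j. x j + v j)) \<in> borel_measurable (leb n)" for m
    using C[of m] C1_with_translate[OF C, of m v] unfolding C1_with_def by blast+
  from borel_measurable_integrable[OF \<Omega>] have "\<Omega> \<inter> space (leb n) \<in> sets (leb n)"
    by (simp only: borel_measurable_indicator_iff)
  moreover have "\<Omega> \<inter> space (leb n) = \<Omega>" using sub by (simp add: space_leb euc_top_def Int_absorb2)
  ultimately have [measurable]: "\<Omega> \<in> sets (leb n)" by simp
  note [measurable] = measurable_translate[where n = n and c = v]
  have "(\<lambda>m. LINT x|leb n. indicator \<Omega> x * (f m x - f m (\<lambda>j. x j + v j)))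
      \<longlonglongrightarrow> (LINT x|leb n. indicator \<Omega> x * (1 - indicator \<Omega> (\<lambda>j\<in>{..<n}. x j + v j)))"
  proof (rule integral_dominated_convergence[where w = "indicator \<Omega>"])
    show "AE x in leb n. (\<lambda>m. indicator \<Omega> x * (f m x - f m (\<lambda>j. x j + v j)))
        \<longlonglongrightarrow> indicator \<Omega> x * (1 - indicator \<Omega> (\<lambda>j\<in>{..<n}. x j + v j))"
    proof (rule AE_I2)
      fix x
      have "(\<lambda>j\<in>{..<n}. x j + v j) \<in> topspace (euc_top n)" by (simp add: euc_top_def)
      then have "(\<lambda>m. indicator \<Omega> x * (1 - f m (\<lambda>j. x j + v j))) \<longlonglongrightarrow> indicator \<Omega> x * (1 - indicator \<Omega> (\<lambda>j\<in>{..<n}. x j + v j))"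
        unfolding inv by (intro tendsto_intros lim)
      \<comment> \<open>On Omega the cut-off is exactly 1, so only its translate has to
        converge.\<close>
      moreover have "indicator \<Omega> x * (1 - f m (\<lambda>j. x j + v j)) = indicator \<Omega> x * (f m x - f m (\<lambda>j. x j + v j))" for m
        by (auto simp: indicator_def f1)
      ultimately show "(\<lambda>m. indicator \<Omega> x * (f m x - f m (\<lambda>j. x j + v j)))
        \<longlonglongrightarrow> indicator \<Omega> x * (1 - indicator \<Omega> (\<lambda>j\<in>{..<n}. x j + v j))" by simp
    qed
    show "AE x in leb n. norm (indicator \<Omega> x * (f m x - f m (\<lambda>j. x j + v j))) \<le> indicator \<Omega> x" for m
    proof (rule AE_I2)
      fix x
      have "\<bar>f m x - f m (\<lambda>j. x j + v j)\<bar> \<le> 1"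
        using f01[of m x] f01[of m "\<lambda>j. x j + v j"] by linarith
      then show "norm (indicator \<Omega> x * (f m x - f m (\<lambda>j. x j + v j))) \<le> indicator \<Omega> x"
        by (simp add: indicator_def)
    qed
  qed (use \<Omega> in auto)
  moreover have "(LINT x|leb n. indicator \<Omega> x * (f m x - f m (\<lambda>j. x j + v j))) \<le> L2_set v {..<n} * perimeter n \<Omega>" for m
    using f01 by (intro translation_smooth_le_perimeter[OF fin C _ supp]) auto
  ultimately show ?thesis by (intro LIMSEQ_le_const2) auto
qed

section \<open>Time-frequency atoms\<close>

definition tf_atom :: "nat \<Rightarrow> ((nat \<Rightarrow> real) \<Rightarrow> complex) \<Rightarrow> (nat \<Rightarrow> real) \<Rightarrow> (nat \<Rightarrow> real) \<Rightarrow> complex" where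
  "tf_atom d g z t = g (vdiff d t (tpart d z)) * cis (2 * pi * dotp d (fpart d z) t)"

lemma stft_eq_ip: "stft d g f z = ip (leb d) f (tf_atom d g z)"
  by (simp add: stft_def ip_def tf_atom_def cis_cnj mult.assoc)

lemma tf_atom_measurable[measurable (raw)]:
  assumes [measurable]: "g \<in> borel_measurable (leb d)" "a \<in> measurable N (leb (2 * d))" "b \<in> measurable N (leb d)"
  shows "(\<lambda>x. tf_atom d g (a x) (b x)) \<in> borel_measurable N"
  unfolding tf_atom_def by measurable

lemma cmod_tf_atom: "cmod (tf_atom d g z t) = cmod (g (vdiff d t (tpart d z)))"
  by (simp add: tf_atom_def norm_mult)

lemma sq_int_tf_atom:
  assumes g: "sq_int (leb d) g"
  shows "sq_int (leb d) (tf_atom d g z)" "nsq (leb d) (tf_atom d g z) = nsq (leb d) g"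
proof -
  note [measurable] = sq_int_measurable[OF g]
  have "(\<lambda>t. vdiff d t (tpart d z)) \<in> measurable (leb d) (leb d)" by measurable
  moreover have "(\<lambda>t. dotp d (fpart d z) t) \<in> borel_measurable (leb d)"
    unfolding dotp_def by (intro borel_measurable_sum borel_measurable_times measurable_leb_component) auto
  ultimately have [measurable]: "tf_atom d g z \<in> borel_measurable (leb d)"
    unfolding tf_atom_def[abs_def] by measurable
  show "sq_int (leb d) (tf_atom d g z)"
    using sq_int_vdiff(1)[OF g, of "tpart d z"] by (simp add: sq_int_def cmod_tf_atom)
  show "nsq (leb d) (tf_atom d g z) = nsq (leb d) g"
    unfolding nsq_def cmod_tf_atom using sq_int_vdiff(2)[OF g, of "tpart d z"] by (simp add: nsq_def)
qed

text \<open>Covariance: the Gram kernel of the atoms is, up to a phase, a convolution kernel.\<close>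

lemma cmod_ip_tf_atom:
  assumes g: "sq_int (leb d) g"
  shows "cmod (ip (leb d) (tf_atom d g w) (tf_atom d g z)) = cmod (stft d g g (vdiff (2 * d) z w))"
proof -
  note [measurable] = sq_int_measurable[OF g]
  let ?u = "vdiff (2 * d) z w"
  \<comment> \<open>The phase picked up when a translation is moved past a modulation. It depends on
    w and z but not on t, so it leaves the integral and disappears in the modulus.\<close>
  let ?\<theta> = "2 * pi * dotp d (vdiff d (fpart d w) (fpart d z)) (tpart d w)"
  define F where "F t = g t * cnj (tf_atom d g ?u t)" for t
  have [measurable]: "F \<in> borel_measurable (leb d)"
    unfolding F_def[abs_def] using sq_int_measurable[OF sq_int_tf_atom(1)[OF g, of ?u]] by measurable
  have eq: "tf_atom d g w t * cnj (tf_atom d g z t) = cis ?\<theta> * F (vdiff d t (tpart d w))" for t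
  proof -
    have 1: "vdiff d (vdiff d t (tpart d w)) (tpart d ?u) = vdiff d t (tpart d z)"
      by (auto simp: vdiff_def tpart_def fun_eq_iff)
    have 2: "2 * pi * dotp d (fpart d w) t - 2 * pi * dotp d (fpart d z) t
        = ?\<theta> - 2 * pi * dotp d (fpart d ?u) (vdiff d t (tpart d w))"
    proof -
      have "dotp d (fpart d w) t - dotp d (fpart d z) t
          = dotp d (vdiff d (fpart d w) (fpart d z)) (tpart d w) - dotp d (fpart d ?u) (vdiff d t (tpart d w))"
        unfolding dotp_def vdiff_def fpart_def tpart_def sum_subtractf[symmetric]
        by (rule sum.cong) (auto simp: algebra_simps)
      then have "2 * pi * (dotp d (fpart d w) t - dotp d (fpart d z) t)
          = 2 * pi * (dotp d (vdiff d (fpart d w) (fpart d z)) (tpart d w) - dotp d (fpart d ?u) (vdiff d t (tpart d w)))"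
        by (rule arg_cong)
      then show ?thesis by (simp only: right_diff_distrib)
    qed
    have "tf_atom d g w t * cnj (tf_atom d g z t)
        = g (vdiff d t (tpart d w)) * cnj (g (vdiff d t (tpart d z)))
          * cis (2 * pi * dotp d (fpart d w) t - 2 * pi * dotp d (fpart d z) t)"
      by (simp add: tf_atom_def cis_cnj cis_mult[symmetric] diff_conv_add_uminus mult_ac del: add_uminus_conv_diff)
    also have "\<dots> = g (vdiff d t (tpart d w)) * cnj (g (vdiff d t (tpart d z)))
          * (cis ?\<theta> * cis (- (2 * pi * dotp d (fpart d ?u) (vdiff d t (tpart d w)))))"
      unfolding 2 by (simp add: cis_mult)
    also have "\<dots> = cis ?\<theta> * F (vdiff d t (tpart d w))"
      unfolding F_def tf_atom_def 1 by (simp add: cis_cnj mult_ac)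
    finally show ?thesis .
  qed
  have "ip (leb d) (tf_atom d g w) (tf_atom d g z) = cis ?\<theta> * (LINT t|leb d. F (vdiff d t (tpart d w)))"
    unfolding ip_def eq by (rule integral_mult_right_zero)
  also have "(LINT t|leb d. F (vdiff d t (tpart d w))) = integral\<^sup>L (leb d) F"
    by (rule integral_vdiff(1)) measurable
  also have "integral\<^sup>L (leb d) F = stft d g g ?u"
    unfolding stft_eq_ip ip_def F_def ..
  finally show ?thesis by (simp add: norm_mult)
qed

locale tf_localization =
  fixes d :: nat and g :: "(nat \<Rightarrow> real) \<Rightarrow> complex" and \<Omega> :: "(nat \<Rightarrow> real) set"
  assumes g: "sq_int (leb d) g" and g1: "nsq (leb d) g = 1"
    and \<Omega>_sets[measurable]: "\<Omega> \<in> sets (leb (2 * d))" and \<Omega>_finite: "emeasure (leb (2 * d)) \<Omega> < \<infinity>"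
begin

abbreviation "PS \<equiv> leb (2 * d)"
abbreviation "atom \<equiv> tf_atom d g"
abbreviation "R \<equiv> restrict_space PS \<Omega>"

lemmas g_measurable[measurable] = sq_int_measurable[OF g]
lemmas atom_sq = sq_int_tf_atom(1)[OF g]
lemma atom_nsq[simp]: "nsq (leb d) (atom z) = 1" by (simp add: sq_int_tf_atom(2)[OF g] g1)

lemma \<Omega>_sub: "\<Omega> \<subseteq> space PS" using sets.sets_into_space[OF \<Omega>_sets] .

lemma space_R[simp]: "space R = \<Omega>" using \<Omega>_sub by (auto simp: space_restrict_space)

sublocale fR: finite_measure R
  by (rule finite_measureI) (use \<Omega>_finite \<Omega>_sub in \<open>auto simp: emeasure_restrict_space space_restrict_space Int_absorb2\<close>)

lemma integral_R: "(LINT z|R. f z) = (LINT z|PS. indicator \<Omega> z *\<^sub>R (f z :: 'b :: {banach, second_countable_topology}))"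
  using integral_restrict_space[of \<Omega> PS f] \<Omega>_sub by (simp add: Int_absorb1)

lemma measurable_R: "f \<in> borel_measurable PS \<Longrightarrow> f \<in> borel_measurable R"
  by (rule measurable_restrict_space1)

lemma measure_R: "measure R (space R) = measure PS \<Omega>"
  using \<Omega>_sub by (simp add: measure_restrict_space)

text \<open>The adjoint of the short-time Fourier transform, applied to v extended by zero outside
  Omega.\<close>

definition synth :: "((nat \<Rightarrow> real) \<Rightarrow> complex) \<Rightarrow> (nat \<Rightarrow> real) \<Rightarrow> complex" where
  "synth v t = (LINT z|R. v z * atom z t)"

lemma loc_op_eq_synth: "loc_op d g \<Omega> f t = synth (stft d g f) t"
  by (simp add: loc_op_def synth_def set_lebesgue_integral_def integral_R tf_atom_def mult.assoc)

lemma atom_measurable_R[measurable]: "(\<lambda>(z, t). atom z t) \<in> borel_measurable (R \<Otimes>\<^sub>M leb d)"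
proof -
  have [measurable]: "(\<lambda>p. fst p) \<in> measurable (R \<Otimes>\<^sub>M leb d) PS"
    by (rule measurable_compose[OF measurable_fst]) (auto intro: measurable_restrict_space1)
  show ?thesis unfolding case_prod_beta' by measurable
qed

text \<open>Square-integrability is Cauchy-Schwarz with respect to the density |v|, followed by
  integration in t, where every atom has norm 1. The second claim is the adjoint relation, by
  Fubini. Bounded v are enough because the eigenvectors used later are bounded.\<close>

lemma sq_int_synth:
  assumes v[measurable]: "v \<in> borel_measurable R" and bd: "\<And>z. z \<in> \<Omega> \<Longrightarrow> cmod (v z) \<le> C"
  shows "sq_int (leb d) (synth v)"
    and "sq_int (leb d) u \<Longrightarrow> ip (leb d) (synth v) u = (LINT z|R. v z * cnj (stft d g u z))"
proof -
  interpret P: pair_sigma_finite R "leb d" ..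
  have C0: "0 \<le> \<bar>C\<bar>" by simp
  have vint: "integrable R v" using bd by (intro fR.integrable_bounded) auto
  have atom_nn: "(\<integral>\<^sup>+t. ennreal ((cmod (atom z t))\<^sup>2) \<partial>leb d) = 1" for z
    using nn_integral_sq_int[OF atom_sq] by simp
  define m where "m = (\<integral>\<^sup>+z. ennreal (cmod (v z)) \<partial>R)"
  have m_fin: "m < \<infinity>" using vint unfolding m_def integrable_iff_bounded by simp
  have meas[measurable]: "synth v \<in> borel_measurable (leb d)"
    unfolding synth_def by measurable
  have pt: "ennreal ((cmod (synth v t))\<^sup>2) \<le> m * (\<integral>\<^sup>+z. ennreal (cmod (v z)) * ennreal ((cmod (atom z t))\<^sup>2) \<partial>R)"
    if [measurable]: "t \<in> space (leb d)" for t
  proof -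
    have "ennreal (cmod (synth v t)) \<le> (\<integral>\<^sup>+z. ennreal (cmod (v z * atom z t)) \<partial>R)"
      unfolding synth_def using integral_norm_bound_ennreal
      by (cases "integrable R (\<lambda>z. v z * atom z t)") (auto simp: not_integrable_integral_eq)
    \<comment> \<open>Writing |v| as sqrt |v| times sqrt |v| leaves the total mass of |v| in one
      factor and a weighted average of |atom|^2 in the other.\<close>
    also have "\<dots> = (\<integral>\<^sup>+z. ennreal (sqrt (cmod (v z))) * ennreal (sqrt (cmod (v z)) * cmod (atom z t)) \<partial>R)"
      by (intro nn_integral_cong) (simp add: ennreal_mult[symmetric] norm_mult mult.assoc[symmetric])
    finally have "(ennreal (cmod (synth v t)))\<^sup>2
        \<le> (\<integral>\<^sup>+z. ennreal (sqrt (cmod (v z))) * ennreal (sqrt (cmod (v z)) * cmod (atom z t)) \<partial>R)\<^sup>2"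
      by (intro power_mono) auto
    also have "\<dots> \<le> (\<integral>\<^sup>+z. (ennreal (sqrt (cmod (v z))))\<^sup>2 \<partial>R) * (\<integral>\<^sup>+z. (ennreal (sqrt (cmod (v z)) * cmod (atom z t)))\<^sup>2 \<partial>R)"
      by (rule Cauchy_Schwarz_nn_integral) measurable
    also have "\<dots> = m * (\<integral>\<^sup>+z. ennreal (cmod (v z)) * ennreal ((cmod (atom z t))\<^sup>2) \<partial>R)"
      unfolding m_def by (simp add: ennreal_power power_mult_distrib ennreal_mult)
    finally show ?thesis by (simp add: ennreal_power)
  qed
  have "(\<integral>\<^sup>+t. ennreal ((cmod (synth v t))\<^sup>2) \<partial>leb d)
      \<le> (\<integral>\<^sup>+t. m * (\<integral>\<^sup>+z. ennreal (cmod (v z)) * ennreal ((cmod (atom z t))\<^sup>2) \<partial>R) \<partial>leb d)"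
    by (intro nn_integral_mono pt)
  also have "\<dots> = m * (\<integral>\<^sup>+t. \<integral>\<^sup>+z. ennreal (cmod (v z)) * ennreal ((cmod (atom z t))\<^sup>2) \<partial>R \<partial>leb d)"
    by (rule nn_integral_cmult) measurable
  also have "(\<integral>\<^sup>+t. \<integral>\<^sup>+z. ennreal (cmod (v z)) * ennreal ((cmod (atom z t))\<^sup>2) \<partial>R \<partial>leb d)
      = (\<integral>\<^sup>+z. \<integral>\<^sup>+t. ennreal (cmod (v z)) * ennreal ((cmod (atom z t))\<^sup>2) \<partial>leb d \<partial>R)"
    by (rule P.Fubini') measurable
  also have "\<dots> = m"
    unfolding m_def
  proof (intro nn_integral_cong)
    fix z
    have [measurable]: "atom z \<in> borel_measurable (leb d)" using atom_sq by (rule sq_int_measurable)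
    show "(\<integral>\<^sup>+t. ennreal (cmod (v z)) * ennreal ((cmod (atom z t))\<^sup>2) \<partial>leb d) = ennreal (cmod (v z))"
      by (subst nn_integral_cmult) (auto simp: atom_nn)
  qed
  finally have fin: "(\<integral>\<^sup>+t. ennreal ((cmod (synth v t))\<^sup>2) \<partial>leb d) < \<infinity>"
    using m_fin by (auto simp: ennreal_mult_less_top intro: order_le_less_trans)
  then show "sq_int (leb d) (synth v)"
    unfolding sq_int_def by (auto intro!: integrableI_nonneg)
  assume u: "sq_int (leb d) u"
  note [measurable] = sq_int_measurable[OF u]
  have inner_bd: "(\<integral>\<^sup>+t. ennreal (cmod (atom z t) * cmod (u t)) \<partial>leb d) \<le> ennreal (sqrt (nsq (leb d) u))" for z
  proof -
    have "(\<integral>\<^sup>+t. ennreal (cmod (atom z t) * cmod (u t)) \<partial>leb d) = ennreal (LINT t|leb d. cmod (atom z t) * cmod (u t))"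
      using integrable_cmod_mult[OF atom_sq u] by (intro nn_integral_eq_integral) auto
    also have "\<dots> \<le> ennreal (sqrt (nsq (leb d) u))"
      using Cauchy_Schwarz_integral[OF atom_sq[of z] u] by (intro ennreal_leI real_le_rsqrt) simp
    finally show ?thesis .
  qed
  have int: "integrable (R \<Otimes>\<^sub>M leb d) (\<lambda>(z, t). v z * atom z t * cnj (u t))"
  proof (rule integrableI_bounded)
    have "(\<integral>\<^sup>+p. ennreal (norm (case_prod (\<lambda>z t. v z * atom z t * cnj (u t)) p)) \<partial>(R \<Otimes>\<^sub>M leb d))
        = (\<integral>\<^sup>+z. \<integral>\<^sup>+t. ennreal (cmod (v z)) * ennreal (cmod (atom z t) * cmod (u t)) \<partial>leb d \<partial>R)"
      by (subst leb.nn_integral_fst[symmetric]) (auto simp: norm_mult ennreal_mult mult.assoc)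
    also have "\<dots> \<le> (\<integral>\<^sup>+z. ennreal (cmod (v z)) * ennreal (sqrt (nsq (leb d) u)) \<partial>R)"
    proof (intro nn_integral_mono)
      fix z
      have [measurable]: "atom z \<in> borel_measurable (leb d)" using atom_sq by (rule sq_int_measurable)
      show "(\<integral>\<^sup>+t. ennreal (cmod (v z)) * ennreal (cmod (atom z t) * cmod (u t)) \<partial>leb d)
          \<le> ennreal (cmod (v z)) * ennreal (sqrt (nsq (leb d) u))"
        using inner_bd[of z] by (subst nn_integral_cmult) (auto intro: mult_left_mono)
    qed
    also have "\<dots> = m * ennreal (sqrt (nsq (leb d) u))" unfolding m_def by (rule nn_integral_multc) measurable
    also have "\<dots> < \<infinity>" using m_fin by (simp add: ennreal_mult_less_top)
    finally show "(\<integral>\<^sup>+p. ennreal (norm (case_prod (\<lambda>z t. v z * atom z t * cnj (u t)) p)) \<partial>(R \<Otimes>\<^sub>M leb d)) < \<infinity>" .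
  qed measurable
  have "ip (leb d) (synth v) u = (LINT t|leb d. LINT z|R. v z * atom z t * cnj (u t))"
    by (simp add: ip_def synth_def)
  also have "\<dots> = (LINT z|R. LINT t|leb d. v z * atom z t * cnj (u t))"
    by (rule P.Fubini_integral[OF int])
  also have "\<dots> = (LINT z|R. v z * ip (leb d) (atom z) u)"
    by (simp add: ip_def mult.assoc)
  also have "\<dots> = (LINT z|R. v z * cnj (stft d g u z))"
    by (simp add: stft_eq_ip cnj_ip)
  finally show "ip (leb d) (synth v) u = (LINT z|R. v z * cnj (stft d g u z))" .
qed

text \<open>The atoms occur in reversed order so that \<open>gram z w\<close> is the integral kernel
  of analysis after synthesis, with z as the output variable.\<close>

definition gram :: "(nat \<Rightarrow> real) \<Rightarrow> (nat \<Rightarrow> real) \<Rightarrow> complex" where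
  "gram z w = ip (leb d) (atom w) (atom z)"

lemma gram_bound: "cmod (gram z w) \<le> 1"
  unfolding gram_def
  by (rule power2_le_imp_le) (use Cauchy_Schwarz_ip[OF atom_sq[of w] atom_sq[of z]] in simp_all)

lemma gram_hermitian: "gram w z = cnj (gram z w)"
  by (simp add: gram_def cnj_ip)

lemma gram_measurable[measurable]: "case_prod gram \<in> borel_measurable (PS \<Otimes>\<^sub>M PS)"
  unfolding gram_def ip_def by measurable

lemma gram_measurable_R[measurable]: "case_prod gram \<in> borel_measurable (R \<Otimes>\<^sub>M R)"
proof -
  have "(\<lambda>p. p) \<in> measurable (R \<Otimes>\<^sub>M R) (PS \<Otimes>\<^sub>M PS)"
    by (rule measurable_pair) (auto intro!: measurable_compose[OF measurable_fst] measurable_compose[OF measurable_snd] measurable_restrict_space1 simp: comp_def)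
  from measurable_compose[OF this gram_measurable] show ?thesis by simp
qed

lemma stft_le_one:
  assumes "sq_int (leb d) f" "nsq (leb d) f = 1"
  shows "cmod (stft d g f z) \<le> 1"
  unfolding stft_eq_ip
  by (rule power2_le_imp_le) (use Cauchy_Schwarz_ip[OF assms(1) atom_sq[of z]] assms(2) in simp_all)

text \<open>The adjoint relation tested against a single atom. It is valid at every z, including
  points outside Omega.\<close>

lemma stft_synth:
  assumes "v \<in> borel_measurable R" "\<And>z. z \<in> \<Omega> \<Longrightarrow> cmod (v z) \<le> C"
  shows "stft d g (synth v) z = (LINT w|R. gram z w * v w)"
proof -
  have "stft d g (synth v) z = (LINT w|R. v w * cnj (stft d g (atom z) w))"
    unfolding stft_eq_ip[of d g "synth v"] by (rule sq_int_synth(2)[OF assms atom_sq])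
  also have "\<dots> = (LINT w|R. gram z w * v w)"
    by (simp only: stft_eq_ip cnj_ip gram_def mult.commute)
  finally show ?thesis .
qed

text \<open>The trace of \<open>H - H\<^sup>2\<close> is the mass that the convolution kernel transports out of \<open>\<Omega>\<close>.\<close>

lemma measure_minus_gram_le:
  assumes Ms: "integrable PS (\<lambda>z. L2_set z {..<2 * d} * (cmod (stft d g g z))\<^sup>2)"
    and comp: "compactin (euc_top (2 * d)) \<Omega>" and fin: "finite_perimeter (2 * d) \<Omega>"
    and per: "0 \<le> perimeter (2 * d) \<Omega>"
  shows "measure PS \<Omega> - nsq (R \<Otimes>\<^sub>M R) (case_prod gram)
    \<le> (LINT z|PS. L2_set z {..<2 * d} * (cmod (stft d g g z))\<^sup>2) * perimeter (2 * d) \<Omega>"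
proof -
  let ?G = "\<lambda>u. ennreal ((cmod (stft d g g u))\<^sup>2)"
  interpret RR: pair_sigma_finite R R ..
  interpret fRR: finite_measure "R \<Otimes>\<^sub>M R" by (rule finite_measure_pair_measure) unfold_locales
  have gram_eq: "ennreal ((cmod (gram z w))\<^sup>2) = ?G (vdiff (2 * d) z w)" for z w
    by (simp add: gram_def cmod_ip_tf_atom[OF g])
  have stft_m[measurable]: "stft d g g \<in> borel_measurable PS" by measurable
  have sq: "sq_int (R \<Otimes>\<^sub>M R) (case_prod gram)"
    using gram_bound by (intro sq_int_finite_measure[of _ _ 1] fRR.finite_measure_axioms) auto
  have gram_nn: "ennreal (nsq (R \<Otimes>\<^sub>M R) (case_prod gram))
      = (\<integral>\<^sup>+z. \<integral>\<^sup>+w. indicator \<Omega> z * (indicator \<Omega> w * ?G (vdiff (2 * d) z w)) \<partial>PS \<partial>PS)"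
  proof -
    have "ennreal (nsq (R \<Otimes>\<^sub>M R) (case_prod gram)) = (\<integral>\<^sup>+z. \<integral>\<^sup>+w. ?G (vdiff (2 * d) z w) \<partial>R \<partial>R)"
      unfolding nn_integral_sq_int[OF sq, symmetric]
      by (subst fR.nn_integral_fst[symmetric]) (auto simp: gram_eq)
    also have "\<dots> = (\<integral>\<^sup>+z. (\<integral>\<^sup>+w. ?G (vdiff (2 * d) z w) * indicator \<Omega> w \<partial>PS) * indicator \<Omega> z \<partial>PS)"
      using \<Omega>_sub by (simp add: nn_integral_restrict_space Int_absorb1)
    also have "\<dots> = (\<integral>\<^sup>+z. \<integral>\<^sup>+w. indicator \<Omega> z * (indicator \<Omega> w * ?G (vdiff (2 * d) z w)) \<partial>PS \<partial>PS)"
    proof (intro nn_integral_cong)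
      fix z assume [measurable]: "z \<in> space PS"
      show "(\<integral>\<^sup>+w. ?G (vdiff (2 * d) z w) * indicator \<Omega> w \<partial>PS) * indicator \<Omega> z
          = (\<integral>\<^sup>+w. indicator \<Omega> z * (indicator \<Omega> w * ?G (vdiff (2 * d) z w)) \<partial>PS)"
        by (subst nn_integral_cmult) (measurable, simp add: mult.commute)
    qed
    finally show ?thesis .
  qed
  \<comment> \<open>The mass that points of Omega send outside Omega under the kernel |V_g g (z -
    w)|^2.\<close>
  define out where "out = (\<integral>\<^sup>+z. \<integral>\<^sup>+w. indicator \<Omega> z * (indicator (space PS - \<Omega>) w * ?G (vdiff (2 * d) z w)) \<partial>PS \<partial>PS)"
  \<comment> \<open>By \<open>stft_norm\<close> each z distributes total mass 1 over w. What stays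
    in Omega is the squared norm of the Gram kernel, the rest is \<open>out\<close>.\<close>
  have total: "emeasure PS \<Omega> = ennreal (nsq (R \<Otimes>\<^sub>M R) (case_prod gram)) + out"
  proof -
    have "(\<integral>\<^sup>+w. ?G (vdiff (2 * d) z w) \<partial>PS) = 1" for z
      using nn_integral_vdiff(2)[of ?G "2 * d" z] stft_norm[OF g g1] by simp
    then have "emeasure PS \<Omega> = (\<integral>\<^sup>+z. indicator \<Omega> z * (\<integral>\<^sup>+w. ?G (vdiff (2 * d) z w) \<partial>PS) \<partial>PS)" by simp
    also have "\<dots> = (\<integral>\<^sup>+z. (\<integral>\<^sup>+w. indicator \<Omega> z * (indicator \<Omega> w * ?G (vdiff (2 * d) z w)) \<partial>PS)
        + (\<integral>\<^sup>+w. indicator \<Omega> z * (indicator (space PS - \<Omega>) w * ?G (vdiff (2 * d) z w)) \<partial>PS) \<partial>PS)"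
    proof (intro nn_integral_cong)
      fix z assume [measurable]: "z \<in> space PS"
      have "indicator \<Omega> z * (\<integral>\<^sup>+w. ?G (vdiff (2 * d) z w) \<partial>PS) = (\<integral>\<^sup>+w. indicator \<Omega> z * ?G (vdiff (2 * d) z w) \<partial>PS)"
        by (subst nn_integral_cmult) auto
      also have "\<dots> = (\<integral>\<^sup>+w. indicator \<Omega> z * (indicator \<Omega> w * ?G (vdiff (2 * d) z w))
          + indicator \<Omega> z * (indicator (space PS - \<Omega>) w * ?G (vdiff (2 * d) z w)) \<partial>PS)"
        by (intro nn_integral_cong) (auto simp: indicator_def)
      also have "\<dots> = (\<integral>\<^sup>+w. indicator \<Omega> z * (indicator \<Omega> w * ?G (vdiff (2 * d) z w)) \<partial>PS)
        + (\<integral>\<^sup>+w. indicator \<Omega> z * (indicator (space PS - \<Omega>) w * ?G (vdiff (2 * d) z w)) \<partial>PS)"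
        by (rule nn_integral_add) measurable
      finally show "indicator \<Omega> z * (\<integral>\<^sup>+w. ?G (vdiff (2 * d) z w) \<partial>PS)
        = (\<integral>\<^sup>+w. indicator \<Omega> z * (indicator \<Omega> w * ?G (vdiff (2 * d) z w)) \<partial>PS)
        + (\<integral>\<^sup>+w. indicator \<Omega> z * (indicator (space PS - \<Omega>) w * ?G (vdiff (2 * d) z w)) \<partial>PS)" .
    qed
    also have "\<dots> = ennreal (nsq (R \<Otimes>\<^sub>M R) (case_prod gram)) + out"
      unfolding gram_nn out_def by (rule nn_integral_add) measurable
    finally show ?thesis .
  qed
  \<comment> \<open>The substitution w = z - u exposes the weight |V_g g (u)|^2; after Fubini the
    inner integral measures the points of Omega that the shift by -u moves out of Omega.\<close>
  have "out = (\<integral>\<^sup>+z. \<integral>\<^sup>+u. indicator \<Omega> z * (indicator (space PS - \<Omega>) (vdiff (2 * d) z u) * ?G u) \<partial>PS \<partial>PS)"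
    unfolding out_def
  proof (rule nn_integral_cong)
    fix z assume z[measurable]: "z \<in> space PS"
    let ?f = "\<lambda>w. indicator \<Omega> z * (indicator (space PS - \<Omega>) w * ?G (vdiff (2 * d) z w))"
    have "(\<integral>\<^sup>+w. ?f w \<partial>PS) = (\<integral>\<^sup>+u. ?f (vdiff (2 * d) z u) \<partial>PS)"
      by (rule nn_integral_vdiff(2)[symmetric]) measurable
    also have "\<dots> = (\<integral>\<^sup>+u. indicator \<Omega> z * (indicator (space PS - \<Omega>) (vdiff (2 * d) z u) * ?G u) \<partial>PS)"
    proof (intro nn_integral_cong)
      fix u assume "u \<in> space PS"
      then have "vdiff (2 * d) z (vdiff (2 * d) z u) = u"
        by (auto simp: vdiff_def space_leb PiE_iff extensional_def fun_eq_iff)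
      then show "?f (vdiff (2 * d) z u) = indicator \<Omega> z * (indicator (space PS - \<Omega>) (vdiff (2 * d) z u) * ?G u)" by simp
    qed
    finally show "(\<integral>\<^sup>+w. ?f w \<partial>PS) = (\<integral>\<^sup>+u. indicator \<Omega> z * (indicator (space PS - \<Omega>) (vdiff (2 * d) z u) * ?G u) \<partial>PS)" .
  qed
  also have "\<dots> = (\<integral>\<^sup>+u. \<integral>\<^sup>+z. indicator \<Omega> z * (indicator (space PS - \<Omega>) (vdiff (2 * d) z u) * ?G u) \<partial>PS \<partial>PS)"
    by (rule leb2.Fubini') measurable
  also have "\<dots> \<le> (\<integral>\<^sup>+u. ennreal (L2_set u {..<2 * d} * (cmod (stft d g g u))\<^sup>2 * perimeter (2 * d) \<Omega>) \<partial>PS)"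
  proof (intro nn_integral_mono)
    fix u assume u[measurable]: "u \<in> space PS"
    let ?h = "\<lambda>z. indicator \<Omega> z * (1 - indicator \<Omega> (\<lambda>j\<in>{..<2 * d}. z j + - u j)) :: real"
    have vd: "(\<lambda>j\<in>{..<2 * d}. z j + - u j) = vdiff (2 * d) z u" for z by (simp add: vdiff_def)
    have hm[measurable]: "?h \<in> borel_measurable PS" unfolding vd by measurable
    have hi: "integrable PS ?h"
    proof (rule Bochner_Integration.integrable_bound)
      show "integrable PS (indicator \<Omega> :: _ \<Rightarrow> real)" using \<Omega>_finite by simp
      show "AE z in PS. norm (?h z) \<le> norm (indicator \<Omega> z :: real)" by (intro AE_I2) (auto simp: indicator_def)
    qed (rule hm)
    have "(\<integral>\<^sup>+z. indicator \<Omega> z * (indicator (space PS - \<Omega>) (vdiff (2 * d) z u) * ?G u) \<partial>PS)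
        = (\<integral>\<^sup>+z. ennreal (?h z) * ?G u \<partial>PS)"
      unfolding vd by (intro nn_integral_cong) (auto simp: indicator_def)
    also have "\<dots> = (\<integral>\<^sup>+z. ennreal (?h z) \<partial>PS) * ?G u" by (rule nn_integral_multc) measurable
    also have "(\<integral>\<^sup>+z. ennreal (?h z) \<partial>PS) = ennreal (LINT z|PS. ?h z)"
      using hi by (intro nn_integral_eq_integral) (auto simp: indicator_def)
    also have "\<dots> * ?G u \<le> ennreal (L2_set u {..<2 * d} * perimeter (2 * d) \<Omega>) * ?G u"
    proof (intro mult_right_mono ennreal_leI)
      have "L2_set (\<lambda>j. - u j) {..<2 * d} = L2_set u {..<2 * d}" by (simp add: L2_set_def)
      then show "(LINT z|PS. ?h z) \<le> L2_set u {..<2 * d} * perimeter (2 * d) \<Omega>"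
        using translation_le_perimeter[OF comp fin, of "\<lambda>j. - u j"] by simp
    qed simp
    also have "\<dots> = ennreal (L2_set u {..<2 * d} * (cmod (stft d g g u))\<^sup>2 * perimeter (2 * d) \<Omega>)"
      using per by (simp add: ennreal_mult[symmetric] mult_ac)
    finally show "(\<integral>\<^sup>+z. indicator \<Omega> z * (indicator (space PS - \<Omega>) (vdiff (2 * d) z u) * ?G u) \<partial>PS)
        \<le> ennreal (L2_set u {..<2 * d} * (cmod (stft d g g u))\<^sup>2 * perimeter (2 * d) \<Omega>)" .
  qed
  also have "\<dots> = ennreal (LINT u|PS. L2_set u {..<2 * d} * (cmod (stft d g g u))\<^sup>2 * perimeter (2 * d) \<Omega>)"
    using Ms per by (intro nn_integral_eq_integral) auto
  also have "(LINT u|PS. L2_set u {..<2 * d} * (cmod (stft d g g u))\<^sup>2 * perimeter (2 * d) \<Omega>)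
      = (LINT z|PS. L2_set z {..<2 * d} * (cmod (stft d g g z))\<^sup>2) * perimeter (2 * d) \<Omega>"
    by (rule integral_mult_left_zero)
  finally have out_le: "out \<le> ennreal ((LINT z|PS. L2_set z {..<2 * d} * (cmod (stft d g g z))\<^sup>2) * perimeter (2 * d) \<Omega>)" .
  have P0: "0 \<le> (LINT z|PS. L2_set z {..<2 * d} * (cmod (stft d g g z))\<^sup>2) * perimeter (2 * d) \<Omega>"
    using per by (intro mult_nonneg_nonneg integral_nonneg_AE) auto
  have "ennreal (measure PS \<Omega>) \<le> ennreal (nsq (R \<Otimes>\<^sub>M R) (case_prod gram)
      + (LINT z|PS. L2_set z {..<2 * d} * (cmod (stft d g g z))\<^sup>2) * perimeter (2 * d) \<Omega>)"
    using total out_le \<Omega>_finite P0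
    by (simp add: emeasure_eq_ennreal_measure[symmetric] less_top[symmetric] ennreal_plus add_left_mono)
  then show ?thesis using P0 by (subst (asm) ennreal_le_iff) auto
qed

end

section \<open>Spectral estimates\<close>

locale tf_eigensystem = tf_localization +
  fixes N :: enat and ev :: "nat \<Rightarrow> real" and h :: "nat \<Rightarrow> (nat \<Rightarrow> real) \<Rightarrow> complex"
  assumes eig: "eigensystem d g \<Omega> N ev h"
begin

abbreviation "J \<equiv> eig_index N"
abbreviation "\<phi> k \<equiv> stft d g (h k)"

lemma h_sq: "k \<in> J \<Longrightarrow> sq_int (leb d) (h k)"
  using eig by (auto simp: eigensystem_def L2_def sq_int_def)

lemma eigenfunction_expansion:
  assumes "(\<mu>::complex) \<noteq> 0" "f \<in> L2 d" "AE t in leb d. loc_op d g \<Omega> f t = \<mu> * f t"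
  shows "\<exists>c. AE t in leb d. f t = (\<Sum>k\<in>{k \<in> J. complex_of_real (ev k) = \<mu>}. c k * h k t)"
proof -
  have "\<forall>\<mu>::complex. \<mu> \<noteq> 0 \<longrightarrow> finite {k \<in> J. complex_of_real (ev k) = \<mu>} \<and>
      (\<forall>f\<in>L2 d. (AE t in leb d. loc_op d g \<Omega> f t = \<mu> * f t) \<longrightarrow>
        (\<exists>c. AE t in leb d. f t = (\<Sum>k\<in>{k \<in> J. complex_of_real (ev k) = \<mu>}. c k * h k t)))"
    using eig unfolding eigensystem_def by (elim conjE)
  from this[rule_format, OF assms(1)] assms(2,3) show ?thesis by blast
qed

lemma h_orthonormal: "j \<in> J \<Longrightarrow> k \<in> J \<Longrightarrow> ip (leb d) (h j) (h k) = (if j = k then 1 else 0)"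
  using eig by (auto simp: eigensystem_def l2inner_def ip_def)

lemma h_nsq: "k \<in> J \<Longrightarrow> nsq (leb d) (h k) = 1"
  using h_orthonormal[of k k] by (simp add: ip_self)

lemma \<phi>_bound: "k \<in> J \<Longrightarrow> cmod (\<phi> k z) \<le> 1"
  by (rule stft_le_one[OF h_sq h_nsq])

lemma \<phi>_measurable: "k \<in> J \<Longrightarrow> \<phi> k \<in> borel_measurable PS"
  by (rule stft_measurable[OF sq_int_measurable[OF h_sq] g_measurable])

lemmas \<phi>_measurable_R = measurable_R[OF \<phi>_measurable]

lemma \<phi>_sq: "k \<in> J \<Longrightarrow> sq_int R (\<phi> k)"
  using \<phi>_bound by (intro sq_int_finite_measure[of _ _ 1] fR.finite_measure_axioms \<phi>_measurable_R) auto

text \<open>The eigenvalue equation is assumed only almost everywhere, so it is used only inside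
  inner products. Pairing with an atom still yields information at each single phase-space
  point.\<close>

lemma ip_synth_\<phi>:
  assumes k: "k \<in> J" and u: "sq_int (leb d) u"
  shows "ip (leb d) (synth (\<phi> k)) u = of_real (ev k) * ip (leb d) (h k) u"
proof -
  have "AE t in leb d. synth (\<phi> k) t = of_real (ev k) * h k t"
    using eig k by (auto simp: eigensystem_def loc_op_eq_synth)
  moreover have "sq_int (leb d) (synth (\<phi> k))"
    using \<phi>_bound[OF k] by (intro sq_int_synth(1) \<phi>_measurable_R k)
  ultimately have "ip (leb d) (synth (\<phi> k)) u = ip (leb d) (\<lambda>t. of_real (ev k) * h k t) u"
    using u h_sq[OF k] by (intro ip_cong_AE sq_int_cmult) auto
  then show ?thesis by (simp add: ip_cmult_left)
qed

text \<open>The inner product over Omega of two transforms is <H h_j, h_k>, so orthogonality of the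
  h_k passes to the transforms, with squared norm equal to the eigenvalue.\<close>

lemma ip_\<phi>: "j \<in> J \<Longrightarrow> k \<in> J \<Longrightarrow> ip R (\<phi> j) (\<phi> k) = (if j = k then of_real (ev j) else 0)"
  using sq_int_synth(2)[OF \<phi>_measurable_R \<phi>_bound h_sq, of j k] ip_synth_\<phi>[OF _ h_sq, of j k] h_orthonormal[of j k]
  by (simp add: ip_def)

lemma gram_\<phi>:
  assumes k: "k \<in> J"
  shows "(LINT w|R. gram z w * \<phi> k w) = of_real (ev k) * \<phi> k z"
proof -
  have "(LINT w|R. gram z w * \<phi> k w) = stft d g (synth (\<phi> k)) z"
    by (rule stft_synth[symmetric, OF \<phi>_measurable_R[OF k] \<phi>_bound[OF k]])
  also have "\<dots> = ip (leb d) (synth (\<phi> k)) (atom z)" by (rule stft_eq_ip)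
  also have "\<dots> = of_real (ev k) * ip (leb d) (h k) (atom z)" by (rule ip_synth_\<phi>[OF k atom_sq])
  also have "\<dots> = of_real (ev k) * \<phi> k z" by (simp only: stft_eq_ip)
  finally show ?thesis .
qed

text \<open>Up to conjugation the values at z are the coefficients of the unit vector
  \<open>atom z\<close> in the orthonormal family h_k.\<close>

lemma \<phi>_Bessel: "finite F \<Longrightarrow> F \<subseteq> J \<Longrightarrow> (\<Sum>k\<in>F. (cmod (\<phi> k z))\<^sup>2) \<le> 1"
proof -
  assume F: "finite F" "F \<subseteq> J"
  have "(\<Sum>k\<in>F. (cmod (ip (leb d) (atom z) (h k)))\<^sup>2) \<le> nsq (leb d) (atom z)"
    by (rule Bessel_inequality[OF F(1) atom_sq]) (use F(2) h_orthonormal h_sq in \<open>auto simp: subset_iff\<close>)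
  moreover have "cmod (ip (leb d) (atom z) (h k)) = cmod (\<phi> k z)" for k
    unfolding stft_eq_ip cnj_ip[of "leb d" "h k" "atom z", symmetric] by simp
  ultimately show ?thesis by simp
qed

lemma ev_eq: "k \<in> J \<Longrightarrow> ev k = nsq R (\<phi> k)"
  using ip_\<phi>[of k k] unfolding ip_self by simp

lemma ev_pos: "k \<in> J \<Longrightarrow> 0 < ev k"
  using eig ev_eq[of k] nsq_nonneg[of R "\<phi> k"] by (auto simp: eigensystem_def order_less_le)

lemma ev_antimono: "j \<in> J \<Longrightarrow> k \<in> J \<Longrightarrow> j \<le> k \<Longrightarrow> ev k \<le> ev j"
  using eig by (auto simp: eigensystem_def)

lemma \<phi>_integrable: "k \<in> J \<Longrightarrow> integrable PS (\<lambda>z. (cmod (\<phi> k z))\<^sup>2)"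
  and \<phi>_norm_le: "k \<in> J \<Longrightarrow> (LINT z|PS. (cmod (\<phi> k z))\<^sup>2) \<le> 1"
proof -
  assume k: "k \<in> J"
  note [measurable] = \<phi>_measurable[OF k]
  have le: "(\<integral>\<^sup>+z. ennreal ((cmod (\<phi> k z))\<^sup>2) \<partial>PS) \<le> 1"
    using stft_norm_le[OF h_sq[OF k] g] by (simp add: h_nsq[OF k] g1)
  then show int: "integrable PS (\<lambda>z. (cmod (\<phi> k z))\<^sup>2)"
    by (intro integrableI_nonneg) (auto intro: order_le_less_trans)
  have "ennreal (LINT z|PS. (cmod (\<phi> k z))\<^sup>2) \<le> 1"
    using le int by (subst (asm) nn_integral_eq_integral) auto
  then show "(LINT z|PS. (cmod (\<phi> k z))\<^sup>2) \<le> 1" by simp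
qed

lemma ev_le_one: "k \<in> J \<Longrightarrow> ev k \<le> 1"
proof -
  assume k: "k \<in> J"
  have "ev k = (LINT z|PS. indicator \<Omega> z * (cmod (\<phi> k z))\<^sup>2)"
    by (simp add: ev_eq[OF k] nsq_def integral_R)
  also have "\<dots> \<le> (LINT z|PS. (cmod (\<phi> k z))\<^sup>2)"
    using \<phi>_integrable[OF k] by (intro integral_mono') (auto simp: indicator_def)
  finally show ?thesis using \<phi>_norm_le[OF k] by linarith
qed

lemma sum_ev_le:
  assumes F: "finite F" "F \<subseteq> J"
  shows "(\<Sum>k\<in>F. ev k) \<le> measure PS \<Omega>"
proof -
  have "(\<Sum>k\<in>F. ev k) = (LINT z|R. (\<Sum>k\<in>F. (cmod (\<phi> k z))\<^sup>2))"
    using F \<phi>_sq by (subst Bochner_Integration.integral_sum) (auto simp: ev_eq nsq_def sq_int_def subset_iff)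
  also have "\<dots> \<le> (LINT z|R. 1)"
    using \<phi>_Bessel[OF F] by (intro integral_mono') auto
  also have "\<dots> = measure PS \<Omega>" using measure_R by simp
  finally show ?thesis .
qed

text \<open>The factors are not normalized: their squared norm on Omega is the eigenvalue, so the
  product already carries it. Setting the term to 0 outside the index set lets finite and infinite
  systems share one series.\<close>

definition rank_one :: "nat \<Rightarrow> (nat \<Rightarrow> real) \<Rightarrow> (nat \<Rightarrow> real) \<Rightarrow> complex" where
  "rank_one n z w = (if n \<in> J then \<phi> n z * cnj (\<phi> n w) else 0)"

definition spectral_sum :: "(nat \<Rightarrow> real) \<Rightarrow> (nat \<Rightarrow> real) \<Rightarrow> complex" where
  "spectral_sum z w = (\<Sum>n. rank_one n z w)"

definition remainder :: "(nat \<Rightarrow> real) \<Rightarrow> (nat \<Rightarrow> real) \<Rightarrow> complex" where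
  "remainder z w = gram z w - spectral_sum z w"

text \<open>The arithmetic-geometric inequality separates z from w, and the Bessel bound applies to
  each. The series therefore converges absolutely at every pair of points, with partial sums bounded
  by 1.\<close>

lemma partial_norm_le: "(\<Sum>n<m. cmod (rank_one n z w)) \<le> 1"
proof -
  let ?F = "{..<m} \<inter> J"
  have "(\<Sum>n<m. cmod (rank_one n z w)) = (\<Sum>n\<in>?F. cmod (\<phi> n z) * cmod (\<phi> n w))"
    unfolding sum.inter_restrict[OF finite_lessThan] by (rule sum.cong) (auto simp: rank_one_def norm_mult)
  also have "\<dots> \<le> (\<Sum>n\<in>?F. ((cmod (\<phi> n z))\<^sup>2 + (cmod (\<phi> n w))\<^sup>2) / 2)"
  proof (rule sum_mono)
    fix n
    show "cmod (\<phi> n z) * cmod (\<phi> n w) \<le> ((cmod (\<phi> n z))\<^sup>2 + (cmod (\<phi> n w))\<^sup>2) / 2"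
      by (rule mult_le_half_squares)
  qed
  also have "\<dots> = ((\<Sum>n\<in>?F. (cmod (\<phi> n z))\<^sup>2) + (\<Sum>n\<in>?F. (cmod (\<phi> n w))\<^sup>2)) / 2"
    by (simp add: sum_divide_distrib[symmetric] sum.distrib)
  also have "\<dots> \<le> 1" using \<phi>_Bessel[of ?F z] \<phi>_Bessel[of ?F w] by simp
  finally show ?thesis .
qed

lemma partial_bound: "cmod (\<Sum>n<m. rank_one n z w) \<le> 1"
  using norm_sum[of "\<lambda>n. rank_one n z w" "{..<m}"] partial_norm_le[of z w m] by linarith

lemma spectral_sum_tendsto: "(\<lambda>m. \<Sum>n<m. rank_one n z w) \<longlonglongrightarrow> spectral_sum z w"
proof -
  have "summable (\<lambda>n. cmod (rank_one n z w))"
    using partial_norm_le by (intro summableI_nonneg_bounded[where x = 1]) auto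
  then have "summable (\<lambda>n. rank_one n z w)" by (rule summable_norm_cancel)
  then show ?thesis unfolding spectral_sum_def by (rule summable_LIMSEQ)
qed

lemma spectral_sum_bound: "cmod (spectral_sum z w) \<le> 1"
  by (rule LIMSEQ_le_const2[OF tendsto_norm[OF spectral_sum_tendsto]]) (use partial_bound in blast)

lemma spectral_sum_hermitian: "spectral_sum w z = cnj (spectral_sum z w)"
proof (rule LIMSEQ_unique[OF spectral_sum_tendsto])
  have "(\<lambda>m. cnj (\<Sum>n<m. rank_one n z w)) \<longlonglongrightarrow> cnj (spectral_sum z w)"
    by (intro tendsto_cnj spectral_sum_tendsto)
  moreover have "cnj (\<Sum>n<m. rank_one n z w) = (\<Sum>n<m. rank_one n w z)" for m
    unfolding cnj_sum by (rule sum.cong) (auto simp: rank_one_def)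
  ultimately show "(\<lambda>m. \<Sum>n<m. rank_one n w z) \<longlonglongrightarrow> cnj (spectral_sum z w)" by simp
qed

lemma rank_one_measurable[measurable]: "case_prod (rank_one n) \<in> borel_measurable (R \<Otimes>\<^sub>M R)"
proof (cases "n \<in> J")
  case True
  note [measurable] = \<phi>_measurable_R[OF True]
  show ?thesis using True unfolding rank_one_def by measurable
qed (simp add: rank_one_def case_prod_beta')

lemma spectral_sum_measurable[measurable]: "case_prod spectral_sum \<in> borel_measurable (R \<Otimes>\<^sub>M R)"
proof -
  have "(\<lambda>p. \<Sum>n. rank_one n (fst p) (snd p)) \<in> borel_measurable (R \<Otimes>\<^sub>M R)"
    by (rule borel_measurable_suminf) (use rank_one_measurable in \<open>simp add: case_prod_beta'\<close>)
  then show ?thesis by (simp add: spectral_sum_def case_prod_beta')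
qed

text \<open>The bound 2 adds the bounds 1 for the Gram kernel and for the spectral sum. From here on
  \<open>opr\<close> is the integral operator of the remainder.\<close>

sublocale bounded_hermitian_kernel R remainder 2
proof
  show "case_prod remainder \<in> borel_measurable (R \<Otimes>\<^sub>M R)"
    unfolding remainder_def by measurable
  show "cmod (remainder z w) \<le> 2" for z w
    unfolding remainder_def using norm_triangle_ineq4[of "gram z w" "spectral_sum z w"] gram_bound[of z w] spectral_sum_bound[of z w]
    by linarith
  show "remainder w z = cnj (remainder z w)" for z w
    by (simp only: remainder_def complex_cnj_diff gram_hermitian[of w z] spectral_sum_hermitian[of w z])
qed

text \<open>Partial sums of modulus at most 1 and a bounded v allow dominated convergence, so
  integration against v may be done term by term.\<close>

lemma integral_spectral_sum:
  assumes v: "bounded_measurable v" and z[measurable]: "z \<in> \<Omega>"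
  shows "(\<lambda>m. \<Sum>n<m. if n \<in> J then \<phi> n z * ip R v (\<phi> n) else 0) \<longlonglongrightarrow> (LINT w|R. spectral_sum z w * v w)"
proof -
  note [measurable] = bounded_measurableD[OF v]
  have [measurable]: "z \<in> space R" using z by simp
  obtain C where C: "0 \<le> C" "\<And>x. x \<in> \<Omega> \<Longrightarrow> cmod (v x) \<le> C"
    using v by (auto simp: bounded_measurable_def)
  have int: "integrable R (\<lambda>w. rank_one n z w * v w)" for n
  proof (rule fR.integrable_bounded[of _ C])
    fix w assume "w \<in> space R"
    have "cmod (rank_one n z w) \<le> 1"
      using \<phi>_bound[of n z] \<phi>_bound[of n w] by (auto simp: rank_one_def norm_mult intro: mult_le_one)
    then show "cmod (rank_one n z w * v w) \<le> C"
      using C \<open>w \<in> space R\<close> mult_mono[of "cmod (rank_one n z w)" 1 "cmod (v w)" C] by (simp add: norm_mult)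
  qed measurable
  have "(\<lambda>m. LINT w|R. (\<Sum>n<m. rank_one n z w) * v w) \<longlonglongrightarrow> (LINT w|R. spectral_sum z w * v w)"
  proof (rule integral_dominated_convergence[where w = "\<lambda>_. C"])
    show "AE w in R. (\<lambda>m. (\<Sum>n<m. rank_one n z w) * v w) \<longlonglongrightarrow> spectral_sum z w * v w"
      by (intro AE_I2 tendsto_mult spectral_sum_tendsto tendsto_const)
    show "AE w in R. norm ((\<Sum>n<m. rank_one n z w) * v w) \<le> C" for m
    proof (rule AE_I2)
      fix w assume "w \<in> space R"
      then show "norm ((\<Sum>n<m. rank_one n z w) * v w) \<le> C"
        using C partial_bound[of z w m] mult_mono[of "cmod (\<Sum>n<m. rank_one n z w)" 1 "cmod (v w)" C]
        by (simp add: norm_mult)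
    qed
  qed (simp_all, measurable)
  moreover have "(LINT w|R. (\<Sum>n<m. rank_one n z w) * v w) = (\<Sum>n<m. if n \<in> J then \<phi> n z * ip R v (\<phi> n) else 0)" for m
  proof -
    have "(LINT w|R. (\<Sum>n<m. rank_one n z w) * v w) = (\<Sum>n<m. LINT w|R. rank_one n z w * v w)"
      unfolding sum_distrib_right by (rule Bochner_Integration.integral_sum) (rule int)
    also have "\<dots> = (\<Sum>n<m. if n \<in> J then \<phi> n z * ip R v (\<phi> n) else 0)"
    proof (rule sum.cong[OF refl])
      fix n
      show "(LINT w|R. rank_one n z w * v w) = (if n \<in> J then \<phi> n z * ip R v (\<phi> n) else 0)"
      proof (cases "n \<in> J")
        case True
        then have "(LINT w|R. rank_one n z w * v w) = (LINT w|R. \<phi> n z * (v w * cnj (\<phi> n w)))"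
          by (simp add: rank_one_def mult.assoc mult.commute[of "v _"])
        also have "\<dots> = \<phi> n z * ip R v (\<phi> n)" unfolding ip_def by (rule integral_mult_right_zero)
        finally show ?thesis using True by simp
      qed (simp add: rank_one_def)
    qed
    finally show ?thesis .
  qed
  ultimately show ?thesis by simp
qed

lemma opr_eq:
  assumes v: "bounded_measurable v" and z: "z \<in> \<Omega>"
  shows "opr v z = (LINT w|R. gram z w * v w) - (LINT w|R. spectral_sum z w * v w)"
proof -
  note [measurable] = bounded_measurableD[OF v]
  have [measurable]: "z \<in> space R" using z by simp
  obtain C where C: "0 \<le> C" "\<And>x. x \<in> \<Omega> \<Longrightarrow> cmod (v x) \<le> C"
    using v by (auto simp: bounded_measurable_def)
  have int: "integrable R (\<lambda>w. a w * v w)" if [measurable]: "a \<in> borel_measurable R" and "\<And>w. cmod (a w) \<le> 1" for a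
  proof (rule fR.integrable_bounded[of _ C])
    fix w assume "w \<in> space R"
    then show "cmod (a w * v w) \<le> C"
      using C that(2)[of w] mult_mono[of "cmod (a w)" 1 "cmod (v w)" C] by (simp add: norm_mult)
  qed measurable
  have "integrable R (\<lambda>w. gram z w * v w)" by (rule int) (measurable, rule gram_bound)
  moreover have "integrable R (\<lambda>w. spectral_sum z w * v w)" by (rule int) (measurable, rule spectral_sum_bound)
  ultimately show ?thesis by (simp add: opr_def remainder_def left_diff_distrib)
qed

lemma bounded_measurable_\<phi>: "k \<in> J \<Longrightarrow> bounded_measurable (\<phi> k)"
  unfolding bounded_measurable_def using \<phi>_bound \<phi>_measurable_R by (auto intro!: exI[of _ 1])

text \<open>The Gram kernel and the spectral sum both send this function to its multiple by the
  eigenvalue. By orthogonality the partial sums of the latter are constant once m exceeds k.\<close>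

lemma opr_\<phi>:
  assumes k: "k \<in> J" and z: "z \<in> \<Omega>"
  shows "opr (\<phi> k) z = 0"
proof -
  have "(\<Sum>n<m. if n \<in> J then \<phi> n z * ip R (\<phi> k) (\<phi> n) else 0) = of_real (ev k) * \<phi> k z" if "k < m" for m
  proof -
    have "(\<Sum>n<m. if n \<in> J then \<phi> n z * ip R (\<phi> k) (\<phi> n) else 0) = (\<Sum>n<m. if n = k then of_real (ev k) * \<phi> k z else 0)"
      using k by (intro sum.cong) (auto simp: ip_\<phi>)
    then show ?thesis using that by simp
  qed
  then have "\<forall>\<^sub>F m in sequentially. (\<Sum>n<m. if n \<in> J then \<phi> n z * ip R (\<phi> k) (\<phi> n) else 0) = of_real (ev k) * \<phi> k z"
    by (rule eventually_mono[OF eventually_gt_at_top[of k]])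
  then have "(\<lambda>m. \<Sum>n<m. if n \<in> J then \<phi> n z * ip R (\<phi> k) (\<phi> n) else 0) \<longlonglongrightarrow> of_real (ev k) * \<phi> k z"
    by (rule tendsto_eventually)
  from LIMSEQ_unique[OF integral_spectral_sum[OF bounded_measurable_\<phi>[OF k] z] this]
  show ?thesis unfolding opr_eq[OF bounded_measurable_\<phi>[OF k] z] gram_\<phi>[OF k] by simp
qed

text \<open>A nonzero remainder would have an eigenvector \<open>v\<close>; it is orthogonal to every \<open>\<phi> k\<close>, so
  \<open>synth v\<close> would be an eigenfunction of the localization operator orthogonal to every \<open>h k\<close>.\<close>

lemma remainder_zero: "AE p in R \<Otimes>\<^sub>M R. case_prod remainder p = 0"
proof (rule ccontr)
  assume "\<not> (AE p in R \<Otimes>\<^sub>M R. case_prod remainder p = 0)"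
  then obtain \<mu> :: real and v where \<mu>: "\<mu> \<noteq> 0" and v: "bounded_measurable v" and nz: "\<not> (AE z in R. v z = 0)"
    and ev: "\<And>z. z \<in> space R \<Longrightarrow> opr v z = of_real \<mu> * v z"
    using eigenvector_exists by blast
  note vm = bounded_measurableD[OF v]
  obtain C where C: "0 \<le> C" "\<And>x. x \<in> \<Omega> \<Longrightarrow> cmod (v x) \<le> C"
    using v by (auto simp: bounded_measurable_def)
  \<comment> \<open>The remainder is self-adjoint and annihilates each \<open>\<phi> k\<close>, so
    \<open>\<mu>\<close> <v, \<open>\<phi> k\<close>> = <v, 0>, and \<open>\<mu>\<close> is
    non-zero.\<close>
  have orth: "ip R v (\<phi> k) = 0" if k: "k \<in> J" for k
  proof -
    have "of_real \<mu> * ip R v (\<phi> k) = ip R (opr v) (\<phi> k)"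
      unfolding ip_cmult_left[symmetric] unfolding ip_def by (intro Bochner_Integration.integral_cong) (simp_all add: ev)
    also have "\<dots> = ip R v (opr (\<phi> k))" by (rule opr_selfadjoint[OF v bounded_measurable_\<phi>[OF k]])
    also have "\<dots> = (LINT z|R. 0)"
      unfolding ip_def by (intro Bochner_Integration.integral_cong) (simp_all add: opr_\<phi>[OF k])
    finally show ?thesis using \<mu> by simp
  qed
  \<comment> \<open>By orthogonality the spectral sum contributes nothing on v, so v is an
    eigenvector of the Gram kernel itself.\<close>
  have gram_v: "(LINT w|R. gram z w * v w) = of_real \<mu> * v z" if z: "z \<in> \<Omega>" for z
  proof -
    have "(\<lambda>m. \<Sum>n<m. if n \<in> J then \<phi> n z * ip R v (\<phi> n) else 0) = (\<lambda>m. 0)"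
      by (auto simp: orth intro!: sum.neutral)
    then have "(LINT w|R. spectral_sum z w * v w) = 0"
      using integral_spectral_sum[OF v z] by (simp add: LIMSEQ_const_iff)
    then show ?thesis using ev[of z] opr_eq[OF v z] z by simp
  qed
  define f where "f = synth v"
  have f: "sq_int (leb d) f" unfolding f_def by (rule sq_int_synth(1)[OF vm C(2)])
  have stft_f: "stft d g f z = of_real \<mu> * v z" if "z \<in> \<Omega>" for z
    unfolding f_def using stft_synth[of v C z] vm C(2) gram_v[OF that] by simp
  have "loc_op d g \<Omega> f t = of_real \<mu> * f t" for t
  proof -
    have "loc_op d g \<Omega> f t = (LINT z|R. of_real \<mu> * (v z * atom z t))"
      unfolding loc_op_eq_synth synth_def by (intro Bochner_Integration.integral_cong) (simp_all add: stft_f mult.assoc)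
    also have "\<dots> = of_real \<mu> * f t" unfolding f_def synth_def by (rule integral_mult_right_zero)
    finally show ?thesis .
  qed
  then have "AE t in leb d. loc_op d g \<Omega> f t = of_real \<mu> * f t" by simp
  moreover have "f \<in> L2 d" using f by (simp add: L2_def sq_int_def)
  ultimately obtain c where
    c: "AE t in leb d. f t = (\<Sum>k\<in>{k \<in> J. complex_of_real (ev k) = complex_of_real \<mu>}. c k * h k t)"
    using eigenfunction_expansion[of "of_real \<mu>" f] \<mu> by auto
  let ?E = "{k \<in> J. complex_of_real (ev k) = complex_of_real \<mu>}"
  have fh: "ip (leb d) f (h k) = 0" if "k \<in> J" for k
    using sq_int_synth(2)[OF vm C(2) h_sq[OF that]] orth[OF that] by (simp add: f_def ip_def)
  have sqS: "sq_int (leb d) (\<lambda>t. \<Sum>k\<in>?E. c k * h k t)"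
    by (intro sq_int_sum sq_int_cmult) (auto intro: h_sq)
  \<comment> \<open>f is a combination of the h_k by hypothesis and orthogonal to each of them, so
    it is null. Its transform is \<open>\<mu>\<close> v on Omega, hence v vanishes as well.\<close>
  have "ip (leb d) f f = ip (leb d) f (\<lambda>t. \<Sum>k\<in>?E. c k * h k t)"
    using c f sqS by (intro ip_cong_AE) auto
  also have "\<dots> = (\<Sum>k\<in>?E. ip (leb d) f (\<lambda>t. c k * h k t))"
    using f by (intro ip_sum_right) (auto intro: sq_int_cmult h_sq)
  also have "\<dots> = 0"
  proof (rule sum.neutral, intro ballI)
    fix k assume "k \<in> ?E"
    then have "ip (leb d) (\<lambda>t. c k * h k t) f = 0"
      unfolding ip_cmult_left using fh[of k] cnj_ip[of "leb d" f "h k"] by simp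
    then show "ip (leb d) f (\<lambda>t. c k * h k t) = 0"
      using cnj_ip[of "leb d" "\<lambda>t. c k * h k t" f] by simp
  qed
  finally have "nsq (leb d) f = 0" by (simp add: ip_self)
  then have "stft d g f z = 0" for z
    unfolding stft_eq_ip using Cauchy_Schwarz_ip[OF f atom_sq[of z]] by simp
  then have "v z = 0" if "z \<in> \<Omega>" for z using stft_f[OF that] \<mu> by simp
  then have "AE z in R. v z = 0" by (intro AE_I2) simp
  with nz show False by simp
qed

text \<open>The products \<open>e k\<close> are orthogonal with squared norm \<open>ev k\<close>
  squared, and the inner product of the Gram kernel with \<open>e k\<close> is that same number, so
  all expansion coefficients are 1. The defect of the partial sums tends to the squared norm of the
  remainder, which is 0.\<close>

lemma sum_ev_squares:
  "(\<lambda>m. \<Sum>k\<in>{..<m} \<inter> J. (ev k)\<^sup>2) \<longlonglongrightarrow> nsq (R \<Otimes>\<^sub>M R) (case_prod gram)"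
proof -
  let ?P = "R \<Otimes>\<^sub>M R"
  define e where "e k p = \<phi> k (fst p) * cnj (\<phi> k (snd p))" for k p
  have e_meas: "e k \<in> borel_measurable ?P" if "k \<in> J" for k
  proof -
    note [measurable] = \<phi>_measurable_R[OF that]
    show ?thesis unfolding e_def[abs_def] by measurable
  qed
  have e_bd: "cmod (e k p) \<le> 1" if "k \<in> J" for k p
    using \<phi>_bound[OF that] by (auto simp: e_def norm_mult intro: mult_le_one)
  have e_sq: "sq_int ?P (e k)" if "k \<in> J" for k
    using e_bd[OF that] by (intro sq_int_finite_measure[of _ _ 1] PF.finite_measure_axioms e_meas that) auto
  have gram_sq: "sq_int ?P (case_prod gram)"
    using gram_bound by (intro sq_int_finite_measure[of _ _ 1] PF.finite_measure_axioms) auto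
  have ee: "ip ?P (e j) (e k) = (if j = k then of_real ((ev j)\<^sup>2) else 0)" if jk: "j \<in> J" "k \<in> J" for j k
  proof -
    note [measurable] = \<phi>_measurable_R[OF jk(1)] \<phi>_measurable_R[OF jk(2)]
    have "ip ?P (e j) (e k) = (LINT p|?P. (\<lambda>z w. \<phi> j z * cnj (\<phi> k z) * (cnj (\<phi> j w) * \<phi> k w)) (fst p) (snd p))"
      by (simp add: ip_def e_def mult_ac)
    also have "\<dots> = (LINT z|R. LINT w|R. \<phi> j z * cnj (\<phi> k z) * (cnj (\<phi> j w) * \<phi> k w))"
    proof (rule fR.swap_bounded_integral(2)[symmetric])
      show "cmod (\<phi> j z * cnj (\<phi> k z) * (cnj (\<phi> j w) * \<phi> k w)) \<le> 1" for z w
        using \<phi>_bound[OF jk(1)] \<phi>_bound[OF jk(2)] unfolding norm_mult complex_mod_cnj by (intro mult_le_one mult_nonneg_nonneg) auto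
    qed measurable
    also have "\<dots> = ip R (\<phi> j) (\<phi> k) * ip R (\<phi> k) (\<phi> j)"
      by (simp add: ip_def mult.commute)
    also have "\<dots> = (if j = k then of_real ((ev j)\<^sup>2) else 0)"
      using jk by (simp add: ip_\<phi> power2_eq_square)
    finally show ?thesis .
  qed
  have ge: "ip ?P (case_prod gram) (e k) = of_real ((ev k)\<^sup>2)" if k: "k \<in> J" for k
  proof -
    note [measurable] = \<phi>_measurable_R[OF k]
    have "ip ?P (case_prod gram) (e k) = (LINT p|?P. (\<lambda>z w. cnj (\<phi> k z) * (gram z w * \<phi> k w)) (fst p) (snd p))"
      by (simp add: ip_def e_def case_prod_beta' mult_ac)
    also have "\<dots> = (LINT z|R. LINT w|R. cnj (\<phi> k z) * (gram z w * \<phi> k w))"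
    proof (rule fR.swap_bounded_integral(2)[symmetric])
      show "cmod (cnj (\<phi> k z) * (gram z w * \<phi> k w)) \<le> 1" for z w
        using \<phi>_bound[OF k] gram_bound unfolding norm_mult complex_mod_cnj by (intro mult_le_one mult_nonneg_nonneg) auto
    qed measurable
    also have "\<dots> = (LINT z|R. of_real (ev k) * (\<phi> k z * cnj (\<phi> k z)))"
    proof (rule Bochner_Integration.integral_cong[OF refl])
      fix z
      have "(LINT w|R. cnj (\<phi> k z) * (gram z w * \<phi> k w)) = cnj (\<phi> k z) * (LINT w|R. gram z w * \<phi> k w)"
        by (rule integral_mult_right_zero)
      then show "(LINT w|R. cnj (\<phi> k z) * (gram z w * \<phi> k w)) = of_real (ev k) * (\<phi> k z * cnj (\<phi> k z))"
        by (simp add: gram_\<phi>[OF k])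
    qed
    also have "\<dots> = of_real (ev k) * ip R (\<phi> k) (\<phi> k)" unfolding ip_def by (rule integral_mult_right_zero)
    finally show ?thesis using ip_\<phi>[OF k k] by (simp add: power2_eq_square)
  qed
  have "nsq ?P (\<lambda>p. case_prod gram p - (\<Sum>k\<in>{..<m} \<inter> J. 1 * e k p))
      = nsq ?P (case_prod gram) - (\<Sum>k\<in>{..<m} \<inter> J. (ev k)\<^sup>2 * (cmod 1)\<^sup>2)" for m
    by (rule nsq_diff_orthogonal_expansion) (auto simp: gram_sq e_sq ee ge)
  then have eq: "(\<Sum>k\<in>{..<m} \<inter> J. (ev k)\<^sup>2) = nsq ?P (case_prod gram) - nsq ?P (\<lambda>p. case_prod gram p - (\<Sum>n<m. rank_one n (fst p) (snd p)))" for m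
  proof -
    have "(\<Sum>k\<in>{..<m} \<inter> J. e k p) = (\<Sum>n<m. rank_one n (fst p) (snd p))" for p
      unfolding sum.inter_restrict[OF finite_lessThan] by (rule sum.cong) (auto simp: rank_one_def e_def)
    then show ?thesis using \<open>nsq ?P (\<lambda>p. case_prod gram p - (\<Sum>k\<in>{..<m} \<inter> J. 1 * e k p))
      = nsq ?P (case_prod gram) - (\<Sum>k\<in>{..<m} \<inter> J. (ev k)\<^sup>2 * (cmod 1)\<^sup>2)\<close> by simp
  qed
  have "(\<lambda>m. nsq ?P (\<lambda>p. case_prod gram p - (\<Sum>n<m. rank_one n (fst p) (snd p)))) \<longlonglongrightarrow> nsq ?P (case_prod remainder)"
    unfolding nsq_def
  \<comment> \<open>The constant 4 is (1 + 1)^2, from the bounds for the Gram kernel and for the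
    partial sums.\<close>
  proof (rule integral_dominated_convergence[where w = "\<lambda>_. 4"])
    show "AE p in ?P. (\<lambda>m. (cmod (case_prod gram p - (\<Sum>n<m. rank_one n (fst p) (snd p))))\<^sup>2) \<longlonglongrightarrow> (cmod (case_prod remainder p))\<^sup>2"
      unfolding case_prod_beta' remainder_def
      by (intro AE_I2 tendsto_power tendsto_norm tendsto_diff tendsto_const spectral_sum_tendsto)
    show "AE p in ?P. norm ((cmod (case_prod gram p - (\<Sum>n<m. rank_one n (fst p) (snd p))))\<^sup>2) \<le> 4" for m
    proof (rule AE_I2)
      fix p
      have "cmod (gram (fst p) (snd p) - (\<Sum>n<m. rank_one n (fst p) (snd p))) \<le> 2"
        using norm_triangle_ineq4[of "gram (fst p) (snd p)" "\<Sum>n<m. rank_one n (fst p) (snd p)"]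
          gram_bound[of "fst p" "snd p"] partial_bound[of "fst p" "snd p" m] by linarith
      from power_mono[OF this norm_ge_zero, of 2]
      show "norm ((cmod (case_prod gram p - (\<Sum>n<m. rank_one n (fst p) (snd p))))\<^sup>2) \<le> 4"
        by (simp add: case_prod_beta')
    qed
  qed (simp_all, measurable)
  moreover have "nsq ?P (case_prod remainder) = 0"
    unfolding nsq_def using remainder_zero by (intro integral_eq_zero_AE) auto
  ultimately have "(\<lambda>m. nsq ?P (case_prod gram) - nsq ?P (\<lambda>p. case_prod gram p - (\<Sum>n<m. rank_one n (fst p) (snd p))))
      \<longlonglongrightarrow> nsq ?P (case_prod gram) - 0"
    by (intro tendsto_diff tendsto_const) simp
  then show ?thesis unfolding eq by simp
qed

text \<open>With \<open>F\<close> the first \<open>A\<close> indices and \<open>G\<close> the remaining ones, comparing both with \<open>\<lambda>\<^sub>A\<close> gives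
  \<open>\<Sum>\<^sub>G \<lambda>\<^sup>2 \<le> \<lambda>\<^sub>A \<Sum>\<^sub>G \<lambda> \<le> \<lambda>\<^sub>A \<Sum>\<^sub>F (1 - \<lambda>) \<le> \<Sum>\<^sub>F \<lambda> (1 - \<lambda>)\<close>.\<close>

lemma sum_squares_le_head:
  assumes A: "measure PS \<Omega> \<le> real A"
  shows "(\<Sum>k\<in>{..<m} \<inter> J. (ev k)\<^sup>2) \<le> (\<Sum>k\<in>J \<inter> {1..A}. ev k)"
proof -
  let ?F = "J \<inter> {1..A}"
  define G where "G = J \<inter> {A<..<m}"
  have finG: "finite G" by (simp add: G_def)
  have J1: "1 \<le> k" if "k \<in> J" for k using that by (simp add: eig_index_def)
  have ev01: "0 \<le> ev k" "ev k \<le> 1" if "k \<in> J" for k using ev_pos[OF that] ev_le_one[OF that] by auto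
  have sq_le: "(ev k)\<^sup>2 \<le> ev k" if "k \<in> J" for k
    using ev01[OF that] by (simp add: power2_eq_square mult_left_le)
  have "(\<Sum>k\<in>{..<m} \<inter> J. (ev k)\<^sup>2) \<le> (\<Sum>k\<in>?F \<union> G. (ev k)\<^sup>2)"
    using J1 by (intro sum_mono2) (auto simp: G_def)
  also have "\<dots> = (\<Sum>k\<in>?F. (ev k)\<^sup>2) + (\<Sum>k\<in>G. (ev k)\<^sup>2)"
    by (intro sum.union_disjoint) (auto simp: G_def)
  also have "\<dots> \<le> (\<Sum>k\<in>?F. ev k)"
  proof (cases "G = {}")
    case True
    then show ?thesis using sq_le by (auto intro!: sum_mono)
  next
    case False
    \<comment> \<open>A listed index beyond A forces all of 1, ..., A to be listed, because index
      sets are initial segments. The head then has exactly A terms, which makes the sum of 1 - ev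
      over it at least the tail sum.\<close>
    then obtain n where n: "n \<in> J" "A < n" by (auto simp: G_def)
    have "k \<in> J" if "1 \<le> k" "k \<le> A" for k
    proof -
      have "enat k \<le> enat n" using that n by simp
      also have "enat n \<le> N" using n(1) by (simp add: eig_index_def)
      finally show ?thesis using that by (simp add: eig_index_def)
    qed
    then have F_eq: "?F = {1..A}" by auto
    have "0 < ev n" using n(1) by (rule ev_pos)
    moreover have "ev n \<le> measure PS \<Omega>" using sum_ev_le[of "{n}"] n by simp
    \<comment> \<open>A positive eigenvalue not exceeding |Omega| rules out A = 0, so the comparison
      value \<open>ev A\<close> exists.\<close>
    ultimately have "A \<ge> 1" using A by (cases A) auto
    then have "A \<in> ?F" unfolding F_eq by simp
    then have A_J: "A \<in> J" by blast
    have "card ?F = A" unfolding F_eq by simp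
    then have compl: "(\<Sum>k\<in>?F. 1 - ev k) = real A - (\<Sum>k\<in>?F. ev k)" by (simp add: sum_subtractf)
    have total: "(\<Sum>k\<in>?F. ev k) + (\<Sum>k\<in>G. ev k) \<le> real A"
    proof -
      have "(\<Sum>k\<in>?F. ev k) + (\<Sum>k\<in>G. ev k) = (\<Sum>k\<in>?F \<union> G. ev k)"
        by (intro sum.union_disjoint[symmetric]) (auto simp: G_def)
      also have "\<dots> \<le> measure PS \<Omega>" by (rule sum_ev_le) (auto simp: G_def)
      finally show ?thesis using A by linarith
    qed
    have "(\<Sum>k\<in>G. (ev k)\<^sup>2) \<le> (\<Sum>k\<in>G. ev A * ev k)"
      unfolding power2_eq_square using ev01 ev_antimono[OF A_J] by (intro sum_mono mult_right_mono) (auto simp: G_def)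
    also have "\<dots> = ev A * (\<Sum>k\<in>G. ev k)" by (simp add: sum_distrib_left)
    also have "\<dots> \<le> ev A * (\<Sum>k\<in>?F. 1 - ev k)"
      unfolding compl by (rule mult_left_mono) (use total ev01[OF A_J] in argo)+
    also have "\<dots> = (\<Sum>k\<in>?F. ev A * (1 - ev k))" by (simp add: sum_distrib_left)
    also have "\<dots> \<le> (\<Sum>k\<in>?F. ev k * (1 - ev k))"
      using ev01 ev_antimono[OF _ A_J] by (intro sum_mono mult_right_mono) auto
    also have "\<dots> = (\<Sum>k\<in>?F. ev k) - (\<Sum>k\<in>?F. (ev k)\<^sup>2)"
      by (simp add: right_diff_distrib sum_subtractf power2_eq_square)
    finally show ?thesis by simp
  qed
  finally show ?thesis .
qed

lemma gram_le_head:
  assumes "measure PS \<Omega> \<le> real A"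
  shows "nsq (R \<Otimes>\<^sub>M R) (case_prod gram) \<le> (\<Sum>k\<in>J \<inter> {1..A}. ev k)"
  using sum_squares_le_head[OF assms] by (intro LIMSEQ_le_const2[OF sum_ev_squares]) auto

section \<open>Distance between the accumulated spectrogram and the indicator\<close>

abbreviation "\<rho> \<equiv> acc_spectrogram d g \<Omega> N h"

lemma acc_spectrogram_range: "0 \<le> \<rho> z" "\<rho> z \<le> 1"
  unfolding acc_spectrogram_def by (auto intro!: sum_nonneg \<phi>_Bessel)

text \<open>The integral of \<rho> is at most A, hence at most |Omega| + 1, while its integral over
  Omega is the sum of the first A eigenvalues. \<open>gram_le_head\<close> bounds that sum from
  below.\<close>

lemma acc_spectrogram_L1:
  shows "integrable PS (\<lambda>z. \<bar>\<rho> z - indicator \<Omega> z\<bar>)"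
    and "(LINT z|PS. \<bar>\<rho> z - indicator \<Omega> z\<bar>) \<le> 2 * (measure PS \<Omega> - nsq (R \<Otimes>\<^sub>M R) (case_prod gram)) + 1"
proof -
  define A where "A = nat \<lceil>measure PS \<Omega>\<rceil>"
  have A: "measure PS \<Omega> \<le> real A" "real A \<le> measure PS \<Omega> + 1"
  proof -
    have "0 \<le> \<lceil>measure PS \<Omega>\<rceil>" by (simp add: ceiling_le_zero[symmetric] le_ceiling_iff order_less_le_trans[OF _ measure_nonneg])
    then have "real A = of_int \<lceil>measure PS \<Omega>\<rceil>" by (simp add: A_def)
    then show "measure PS \<Omega> \<le> real A" "real A \<le> measure PS \<Omega> + 1" by linarith+
  qed
  let ?F = "J \<inter> {1..A}"
  have \<rho>: "\<rho> z = (\<Sum>k\<in>?F. (cmod (\<phi> k z))\<^sup>2)" for z by (simp add: acc_spectrogram_def A_def)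
  have \<rho>_int: "integrable PS \<rho>" unfolding \<rho>[abs_def] using \<phi>_integrable by auto
  have \<Omega>_int: "integrable PS (indicator \<Omega> :: _ \<Rightarrow> real)" using \<Omega>_finite by simp
  have \<Omega>\<rho>_int: "integrable PS (\<lambda>z. indicator \<Omega> z * \<rho> z)"
    using integrable_mult_indicator[OF \<Omega>_sets \<rho>_int] by simp
  \<comment> \<open>Since 0 <= \<rho> <= 1, the difference is \<rho> outside Omega and 1 - \<rho>
    inside.\<close>
  have abs_eq: "\<bar>\<rho> z - indicator \<Omega> z\<bar> = \<rho> z + indicator \<Omega> z - 2 * (indicator \<Omega> z * \<rho> z)" for z
    using acc_spectrogram_range[of z] by (cases "z \<in> \<Omega>") auto
  show "integrable PS (\<lambda>z. \<bar>\<rho> z - indicator \<Omega> z\<bar>)"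
    using \<rho>_int \<Omega>_int by auto
  have "(LINT z|PS. \<bar>\<rho> z - indicator \<Omega> z\<bar>) = (LINT z|PS. \<rho> z) + measure PS \<Omega> - 2 * (LINT z|PS. indicator \<Omega> z * \<rho> z)"
    unfolding abs_eq using \<rho>_int \<Omega>_int \<Omega>\<rho>_int \<Omega>_sub by (simp add: Int_absorb2)
  moreover have "(LINT z|PS. \<rho> z) \<le> real A"
  proof -
    have "(LINT z|PS. \<rho> z) = (\<Sum>k\<in>?F. LINT z|PS. (cmod (\<phi> k z))\<^sup>2)"
      unfolding \<rho> using \<phi>_integrable by (intro Bochner_Integration.integral_sum) auto
    also have "\<dots> \<le> (\<Sum>k\<in>?F. 1)" using \<phi>_norm_le by (intro sum_mono) auto
    also have "\<dots> \<le> real A" using card_mono[of "{1..A}" ?F] by simp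
    finally show ?thesis .
  qed
  moreover have "(LINT z|PS. indicator \<Omega> z * \<rho> z) = (\<Sum>k\<in>?F. ev k)"
  proof -
    have "(LINT z|PS. indicator \<Omega> z * \<rho> z) = (LINT z|R. \<rho> z)" by (simp add: integral_R)
    also have "\<dots> = (\<Sum>k\<in>?F. LINT z|R. (cmod (\<phi> k z))\<^sup>2)"
      unfolding \<rho> using sq_int_integrable[OF \<phi>_sq] by (intro Bochner_Integration.integral_sum) auto
    also have "\<dots> = (\<Sum>k\<in>?F. ev k)" by (intro sum.cong) (auto simp: ev_eq nsq_def)
    finally show ?thesis .
  qed
  ultimately show "(LINT z|PS. \<bar>\<rho> z - indicator \<Omega> z\<bar>) \<le> 2 * (measure PS \<Omega> - nsq (R \<Otimes>\<^sub>M R) (case_prod gram)) + 1"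
    using gram_le_head[OF A(1)] A(2) by argo
qed

lemma acc_spectrogram_weak:
  assumes bd: "measure PS \<Omega> - nsq (R \<Otimes>\<^sub>M R) (case_prod gram) \<le> P" and P: "1 \<le> P" and \<delta>: "0 < \<delta>"
  shows "emeasure PS {z \<in> space PS. \<bar>\<rho> z - indicator \<Omega> z\<bar> > \<delta>} \<le> ennreal (3 * P / \<delta>\<^sup>2)"
proof (cases "\<delta> < 1")
  case False
  have le: "\<bar>\<rho> z - indicator \<Omega> z\<bar> \<le> 1" for z
    using acc_spectrogram_range[of z] by (auto simp: indicator_def)
  have empty: "{z \<in> space PS. \<bar>\<rho> z - indicator \<Omega> z\<bar> > \<delta>} = {}"
  proof (rule equals0I)
    fix z assume "z \<in> {z \<in> space PS. \<bar>\<rho> z - indicator \<Omega> z\<bar> > \<delta>}"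
    then show False using le[of z] False by simp
  qed
  show ?thesis unfolding empty by simp
next
  case True
  have [measurable]: "(\<lambda>z. \<bar>\<rho> z - indicator \<Omega> z\<bar>) \<in> borel_measurable PS"
    using acc_spectrogram_L1(1) by (rule borel_measurable_integrable)
  have "emeasure PS {z \<in> space PS. \<bar>\<rho> z - indicator \<Omega> z\<bar> > \<delta>} \<le> emeasure PS {z \<in> space PS. \<bar>\<rho> z - indicator \<Omega> z\<bar> \<ge> \<delta>}"
    by (intro emeasure_mono) auto
  also have "\<dots> \<le> ennreal (1 / \<delta> * (LINT z|PS. \<bar>\<rho> z - indicator \<Omega> z\<bar>))"
    using integral_Markov_inequality[OF acc_spectrogram_L1(1), of \<delta>] \<delta> by simp
  also have "\<dots> \<le> ennreal (3 * P / \<delta>\<^sup>2)"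
  proof (rule ennreal_leI)
    have "1 / \<delta> * (LINT z|PS. \<bar>\<rho> z - indicator \<Omega> z\<bar>) \<le> 1 / \<delta> * (3 * P)"
      using acc_spectrogram_L1(2) bd P \<delta> by (intro mult_left_mono) auto
    also have "\<dots> \<le> 1 / \<delta>\<^sup>2 * (3 * P)"
    proof (rule mult_right_mono)
      have "\<delta>\<^sup>2 \<le> \<delta>" using \<delta> True by (simp add: power2_eq_square mult_left_le)
      then show "1 / \<delta> \<le> 1 / \<delta>\<^sup>2" using \<delta> by (intro divide_left_mono) auto
    qed (use P in simp)
    finally show "1 / \<delta> * (LINT z|PS. \<bar>\<rho> z - indicator \<Omega> z\<bar>) \<le> 3 * P / \<delta>\<^sup>2" by simp
  qed
  finally show ?thesis .
qed

end

theorem theorem1p5: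
  "\<exists>C::real. C > 0 \<and>
    (\<forall>(d::nat) (g::(nat \<Rightarrow> real) \<Rightarrow> complex) (\<Omega>::(nat \<Rightarrow> real) set)
       (N::enat) (ev::nat \<Rightarrow> real) (h::nat \<Rightarrow> (nat \<Rightarrow> real) \<Rightarrow> complex).
       d \<ge> 1 \<longrightarrow> g \<in> Mstar d \<longrightarrow> l2norm d g = 1 \<longrightarrow>
       compactin (euc_top (2 * d)) \<Omega> \<longrightarrow> finite_perimeter (2 * d) \<Omega> \<longrightarrow>
       (Mstar_norm d g)\<^sup>2 * perimeter (2 * d) \<Omega> \<ge> 1 \<longrightarrow>
       eigensystem d g \<Omega> N ev h \<longrightarrow>
       (\<forall>\<delta>::real. \<delta> > 0 \<longrightarrow>
          emeasure (leb (2 * d))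
            {z \<in> space (leb (2 * d)). \<bar>acc_spectrogram d g \<Omega> N h z - indicator \<Omega> z\<bar> > \<delta>}
          \<le> ennreal (C / \<delta>\<^sup>2 * (Mstar_norm d g)\<^sup>2 * perimeter (2 * d) \<Omega>)))"
proof (rule exI[of _ 3], intro conjI allI impI)
  fix d :: nat and g :: "(nat \<Rightarrow> real) \<Rightarrow> complex" and \<Omega> :: "(nat \<Rightarrow> real) set"
    and N :: enat and ev :: "nat \<Rightarrow> real" and h :: "nat \<Rightarrow> (nat \<Rightarrow> real) \<Rightarrow> complex" and \<delta> :: real
  assume gM: "g \<in> Mstar d" and gn: "l2norm d g = 1" and comp: "compactin (euc_top (2 * d)) \<Omega>"
    and fin: "finite_perimeter (2 * d) \<Omega>" and P: "1 \<le> (Mstar_norm d g)\<^sup>2 * perimeter (2 * d) \<Omega>"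
    and eig: "eigensystem d g \<Omega> N ev h" and \<delta>: "0 < \<delta>"
  have sub: "\<Omega> \<subseteq> space (leb (2 * d))"
    using compactin_subset_topspace[OF comp] by (simp add: space_leb euc_top_def)
  have \<Omega>_int: "integrable (leb (2 * d)) (indicator \<Omega> :: _ \<Rightarrow> real)"
    using fin by (simp add: finite_perimeter_def)
  interpret tf_eigensystem d g \<Omega> N ev h
  proof
    show "sq_int (leb d) g" using gM by (simp add: Mstar_def L2_def sq_int_def)
    show "nsq (leb d) g = 1" using gn by (simp add: l2norm_def nsq_def)
    show "\<Omega> \<in> sets (leb (2 * d))" "emeasure (leb (2 * d)) \<Omega> < \<infinity>"
      using \<Omega>_int sub by (simp_all add: integrable_indicator_iff Int_absorb2)
    show "eigensystem d g \<Omega> N ev h" by (rule eig)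
  qed
  have Ms: "integrable (leb (2 * d)) (\<lambda>z. L2_set z {..<2 * d} * (cmod (stft d g g z))\<^sup>2)"
    using gM by (simp add: Mstar_def)
  have norm_eq: "(Mstar_norm d g)\<^sup>2 = (LINT z|leb (2 * d). L2_set z {..<2 * d} * (cmod (stft d g g z))\<^sup>2)"
    unfolding Mstar_norm_def by (rule real_sqrt_pow2) (intro integral_nonneg_AE, simp)
  \<comment> \<open>The perimeter is a real conversion of an extended supremum. Its sign is read off
    from the hypothesis: a negative value would make the product with the squared norm non-positive
    instead of at least 1.\<close>
  have per: "0 \<le> perimeter (2 * d) \<Omega>"
  proof (rule ccontr)
    assume "\<not> 0 \<le> perimeter (2 * d) \<Omega>"
    then have "(Mstar_norm d g)\<^sup>2 * perimeter (2 * d) \<Omega> \<le> 0" by (intro mult_nonneg_nonpos) auto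
    with P show False by linarith
  qed
  show "emeasure (leb (2 * d)) {z \<in> space (leb (2 * d)). \<bar>acc_spectrogram d g \<Omega> N h z - indicator \<Omega> z\<bar> > \<delta>}
      \<le> ennreal (3 / \<delta>\<^sup>2 * (Mstar_norm d g)\<^sup>2 * perimeter (2 * d) \<Omega>)"
    using acc_spectrogram_weak[OF measure_minus_gram_le[OF Ms comp fin per] _ \<delta>] P
    by (simp add: norm_eq mult_ac)
qed simp

end
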